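(* Let $q$ be a positive odd integer, $\nu=1/q$, $G=\mathbb{Z}^2\times[\mathrm{U}(1)_f\rtimes\mathbb{Z}_2^T]$, and let $\mathcal{A}\in mG^{(\nu)}_{\mathrm{GSD}}$, i.e. $\mathcal{A}\in\mathrm{SET}_{G,\nu}$ and $|\mathcal{A}|\le|\mathcal{C}'|$ for all $\mathcal{C}'\in\mathrm{SET}_{G,\nu}$. Then, as a topological order, $\mathcal{A}$ must be $\mathbb{Z}_q$ gauge theory stacked with $\{1,c\}$.
   Context: A fermionic topological order (TO) $\mathcal{C}$ is a unitary braided fusion category (with its canonical ribbon structure) with finitely many simple objects, called anyons, whose only anyons braiding trivially with all anyons are $1$ (the vacuum) and $c$ (the fundamental fermion), where $c\times c=1$ and $\theta_c=\pi$. Here $e^{i\theta_x}$ is the twist (topological spin) of $x$; $d_x$ is its quantum dimension; $x$ is Abelian if $d_x=1$; if $x$ or $y$ is Abelian, the full braiding of $x$ around $y$ is a phase $e^{i\theta_{x,y}}$. $|\mathcal{C}|$ is the number of anyons, with $c$ counted as an anyon. $\mathcal{D}_{\mathcal{C}}=\sqrt{\sum_x d_x^2}$. $\mathbb{Z}_N$ gauge theory stacked with $\{1,c\}$ is the Abelian TO (all anyons Abelian) whose anyons form the group $\mathbb{Z}_N\times\mathbb{Z}_N\times\mathbb{Z}_2$, with $\theta_{(r,s,k)}=2\pi rs/N+\pi k$ and $c=(0,0,1)$. Two Abelian TOs are the same if there is a group isomorphism between their anyon groups preserving $\theta$. An element of $\mathrm{SET}_{G,\nu}$ is a fermionic TO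 $\mathcal{C}$ together with the following data. (1) Charges $Q_x\in\mathbb{R}/2\mathbb{Z}$ for each anyon with $Q_z=Q_x+Q_y$ whenever $z$ occurs in $x\times y$, $Q_1=0$ and $Q_c=1$. (2) An Abelian anyon $v$ (the vison) with $\theta_{v,x}=2\pi Q_x$ mod $2\pi$ for all anyons $x$, $\theta_v=\pi\sigma_H$ and $Q_v=\sigma_H$ mod $2$, where $\sigma_H$ is the Hall conductance; time-reversal symmetry forces $\sigma_H=0$ and chiral central charge $c_-=0$, so $\theta_v=0$, $Q_v=0$, and the relation $e^{2\pi i(c_--\sigma_H)/8}=\frac{1}{\sqrt2\,\mathcal{D}_{\mathcal{C}}}\sum_{x\in\mathcal{C}}d_x^2e^{i(\theta_x+\pi Q_x)}$, valid for any $\mathrm{U}(1)_f$-symmetric fermionic TO, holds with left-hand side $1$. (3) An Abelian anyon $a$ (the background anyon) with $Q_a=\nu$ mod $2$. (4) Time reversal: a permutation $\mathcal{T}$ of the anyons with $\mathcal{T}^2=\mathrm{id}$, preserving fusion rules, with $\theta_{\mathcal{T}x}=-\theta_x$, $\mathcal{T}c=c$, $Q_{\mathcal{T}x}=Q_x$. (5) Translations: an action of $\mathbb{Z}^2$ on the anyons generated by permutations $T_x,T_y$, commuting with $\mathcal{T}$, preserving fusion rules, topological spins, $c$, and charges. (6) Time-reversal invariance of the background: $\theta_{a,d}=\theta_{\mathcal{T}a,d}$ for every anyon $d$ with $T_xd=d=T_yd$. *)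

theory Defs
  imports Complex_Main "HOL-Library.Real_Mod" "HOL-Algebra.Elementary_Groups"
begin

section \<open>Unitary braided fusion categories\<close>

text \<open>
  Morphisms \<open>X \<rightarrow> Y\<close> form the set \<open>Hom C X Y\<close>; composition \<open>g \<Zcomp> f\<close> is in
  applicative order (first \<open>f\<close>). All operations are only constrained on objects in \<open>Obj C\<close>
  and on composable morphisms. Different hom sets need not be disjoint.
\<close>

record ('o, 'm) braided_data =
  Obj    :: "'o set"
  Hom    :: "'o \<Rightarrow> 'o \<Rightarrow> 'm set"
  ident  :: "'o \<Rightarrow> 'm"                   (\<open>\<i>\<index>\<close>)
  cmp    :: "'m \<Rightarrow> 'm \<Rightarrow> 'm"             (infixr \<open>\<Zcomp>\<index>\<close> 60)
  nul    :: "'o \<Rightarrow> 'o \<Rightarrow> 'm"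
  plus_m :: "'m \<Rightarrow> 'm \<Rightarrow> 'm"             (infixl \<open>\<oplus>m\<index>\<close> 55)
  scale  :: "complex \<Rightarrow> 'm \<Rightarrow> 'm"        (infixr \<open>\<cdot>\<index>\<close> 58)
  dag    :: "'m \<Rightarrow> 'm"                   (\<open>_\<dagger>\<index>\<close> [1000] 999)
  tens_o :: "'o \<Rightarrow> 'o \<Rightarrow> 'o"             (infixl \<open>\<odot>\<index>\<close> 70)
  tens_m :: "'m \<Rightarrow> 'm \<Rightarrow> 'm"             (infixl \<open>\<boxtimes>\<index>\<close> 65)
  unit_o :: "'o"                         (\<open>\<I>\<index>\<close>)
  assoc  :: "'o \<Rightarrow> 'o \<Rightarrow> 'o \<Rightarrow> 'm"       (\<open>\<a>\<index>\<close>)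
  lunit  :: "'o \<Rightarrow> 'm"                   (\<open>\<l>\<index>\<close>)
  runit  :: "'o \<Rightarrow> 'm"                   (\<open>\<r>\<index>\<close>)
  braid  :: "'o \<Rightarrow> 'o \<Rightarrow> 'm"             (\<open>\<c>\<index>\<close>)
  twist  :: "'o \<Rightarrow> 'm"                   (\<open>\<t>\<index>\<close>)

context
  fixes C :: "('o, 'm) braided_data" (structure)
begin

definition unitary :: "'o \<Rightarrow> 'o \<Rightarrow> 'm \<Rightarrow> bool" where
  "unitary X Y f \<longleftrightarrow> f \<in> Hom C X Y \<and> f\<dagger> \<Zcomp> f = \<i> X \<and> f \<Zcomp> f\<dagger> = \<i> Y"

definition isomorphic :: "'o \<Rightarrow> 'o \<Rightarrow> bool" where
  "isomorphic X Y \<longleftrightarrow>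
     (\<exists>f\<in>Hom C X Y. \<exists>g\<in>Hom C Y X. g \<Zcomp> f = \<i> X \<and> f \<Zcomp> g = \<i> Y)"

definition zero_object :: "'o \<Rightarrow> bool" where
  "zero_object Z \<longleftrightarrow> Z \<in> Obj C \<and> \<i> Z = nul C Z Z"

definition direct_sum :: "'o \<Rightarrow> 'o \<Rightarrow> 'o \<Rightarrow> bool" where
  "direct_sum Z X Y \<longleftrightarrow> Z \<in> Obj C \<and> (\<exists>i\<in>Hom C X Z. \<exists>j\<in>Hom C Y Z.
     i\<dagger> \<Zcomp> i = \<i> X \<and> j\<dagger> \<Zcomp> j = \<i> Y \<and> i\<dagger> \<Zcomp> j = nul C Y X \<and>
     (i \<Zcomp> i\<dagger>) \<oplus>m (j \<Zcomp> j\<dagger>) = \<i> Z)"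

text \<open>Simplicity over the complex numbers in the usual operator-algebraic form
  \<open>End(X) = \<complex> id\<close>, \<open>X\<close> nonzero.\<close>

definition simple :: "'o \<Rightarrow> bool" where
  "simple X \<longleftrightarrow> X \<in> Obj C \<and> \<i> X \<noteq> nul C X X \<and> (\<forall>f\<in>Hom C X X. \<exists>k. f = k \<cdot> \<i> X)"

inductive sum_of_simples :: "'o \<Rightarrow> bool" where
  zero: "zero_object Z \<Longrightarrow> sum_of_simples Z"
| add: "sum_of_simples X \<Longrightarrow> simple S \<Longrightarrow> direct_sum Z X S \<Longrightarrow> sum_of_simples Z"

text \<open>\<open>Y\<close> is a dual of \<open>X\<close>, with coevaluation \<open>\<I> \<rightarrow> X \<odot> Y\<close> and evaluation \<open>Y \<odot> X \<rightarrow> \<I>\<close>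
  satisfying both zigzag identities.\<close>

definition dual_pair :: "'o \<Rightarrow> 'o \<Rightarrow> 'm \<Rightarrow> 'm \<Rightarrow> bool" where
  "dual_pair X Y coev ev \<longleftrightarrow> X \<in> Obj C \<and> Y \<in> Obj C \<and>
     coev \<in> Hom C \<I> (X \<odot> Y) \<and> ev \<in> Hom C (Y \<odot> X) \<I> \<and>
     \<r> X \<Zcomp> (\<i> X \<boxtimes> ev) \<Zcomp> \<a> X Y X \<Zcomp> (coev \<boxtimes> \<i> X) \<Zcomp> (\<l> X)\<dagger> = \<i> X \<and>
     \<l> Y \<Zcomp> (ev \<boxtimes> \<i> Y) \<Zcomp> (\<a> Y X Y)\<dagger> \<Zcomp> (\<i> Y \<boxtimes> coev) \<Zcomp> (\<r> Y)\<dagger> = \<i> Y"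

text \<open>For simple \<open>X\<close> this is a standard solution of the conjugate equations
  (Longo--Roberts): it exists and is unique up to a unitary of \<open>Y\<close> and a phase.\<close>

definition normalized_dual :: "'o \<Rightarrow> 'o \<Rightarrow> 'm \<Rightarrow> 'm \<Rightarrow> bool" where
  "normalized_dual X Y coev ev \<longleftrightarrow> dual_pair X Y coev ev \<and> coev\<dagger> \<Zcomp> coev = ev \<Zcomp> ev\<dagger>"

end

text \<open>The condition \<open>f\<dagger> \<Zcomp> f = 0 \<Longrightarrow> f = 0\<close> is positivity of a *-category in the sense of
  Mueger; with orthogonal direct sums and finite-dimensional hom spaces (which here follow from
  semisimplicity) it is the C*-condition.\<close>

locale unitary_semisimple_category =
  fixes C :: "('o, 'm) braided_data" (structure)
  assumes ident_in: "X \<in> Obj C \<Longrightarrow> \<i> X \<in> Hom C X X"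
    and cmp_in: "\<lbrakk>X \<in> Obj C; Y \<in> Obj C; Z \<in> Obj C; f \<in> Hom C X Y; g \<in> Hom C Y Z\<rbrakk>
      \<Longrightarrow> g \<Zcomp> f \<in> Hom C X Z"
    and cmp_ident_left: "\<lbrakk>X \<in> Obj C; Y \<in> Obj C; f \<in> Hom C X Y\<rbrakk> \<Longrightarrow> \<i> Y \<Zcomp> f = f"
    and cmp_ident_right: "\<lbrakk>X \<in> Obj C; Y \<in> Obj C; f \<in> Hom C X Y\<rbrakk> \<Longrightarrow> f \<Zcomp> \<i> X = f"
    and cmp_assoc: "\<lbrakk>W \<in> Obj C; X \<in> Obj C; Y \<in> Obj C; Z \<in> Obj C;
      f \<in> Hom C W X; g \<in> Hom C X Y; h \<in> Hom C Y Z\<rbrakk> \<Longrightarrow> (h \<Zcomp> g) \<Zcomp> f = h \<Zcomp> (g \<Zcomp> f)"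
    \<comment> \<open>complex-linear structure\<close>
    and nul_in: "\<lbrakk>X \<in> Obj C; Y \<in> Obj C\<rbrakk> \<Longrightarrow> nul C X Y \<in> Hom C X Y"
    and plus_in: "\<lbrakk>X \<in> Obj C; Y \<in> Obj C; f \<in> Hom C X Y; g \<in> Hom C X Y\<rbrakk> \<Longrightarrow> f \<oplus>m g \<in> Hom C X Y"
    and scale_in: "\<lbrakk>X \<in> Obj C; Y \<in> Obj C; f \<in> Hom C X Y\<rbrakk> \<Longrightarrow> k \<cdot> f \<in> Hom C X Y"
    and plus_assoc: "\<lbrakk>X \<in> Obj C; Y \<in> Obj C; f \<in> Hom C X Y; g \<in> Hom C X Y; h \<in> Hom C X Y\<rbrakk>
      \<Longrightarrow> (f \<oplus>m g) \<oplus>m h = f \<oplus>m (g \<oplus>m h)"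
    and plus_comm: "\<lbrakk>X \<in> Obj C; Y \<in> Obj C; f \<in> Hom C X Y; g \<in> Hom C X Y\<rbrakk> \<Longrightarrow> f \<oplus>m g = g \<oplus>m f"
    and plus_nul: "\<lbrakk>X \<in> Obj C; Y \<in> Obj C; f \<in> Hom C X Y\<rbrakk> \<Longrightarrow> f \<oplus>m nul C X Y = f"
    and plus_neg: "\<lbrakk>X \<in> Obj C; Y \<in> Obj C; f \<in> Hom C X Y\<rbrakk> \<Longrightarrow> f \<oplus>m (-1) \<cdot> f = nul C X Y"
    and scale_one: "\<lbrakk>X \<in> Obj C; Y \<in> Obj C; f \<in> Hom C X Y\<rbrakk> \<Longrightarrow> 1 \<cdot> f = f"
    and scale_scale: "\<lbrakk>X \<in> Obj C; Y \<in> Obj C; f \<in> Hom C X Y\<rbrakk> \<Longrightarrow> k \<cdot> (k' \<cdot> f) = (k * k') \<cdot> f"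
    and scale_plus: "\<lbrakk>X \<in> Obj C; Y \<in> Obj C; f \<in> Hom C X Y; g \<in> Hom C X Y\<rbrakk>
      \<Longrightarrow> k \<cdot> (f \<oplus>m g) = (k \<cdot> f) \<oplus>m (k \<cdot> g)"
    and plus_scale: "\<lbrakk>X \<in> Obj C; Y \<in> Obj C; f \<in> Hom C X Y\<rbrakk>
      \<Longrightarrow> (k + k') \<cdot> f = (k \<cdot> f) \<oplus>m (k' \<cdot> f)"
    and cmp_plus_left: "\<lbrakk>X \<in> Obj C; Y \<in> Obj C; Z \<in> Obj C; f \<in> Hom C X Y; g \<in> Hom C Y Z; h \<in> Hom C Y Z\<rbrakk>
      \<Longrightarrow> (g \<oplus>m h) \<Zcomp> f = (g \<Zcomp> f) \<oplus>m (h \<Zcomp> f)"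
    and cmp_plus_right: "\<lbrakk>X \<in> Obj C; Y \<in> Obj C; Z \<in> Obj C; f \<in> Hom C X Y; g \<in> Hom C X Y; h \<in> Hom C Y Z\<rbrakk>
      \<Longrightarrow> h \<Zcomp> (f \<oplus>m g) = (h \<Zcomp> f) \<oplus>m (h \<Zcomp> g)"
    and cmp_scale_left: "\<lbrakk>X \<in> Obj C; Y \<in> Obj C; Z \<in> Obj C; f \<in> Hom C X Y; g \<in> Hom C Y Z\<rbrakk>
      \<Longrightarrow> (k \<cdot> g) \<Zcomp> f = k \<cdot> (g \<Zcomp> f)"
    and cmp_scale_right: "\<lbrakk>X \<in> Obj C; Y \<in> Obj C; Z \<in> Obj C; f \<in> Hom C X Y; g \<in> Hom C Y Z\<rbrakk>
      \<Longrightarrow> g \<Zcomp> (k \<cdot> f) = k \<cdot> (g \<Zcomp> f)"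
    \<comment> \<open>positive dagger\<close>
    and dag_in: "\<lbrakk>X \<in> Obj C; Y \<in> Obj C; f \<in> Hom C X Y\<rbrakk> \<Longrightarrow> f\<dagger> \<in> Hom C Y X"
    and dag_dag: "\<lbrakk>X \<in> Obj C; Y \<in> Obj C; f \<in> Hom C X Y\<rbrakk> \<Longrightarrow> (f\<dagger>)\<dagger> = f"
    and dag_cmp: "\<lbrakk>X \<in> Obj C; Y \<in> Obj C; Z \<in> Obj C; f \<in> Hom C X Y; g \<in> Hom C Y Z\<rbrakk>
      \<Longrightarrow> (g \<Zcomp> f)\<dagger> = f\<dagger> \<Zcomp> g\<dagger>"
    and dag_plus: "\<lbrakk>X \<in> Obj C; Y \<in> Obj C; f \<in> Hom C X Y; g \<in> Hom C X Y\<rbrakk>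
      \<Longrightarrow> (f \<oplus>m g)\<dagger> = f\<dagger> \<oplus>m g\<dagger>"
    and dag_scale: "\<lbrakk>X \<in> Obj C; Y \<in> Obj C; f \<in> Hom C X Y\<rbrakk> \<Longrightarrow> (k \<cdot> f)\<dagger> = cnj k \<cdot> f\<dagger>"
    and dag_positive: "\<lbrakk>X \<in> Obj C; Y \<in> Obj C; f \<in> Hom C X Y; f\<dagger> \<Zcomp> f = nul C X X\<rbrakk>
      \<Longrightarrow> f = nul C X Y"
    \<comment> \<open>finite direct sums and semisimplicity\<close>
    and ex_zero: "\<exists>Z. zero_object C Z"
    and ex_direct_sum: "\<lbrakk>X \<in> Obj C; Y \<in> Obj C\<rbrakk> \<Longrightarrow> \<exists>Z. direct_sum C Z X Y"
    and semisimple: "X \<in> Obj C \<Longrightarrow> sum_of_simples C X"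

locale unitary_fusion_category = unitary_semisimple_category +
  assumes tens_o_in: "\<lbrakk>X \<in> Obj C; Y \<in> Obj C\<rbrakk> \<Longrightarrow> X \<odot> Y \<in> Obj C"
    and tens_m_in: "\<lbrakk>X \<in> Obj C; X' \<in> Obj C; Y \<in> Obj C; Y' \<in> Obj C; f \<in> Hom C X X'; g \<in> Hom C Y Y'\<rbrakk>
      \<Longrightarrow> f \<boxtimes> g \<in> Hom C (X \<odot> Y) (X' \<odot> Y')"
    and tens_ident: "\<lbrakk>X \<in> Obj C; Y \<in> Obj C\<rbrakk> \<Longrightarrow> \<i> X \<boxtimes> \<i> Y = \<i> (X \<odot> Y)"
    and tens_cmp: "\<lbrakk>X \<in> Obj C; X' \<in> Obj C; X'' \<in> Obj C; Y \<in> Obj C; Y' \<in> Obj C; Y'' \<in> Obj C;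
        f \<in> Hom C X X'; f' \<in> Hom C X' X''; g \<in> Hom C Y Y'; g' \<in> Hom C Y' Y''\<rbrakk>
      \<Longrightarrow> (f' \<Zcomp> f) \<boxtimes> (g' \<Zcomp> g) = (f' \<boxtimes> g') \<Zcomp> (f \<boxtimes> g)"
    and tens_plus_left: "\<lbrakk>X \<in> Obj C; X' \<in> Obj C; Y \<in> Obj C; Y' \<in> Obj C;
        f \<in> Hom C X X'; f' \<in> Hom C X X'; g \<in> Hom C Y Y'\<rbrakk>
      \<Longrightarrow> (f \<oplus>m f') \<boxtimes> g = (f \<boxtimes> g) \<oplus>m (f' \<boxtimes> g)"
    and tens_plus_right: "\<lbrakk>X \<in> Obj C; X' \<in> Obj C; Y \<in> Obj C; Y' \<in> Obj C;
        f \<in> Hom C X X'; g \<in> Hom C Y Y'; g' \<in> Hom C Y Y'\<rbrakk>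
      \<Longrightarrow> f \<boxtimes> (g \<oplus>m g') = (f \<boxtimes> g) \<oplus>m (f \<boxtimes> g')"
    and tens_scale_left: "\<lbrakk>X \<in> Obj C; X' \<in> Obj C; Y \<in> Obj C; Y' \<in> Obj C; f \<in> Hom C X X'; g \<in> Hom C Y Y'\<rbrakk>
      \<Longrightarrow> (k \<cdot> f) \<boxtimes> g = k \<cdot> (f \<boxtimes> g)"
    and tens_scale_right: "\<lbrakk>X \<in> Obj C; X' \<in> Obj C; Y \<in> Obj C; Y' \<in> Obj C; f \<in> Hom C X X'; g \<in> Hom C Y Y'\<rbrakk>
      \<Longrightarrow> f \<boxtimes> (k \<cdot> g) = k \<cdot> (f \<boxtimes> g)"
    and tens_dag: "\<lbrakk>X \<in> Obj C; X' \<in> Obj C; Y \<in> Obj C; Y' \<in> Obj C; f \<in> Hom C X X'; g \<in> Hom C Y Y'\<rbrakk>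
      \<Longrightarrow> (f \<boxtimes> g)\<dagger> = f\<dagger> \<boxtimes> g\<dagger>"
    and unit_in: "\<I> \<in> Obj C"
    and unit_simple: "simple C \<I>"
    and assoc_unitary: "\<lbrakk>X \<in> Obj C; Y \<in> Obj C; Z \<in> Obj C\<rbrakk>
      \<Longrightarrow> unitary C ((X \<odot> Y) \<odot> Z) (X \<odot> (Y \<odot> Z)) (\<a> X Y Z)"
    and assoc_natural: "\<lbrakk>X \<in> Obj C; X' \<in> Obj C; Y \<in> Obj C; Y' \<in> Obj C; Z \<in> Obj C; Z' \<in> Obj C;
        f \<in> Hom C X X'; g \<in> Hom C Y Y'; h \<in> Hom C Z Z'\<rbrakk>
      \<Longrightarrow> \<a> X' Y' Z' \<Zcomp> ((f \<boxtimes> g) \<boxtimes> h) = (f \<boxtimes> (g \<boxtimes> h)) \<Zcomp> \<a> X Y Z"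
    and lunit_unitary: "X \<in> Obj C \<Longrightarrow> unitary C (\<I> \<odot> X) X (\<l> X)"
    and lunit_natural: "\<lbrakk>X \<in> Obj C; X' \<in> Obj C; f \<in> Hom C X X'\<rbrakk>
      \<Longrightarrow> \<l> X' \<Zcomp> (\<i> \<I> \<boxtimes> f) = f \<Zcomp> \<l> X"
    and runit_unitary: "X \<in> Obj C \<Longrightarrow> unitary C (X \<odot> \<I>) X (\<r> X)"
    and runit_natural: "\<lbrakk>X \<in> Obj C; X' \<in> Obj C; f \<in> Hom C X X'\<rbrakk>
      \<Longrightarrow> \<r> X' \<Zcomp> (f \<boxtimes> \<i> \<I>) = f \<Zcomp> \<r> X"
    and pentagon: "\<lbrakk>W \<in> Obj C; X \<in> Obj C; Y \<in> Obj C; Z \<in> Obj C\<rbrakk>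
      \<Longrightarrow> \<a> W X (Y \<odot> Z) \<Zcomp> \<a> (W \<odot> X) Y Z =
          (\<i> W \<boxtimes> \<a> X Y Z) \<Zcomp> \<a> W (X \<odot> Y) Z \<Zcomp> (\<a> W X Y \<boxtimes> \<i> Z)"
    and triangle: "\<lbrakk>X \<in> Obj C; Y \<in> Obj C\<rbrakk> \<Longrightarrow> (\<i> X \<boxtimes> \<l> Y) \<Zcomp> \<a> X \<I> Y = \<r> X \<boxtimes> \<i> Y"
    and rigid: "X \<in> Obj C \<Longrightarrow> \<exists>Y coev ev. dual_pair C X Y coev ev"
    and finite_simples: "finite ({X. simple C X} // {(X, Y). simple C X \<and> simple C Y \<and> isomorphic C X Y})"

text \<open>The last axiom singles out the canonical (unitary) ribbon structure: the right evaluation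
  \<open>ev \<Zcomp> \<c> X Y \<Zcomp> (\<t> X \<boxtimes> \<i> Y)\<close> that the twist induces on \<open>X \<odot> Y\<close> is the adjoint of the
  coevaluation. This determines the twist and makes all categorical dimensions positive.\<close>

locale unitary_braided_fusion_category = unitary_fusion_category +
  assumes braid_unitary: "\<lbrakk>X \<in> Obj C; Y \<in> Obj C\<rbrakk> \<Longrightarrow> unitary C (X \<odot> Y) (Y \<odot> X) (\<c> X Y)"
    and braid_natural: "\<lbrakk>X \<in> Obj C; X' \<in> Obj C; Y \<in> Obj C; Y' \<in> Obj C; f \<in> Hom C X X'; g \<in> Hom C Y Y'\<rbrakk>
      \<Longrightarrow> \<c> X' Y' \<Zcomp> (f \<boxtimes> g) = (g \<boxtimes> f) \<Zcomp> \<c> X Y"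
    and hexagon: "\<lbrakk>X \<in> Obj C; Y \<in> Obj C; Z \<in> Obj C\<rbrakk>
      \<Longrightarrow> \<a> Y Z X \<Zcomp> \<c> X (Y \<odot> Z) \<Zcomp> \<a> X Y Z =
          (\<i> Y \<boxtimes> \<c> X Z) \<Zcomp> \<a> Y X Z \<Zcomp> (\<c> X Y \<boxtimes> \<i> Z)"
    and hexagon': "\<lbrakk>X \<in> Obj C; Y \<in> Obj C; Z \<in> Obj C\<rbrakk>
      \<Longrightarrow> (\<a> Z X Y)\<dagger> \<Zcomp> \<c> (X \<odot> Y) Z \<Zcomp> (\<a> X Y Z)\<dagger> =
          (\<c> X Z \<boxtimes> \<i> Y) \<Zcomp> (\<a> X Z Y)\<dagger> \<Zcomp> (\<i> X \<boxtimes> \<c> Y Z)"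
    and twist_unitary: "X \<in> Obj C \<Longrightarrow> unitary C X X (\<t> X)"
    and twist_natural: "\<lbrakk>X \<in> Obj C; Y \<in> Obj C; f \<in> Hom C X Y\<rbrakk> \<Longrightarrow> \<t> Y \<Zcomp> f = f \<Zcomp> \<t> X"
    and twist_balance: "\<lbrakk>X \<in> Obj C; Y \<in> Obj C\<rbrakk>
      \<Longrightarrow> \<t> (X \<odot> Y) = \<c> Y X \<Zcomp> \<c> X Y \<Zcomp> (\<t> X \<boxtimes> \<t> Y)"
    and twist_dual: "dual_pair C X Y coev ev
      \<Longrightarrow> (\<t> X \<boxtimes> \<i> Y) \<Zcomp> coev = (\<i> X \<boxtimes> \<t> Y) \<Zcomp> coev"
    and twist_canonical: "\<lbrakk>simple C X; normalized_dual C X Y coev ev\<rbrakk>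
      \<Longrightarrow> ev \<Zcomp> \<c> X Y \<Zcomp> (\<t> X \<boxtimes> \<i> Y) = coev\<dagger>"


section \<open>Anyons\<close>

context
  fixes C :: "('o, 'm) braided_data" (structure)
begin

definition anyons :: "'o set set" where
  "anyons = {X. simple C X} // {(X, Y). simple C X \<and> simple C Y \<and> isomorphic C X Y}"

definition vacuum :: "'o set" where
  "vacuum = {X. simple C X \<and> isomorphic C \<I> X}"

text \<open>Invariants of an anyon are read off on a representative; none of them depends on which.\<close>

definition rep :: "'o set \<Rightarrow> 'o" where
  "rep x = (SOME X. X \<in> x)"

definition scalar_of :: "'o \<Rightarrow> 'm \<Rightarrow> complex" where
  "scalar_of X f = (THE k. f = k \<cdot> \<i> X)"

definition hom_dim :: "'o \<Rightarrow> 'o \<Rightarrow> nat" where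
  "hom_dim X Y = (THE n. \<exists>\<phi> :: 'm \<Rightarrow> nat \<Rightarrow> complex.
     bij_betw \<phi> (Hom C X Y) {u. \<forall>i\<ge>n. u i = 0} \<and>
     (\<forall>f\<in>Hom C X Y. \<forall>g\<in>Hom C X Y. \<forall>i. \<phi> (f \<oplus>m g) i = \<phi> f i + \<phi> g i) \<and>
     (\<forall>f\<in>Hom C X Y. \<forall>k. \<forall>i. \<phi> (k \<cdot> f) i = k * \<phi> f i))"

text \<open>The multiplicity of \<open>z\<close> in \<open>x \<times> y\<close>.\<close>

definition fusion :: "'o set \<Rightarrow> 'o set \<Rightarrow> 'o set \<Rightarrow> nat" where
  "fusion x y z = hom_dim (rep z) (rep x \<odot> rep y)"

definition occurs_in :: "'o set \<Rightarrow> 'o set \<Rightarrow> 'o set \<Rightarrow> bool" where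
  "occurs_in z x y \<longleftrightarrow>
     (\<exists>f\<in>Hom C (rep z) (rep x \<odot> rep y). f \<noteq> nul C (rep z) (rep x \<odot> rep y))"

text \<open>\<open>spin x\<close> is \<open>e\<^sup>i\<^sup>\<theta>\<close> for \<open>\<theta> = \<theta>\<^sub>x\<close>; \<open>mutual x y\<close> is \<open>e\<^sup>i\<^sup>\<theta>\<close> for \<open>\<theta> = \<theta>\<^sub>x\<^sub>,\<^sub>y\<close>, meaningful
  when the full braiding is a scalar, in particular when \<open>x\<close> or \<open>y\<close> is Abelian.\<close>

definition spin :: "'o set \<Rightarrow> complex" where
  "spin x = scalar_of (rep x) (\<t> (rep x))"

definition mutual :: "'o set \<Rightarrow> 'o set \<Rightarrow> complex" where
  "mutual x y = scalar_of (rep x \<odot> rep y) (\<c> (rep y) (rep x) \<Zcomp> \<c> (rep x) (rep y))"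

definition braids_trivially :: "'o set \<Rightarrow> 'o set \<Rightarrow> bool" where
  "braids_trivially x y \<longleftrightarrow>
     \<c> (rep y) (rep x) \<Zcomp> \<c> (rep x) (rep y) = \<i> (rep x \<odot> rep y)"

text \<open>The loop value of \<open>x\<close> for a standard solution, which is the same for all of them; by the
  canonicity axiom it is also the categorical (ribbon) dimension.\<close>

definition qdim :: "'o set \<Rightarrow> real" where
  "qdim x = (SOME d. \<exists>Y coev ev. normalized_dual C (rep x) Y coev ev \<and>
     coev\<dagger> \<Zcomp> coev = complex_of_real d \<cdot> \<i> \<I>)"

definition abelian :: "'o set \<Rightarrow> bool" where
  "abelian x \<longleftrightarrow> qdim x = 1"

definition total_dim :: real where
  "total_dim = sqrt (\<Sum>x\<in>anyons. (qdim x)\<^sup>2)"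

definition preserves_fusion :: "('o set \<Rightarrow> 'o set) \<Rightarrow> bool" where
  "preserves_fusion f \<longleftrightarrow>
     (\<forall>x\<in>anyons. \<forall>y\<in>anyons. \<forall>z\<in>anyons. fusion (f x) (f y) (f z) = fusion x y z)"

definition anyon_group :: "'o set monoid" where
  "anyon_group = \<lparr>carrier = anyons,
     mult = (\<lambda>x y. THE z. z \<in> anyons \<and> occurs_in z x y), one = vacuum\<rparr>"

end

definition fermionic_TO :: "('o, 'm) braided_data \<Rightarrow> 'o set \<Rightarrow> bool" where
  "fermionic_TO C c \<longleftrightarrow> unitary_braided_fusion_category C \<and>
     {x \<in> anyons C. \<forall>y\<in>anyons C. braids_trivially C x y} = {vacuum C, c} \<and>
     isomorphic C (tens_o C (rep c) (rep c)) (unit_o C) \<and>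
     spin C c = cis pi"


section \<open>Symmetry-enriched fermionic topological orders\<close>

text \<open>Charges are real representatives of elements of \<open>\<real>/2\<int>\<close>; only their classes mod 2 matter.
  The permutations act on the set of anyons.\<close>

record ('o, 'm) SET_data =
  TO         :: "('o, 'm) braided_data"
  fermion    :: "'o set"
  charge     :: "'o set \<Rightarrow> real"
  vison      :: "'o set"
  background :: "'o set"
  time_rev   :: "'o set \<Rightarrow> 'o set"
  transl_x   :: "'o set \<Rightarrow> 'o set"
  transl_y   :: "'o set \<Rightarrow> 'o set"

definition charge_assignment :: "('o, 'm) braided_data \<Rightarrow> 'o set \<Rightarrow> ('o set \<Rightarrow> real) \<Rightarrow> bool" where
  "charge_assignment C c Q \<longleftrightarrow>
     (\<forall>x\<in>anyons C. \<forall>y\<in>anyons C. \<forall>z\<in>anyons C. occurs_in C z x y \<longrightarrow> [Q z = Q x + Q y] (rmod 2)) \<and>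
     [Q (vacuum C) = 0] (rmod 2) \<and> [Q c = 1] (rmod 2)"

definition is_vison ::
  "('o, 'm) braided_data \<Rightarrow> ('o set \<Rightarrow> real) \<Rightarrow> real \<Rightarrow> 'o set \<Rightarrow> bool" where
  "is_vison C Q \<sigma>H v \<longleftrightarrow> v \<in> anyons C \<and> abelian C v \<and>
     (\<forall>x\<in>anyons C. mutual C v x = cis (2 * pi * Q x)) \<and>
     spin C v = cis (pi * \<sigma>H) \<and> [Q v = \<sigma>H] (rmod 2)"

definition central_charge_relation ::
  "('o, 'm) braided_data \<Rightarrow> ('o set \<Rightarrow> real) \<Rightarrow> real \<Rightarrow> real \<Rightarrow> bool" where
  "central_charge_relation C Q cminus \<sigma>H \<longleftrightarrow>
     cis (2 * pi * (cminus - \<sigma>H) / 8) =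
       1 / complex_of_real (sqrt 2 * total_dim C) *
       (\<Sum>x\<in>anyons C. complex_of_real ((qdim C x)\<^sup>2) * (spin C x * cis (pi * Q x)))"

definition is_time_reversal ::
  "('o, 'm) braided_data \<Rightarrow> 'o set \<Rightarrow> ('o set \<Rightarrow> real) \<Rightarrow> ('o set \<Rightarrow> 'o set) \<Rightarrow> bool" where
  "is_time_reversal C c Q T \<longleftrightarrow> bij_betw T (anyons C) (anyons C) \<and>
     (\<forall>x\<in>anyons C. T (T x) = x) \<and> preserves_fusion C T \<and>
     (\<forall>x\<in>anyons C. spin C (T x) = cnj (spin C x)) \<and> T c = c \<and>
     (\<forall>x\<in>anyons C. [Q (T x) = Q x] (rmod 2))"

definition is_translation ::
  "('o, 'm) braided_data \<Rightarrow> 'o set \<Rightarrow> ('o set \<Rightarrow> real) \<Rightarrow> ('o set \<Rightarrow> 'o set) \<Rightarrow> bool" where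
  "is_translation C c Q t \<longleftrightarrow> bij_betw t (anyons C) (anyons C) \<and> preserves_fusion C t \<and>
     (\<forall>x\<in>anyons C. spin C (t x) = spin C x) \<and> t c = c \<and>
     (\<forall>x\<in>anyons C. [Q (t x) = Q x] (rmod 2))"

text \<open>\<open>SET_G \<nu>\<close> is the set of enriched orders at filling \<open>\<nu>\<close> for
  \<open>G = \<int>\<^sup>2 \<times> [U(1)\<^sub>f \<rtimes> \<int>\<^sub>2\<^sup>T]\<close>; Hall conductance and chiral central charge both vanish.\<close>

definition SET_G :: "real \<Rightarrow> ('o, 'm) SET_data set" where
  "SET_G \<nu> = {S.
     let C = TO S; c = fermion S; Q = charge S; v = vison S; a = background S;
         T = time_rev S; tx = transl_x S; ty = transl_y S
     in fermionic_TO C c \<and> charge_assignment C c Q \<and>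
        is_vison C Q 0 v \<and> central_charge_relation C Q 0 0 \<and>
        a \<in> anyons C \<and> abelian C a \<and> [Q a = \<nu>] (rmod 2) \<and>
        is_time_reversal C c Q T \<and>
        is_translation C c Q tx \<and> is_translation C c Q ty \<and>
        (\<forall>x\<in>anyons C. tx (ty x) = ty (tx x)) \<and>
        (\<forall>x\<in>anyons C. T (tx x) = tx (T x)) \<and> (\<forall>x\<in>anyons C. T (ty x) = ty (T x)) \<and>
        (\<forall>d\<in>anyons C. tx d = d \<and> ty d = d \<longrightarrow> mutual C a d = mutual C (T a) d)}"

text \<open>The competitor \<open>C'\<close> ranges over orders with objects in \<open>nat\<close> and morphisms in
  \<open>nat \<Rightarrow> nat \<Rightarrow> complex\<close>. Nothing is lost: a unitary braided fusion category is equivalent to a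
  skeletal one, which has countably many objects and at most continuum many morphisms, so up to
  relabelling every order occurs over these types. The candidate itself may live on any types.\<close>

definition mG_GSD :: "real \<Rightarrow> ('o, 'm) SET_data set" where
  "mG_GSD \<nu> = {A \<in> SET_G \<nu>.
     \<forall>C' \<in> (SET_G \<nu> :: (nat, nat \<Rightarrow> nat \<Rightarrow> complex) SET_data set).
       card (anyons (TO A)) \<le> card (anyons (TO C'))}"


section \<open>\<open>\<int>\<^sub>N\<close> gauge theory stacked with \<open>{1,c}\<close>\<close>

definition gauge_group :: "nat \<Rightarrow> (int \<times> int \<times> int) monoid" where
  "gauge_group N = integer_mod_group N \<times>\<times> (integer_mod_group N \<times>\<times> integer_mod_group 2)"

definition gauge_spin :: "nat \<Rightarrow> int \<times> int \<times> int \<Rightarrow> complex" where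
  "gauge_spin N = (\<lambda>(r, s, k). cis (2 * pi * of_int (r * s) / of_nat N + pi * of_int k))"

definition is_ZN_gauge_theory_with_fermion ::
  "nat \<Rightarrow> ('o, 'm) braided_data \<Rightarrow> 'o set \<Rightarrow> bool" where
  "is_ZN_gauge_theory_with_fermion N C c \<longleftrightarrow> (\<forall>x\<in>anyons C. abelian C x) \<and>
     (\<exists>h \<in> iso (anyon_group C) (gauge_group N).
        (\<forall>x\<in>anyons C. gauge_spin N (h x) = spin C x) \<and> h c = (0, 0, 1))"

end

theory Submission
  imports Defs "HOL-Library.Nat_Bijection" "HOL-Library.Product_Plus"
begin

text \<open>
  The anyons \<open>a\<^sup>j v\<^sup>k c\<^sup>l\<close> with \<open>j, k < q\<close> and \<open>l < 2\<close> are distinct: charges separate \<open>j\<close> and \<open>l\<close>,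
  and braiding with \<open>a\<close> separates \<open>k\<close> because \<open>\<theta>\<^sub>v\<^sub>,\<^sub>a = 2\<pi>/q\<close>. So an order in \<open>SET_G \<nu>\<close> has at least
  \<open>2q\<^sup>2\<close> anyons. The \<open>\<int>\<^sub>q\<close> gauge theory itself can be enriched to an element of \<open>SET_G \<nu>\<close>, so a minimal
  order has exactly these anyons and they are all Abelian. Time reversal preserves the charge of
  \<open>a\<close>, hence \<open>T a = v\<^sup>k a\<close>, and \<open>\<theta>\<^sub>T\<^sub>a = -\<theta>\<^sub>a\<close> gives \<open>2\<theta>\<^sub>a = -2\<pi>k/q\<close>. As \<open>q\<close> is odd, some \<open>b = v\<^sup>m a c\<^sup>l\<close> is a
  boson; \<open>b\<close> and \<open>v\<close> are the generators of the gauge theory.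
\<close>

section \<open>Arrows with domain and codomain\<close>

text \<open>Nothing assumed makes the anyons Abelian, and "Abelian" means quantum dimension 1, a
  statement about normalised duals. The count therefore takes place in the group of
  tensor-invertible classes. This needs three facts about categories: dimension 1 is the same as
  invertibility (from positivity of the dagger), braiding is bimultiplicative on invertible objects
  (from the hexagons), and the self-braiding is the square of the spin (by comparison with the
  dual). The lower bound counts invertible classes and the upper bound counts all anyons; they can
  meet only if every anyon is invertible. The upper bound calls for an actual category, not just a
  table of spins. The spins of the gauge theory are the diagonal of a bicharacter, so a category
  with trivial associator phases realises them, and its coherence axioms become bookkeeping on
  indices. Oddness of \<open>q\<close> enters twice: 2 is invertible modulo \<open>q\<close>, which
  yields the boson, and a charge \<open>r (q + 1) / q\<close> depends modulo 2 only on the residue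
  of \<open>r\<close>, which gives the competitor its charges.\<close>

text \<open>Hom sets need not be disjoint, so composability is not visible from morphisms alone. Recording
  source and target turns the typing conditions of the axioms into equations for the simplifier.\<close>

datatype ('o, 'm) arrow = Arrow (src: 'o) (tgt: 'o) (mor: 'm)

lemma arrow_eqI: "src f = src g \<Longrightarrow> tgt f = tgt g \<Longrightarrow> mor f = mor g \<Longrightarrow> f = g"
  by (cases f, cases g) auto

context unitary_semisimple_category
begin

definition arr :: "('o, 'm) arrow \<Rightarrow> bool" where
  "arr f \<longleftrightarrow> src f \<in> Obj C \<and> tgt f \<in> Obj C \<and> mor f \<in> Hom C (src f) (tgt f)"

definition acmp :: "('o, 'm) arrow \<Rightarrow> ('o, 'm) arrow \<Rightarrow> ('o, 'm) arrow" (infixr \<open>**\<close> 60)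
  where "g ** f = Arrow (src f) (tgt g) (mor g \<Zcomp> mor f)"

definition aid :: "'o \<Rightarrow> ('o, 'm) arrow" where
  "aid X = Arrow X X (\<i> X)"

definition anul :: "'o \<Rightarrow> 'o \<Rightarrow> ('o, 'm) arrow" where
  "anul X Y = Arrow X Y (nul C X Y)"

definition aplus :: "('o, 'm) arrow \<Rightarrow> ('o, 'm) arrow \<Rightarrow> ('o, 'm) arrow" (infixl \<open>+.\<close> 55)
  where "f +. g = Arrow (src f) (tgt f) (mor f \<oplus>m mor g)"

definition ascale :: "complex \<Rightarrow> ('o, 'm) arrow \<Rightarrow> ('o, 'm) arrow" (infixr \<open>*.\<close> 58)
  where "k *. f = Arrow (src f) (tgt f) (k \<cdot> mor f)"

definition adag :: "('o, 'm) arrow \<Rightarrow> ('o, 'm) arrow" where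
  "adag f = Arrow (tgt f) (src f) ((mor f)\<dagger>)"

lemma src_tgt [simp]:
  "src (g ** f) = src f" "tgt (g ** f) = tgt g"
  "src (aid X) = X" "tgt (aid X) = X"
  "src (anul X Y) = X" "tgt (anul X Y) = Y"
  "src (f +. g) = src f" "tgt (f +. g) = tgt f"
  "src (k *. f) = src f" "tgt (k *. f) = tgt f"
  "src (adag f) = tgt f" "tgt (adag f) = src f"
  by (simp_all add: acmp_def aid_def anul_def aplus_def ascale_def adag_def)

lemma mor_simps:
  "mor (g ** f) = mor g \<Zcomp> mor f" "mor (aid X) = \<i> X" "mor (anul X Y) = nul C X Y"
  "mor (f +. g) = mor f \<oplus>m mor g" "mor (k *. f) = k \<cdot> mor f" "mor (adag f) = (mor f)\<dagger>"
  by (simp_all add: acmp_def aid_def anul_def aplus_def ascale_def adag_def)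

lemma arrD: "arr f \<Longrightarrow> src f \<in> Obj C" "arr f \<Longrightarrow> tgt f \<in> Obj C"
  "arr f \<Longrightarrow> mor f \<in> Hom C (src f) (tgt f)"
  by (auto simp: arr_def)

lemma arr_Arrow [simp]: "arr (Arrow X Y f) \<longleftrightarrow> X \<in> Obj C \<and> Y \<in> Obj C \<and> f \<in> Hom C X Y"
  by (simp add: arr_def)

lemma arr_acmp [simp]: "arr f \<Longrightarrow> arr g \<Longrightarrow> src g = tgt f \<Longrightarrow> arr (g ** f)"
  unfolding arr_def using cmp_in by (auto simp: mor_simps)

lemma arr_aid [simp]: "X \<in> Obj C \<Longrightarrow> arr (aid X)"
  by (simp add: arr_def mor_simps ident_in)

lemma arr_anul [simp]: "X \<in> Obj C \<Longrightarrow> Y \<in> Obj C \<Longrightarrow> arr (anul X Y)"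
  by (simp add: arr_def mor_simps nul_in)

lemma arr_aplus [simp]: "arr f \<Longrightarrow> arr g \<Longrightarrow> src f = src g \<Longrightarrow> tgt f = tgt g \<Longrightarrow> arr (f +. g)"
  by (simp add: arr_def mor_simps plus_in)

lemma arr_ascale [simp]: "arr f \<Longrightarrow> arr (k *. f)"
  by (simp add: arr_def mor_simps scale_in)

lemma arr_adag [simp]: "arr f \<Longrightarrow> arr (adag f)"
  by (simp add: arr_def mor_simps dag_in)

lemma acmp_assoc [simp]:
  "arr f \<Longrightarrow> arr g \<Longrightarrow> arr h \<Longrightarrow> src g = tgt f \<Longrightarrow> src h = tgt g \<Longrightarrow> (h ** g) ** f = h ** (g ** f)"
  using cmp_assoc[of "src f" "tgt f" "tgt g" "tgt h" "mor f" "mor g" "mor h"]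
  by (intro arrow_eqI) (auto simp: arr_def mor_simps)

text \<open>Composites are kept nested to the right, so \<open>h ** g\<close> is no longer a subterm
  once something is composed before it. This form makes an equation for \<open>h ** g\<close> usable
  as a rewrite rule inside longer chains.\<close>

lemma acmp_reassoc:
  "h ** g = m \<Longrightarrow> arr f \<Longrightarrow> arr g \<Longrightarrow> arr h \<Longrightarrow> src g = tgt f \<Longrightarrow> src h = tgt g \<Longrightarrow> h ** g ** f = m ** f"
  by (metis acmp_assoc)

lemma acmp_aid [simp]:
  "arr f \<Longrightarrow> Y = tgt f \<Longrightarrow> aid Y ** f = f" "arr f \<Longrightarrow> X = src f \<Longrightarrow> f ** aid X = f"
  by (auto intro!: arrow_eqI simp: arr_def mor_simps cmp_ident_left cmp_ident_right)

lemma aplus_assoc: "arr f \<Longrightarrow> arr g \<Longrightarrow> arr h \<Longrightarrow> src f = src g \<Longrightarrow> tgt f = tgt g \<Longrightarrow>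
    src g = src h \<Longrightarrow> tgt g = tgt h \<Longrightarrow> (f +. g) +. h = f +. (g +. h)"
  by (intro arrow_eqI) (auto simp: arr_def mor_simps plus_assoc)

lemma aplus_comm: "arr f \<Longrightarrow> arr g \<Longrightarrow> src f = src g \<Longrightarrow> tgt f = tgt g \<Longrightarrow> f +. g = g +. f"
  by (intro arrow_eqI) (auto simp: arr_def mor_simps plus_comm)

lemma aplus_anul [simp]: "arr f \<Longrightarrow> X = src f \<Longrightarrow> Y = tgt f \<Longrightarrow> f +. anul X Y = f"
  by (intro arrow_eqI) (auto simp: arr_def mor_simps plus_nul)

lemma anul_aplus [simp]: "arr f \<Longrightarrow> X = src f \<Longrightarrow> Y = tgt f \<Longrightarrow> anul X Y +. f = f"
  by (subst aplus_comm) (auto simp: arr_def mor_simps nul_in)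

lemma aplus_neg: "arr f \<Longrightarrow> f +. (-1) *. f = anul (src f) (tgt f)"
  by (intro arrow_eqI) (auto simp: arr_def mor_simps plus_neg)

lemma ascale_one [simp]: "arr f \<Longrightarrow> 1 *. f = f"
  by (intro arrow_eqI) (auto simp: arr_def mor_simps scale_one)

lemma ascale_ascale [simp]: "arr f \<Longrightarrow> k *. l *. f = (k * l) *. f"
  by (intro arrow_eqI) (auto simp: arr_def mor_simps scale_scale)

lemma aplus_ascale: "arr f \<Longrightarrow> k *. f +. l *. f = (k + l) *. f"
  by (intro arrow_eqI) (auto simp: arr_def mor_simps plus_scale)

text \<open>The axioms name no zero scalar; 0 is 1 + (-1), and \<open>plus_neg\<close> identifies
  the sum.\<close>

lemma ascale_zero: "arr f \<Longrightarrow> 0 *. f = anul (src f) (tgt f)"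
  using aplus_neg[of f] aplus_ascale[of f 1 "-1"] by simp

lemma acmp_aplus_left: "arr f \<Longrightarrow> arr g \<Longrightarrow> arr h \<Longrightarrow> src g = src h \<Longrightarrow> tgt g = tgt h \<Longrightarrow>
    src g = tgt f \<Longrightarrow> (g +. h) ** f = g ** f +. h ** f"
  using cmp_plus_left[of "src f" "tgt f" "tgt g" "mor f" "mor g" "mor h"]
  by (intro arrow_eqI) (auto simp: arr_def mor_simps)

lemma acmp_aplus_right: "arr f \<Longrightarrow> arr g \<Longrightarrow> arr h \<Longrightarrow> src f = src g \<Longrightarrow> tgt f = tgt g \<Longrightarrow>
    src h = tgt f \<Longrightarrow> h ** (f +. g) = h ** f +. h ** g"
  using cmp_plus_right[of "src f" "tgt f" "tgt h" "mor f" "mor g" "mor h"]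
  by (intro arrow_eqI) (auto simp: arr_def mor_simps)

lemma acmp_ascale [simp]:
  "arr f \<Longrightarrow> arr g \<Longrightarrow> src g = tgt f \<Longrightarrow> (k *. g) ** f = k *. (g ** f)"
  "arr f \<Longrightarrow> arr g \<Longrightarrow> src g = tgt f \<Longrightarrow> g ** (k *. f) = k *. (g ** f)"
  using cmp_scale_left[of "src f" "tgt f" "tgt g" "mor f" "mor g" k]
    cmp_scale_right[of "src f" "tgt f" "tgt g" "mor f" "mor g" k]
  by (auto intro!: arrow_eqI simp: arr_def mor_simps)

lemma acmp_anul [simp]:
  "arr f \<Longrightarrow> X = tgt f \<Longrightarrow> Y \<in> Obj C \<Longrightarrow> anul X Y ** f = anul (src f) Y"
  "arr f \<Longrightarrow> Y = src f \<Longrightarrow> X \<in> Obj C \<Longrightarrow> f ** anul X Y = anul X (tgt f)"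
proof -
  show "anul X Y ** f = anul (src f) Y" if "arr f" "X = tgt f" "Y \<in> Obj C"
  proof -
    have X: "arr (anul X Y)" using that arrD by auto
    have "anul X Y ** f = (0 *. anul X Y) ** f" using ascale_zero[OF X] by simp
    also have "\<dots> = 0 *. (anul X Y ** f)" using that X by simp
    also have "\<dots> = anul (src f) Y" using ascale_zero[of "anul X Y ** f"] that X by simp
    finally show ?thesis .
  qed
  show "f ** anul X Y = anul X (tgt f)" if "arr f" "Y = src f" "X \<in> Obj C"
  proof -
    have X: "arr (anul X Y)" using that arrD by auto
    have "f ** anul X Y = f ** (0 *. anul X Y)" using ascale_zero[OF X] by simp
    also have "\<dots> = 0 *. (f ** anul X Y)" using that X by simp
    also have "\<dots> = anul X (tgt f)" using ascale_zero[of "f ** anul X Y"] that X by simp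
    finally show ?thesis .
  qed
qed

lemma ascale_anul [simp]: "X \<in> Obj C \<Longrightarrow> Y \<in> Obj C \<Longrightarrow> k *. anul X Y = anul X Y"
  using ascale_zero[of "anul X Y"] ascale_ascale[of "anul X Y" k 0] by simp

lemma adag_adag [simp]: "arr f \<Longrightarrow> adag (adag f) = f"
  by (intro arrow_eqI) (auto simp: arr_def mor_simps dag_dag)

lemma adag_acmp [simp]: "arr f \<Longrightarrow> arr g \<Longrightarrow> src g = tgt f \<Longrightarrow> adag (g ** f) = adag f ** adag g"
  using dag_cmp[of "src f" "tgt f" "tgt g" "mor f" "mor g"]
  by (auto intro!: arrow_eqI simp: arr_def mor_simps)

lemma adag_aplus [simp]: "arr f \<Longrightarrow> arr g \<Longrightarrow> src f = src g \<Longrightarrow> tgt f = tgt g \<Longrightarrow>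
    adag (f +. g) = adag f +. adag g"
  by (auto intro!: arrow_eqI simp: arr_def mor_simps dag_plus)

lemma adag_ascale [simp]: "arr f \<Longrightarrow> adag (k *. f) = cnj k *. adag f"
  by (auto intro!: arrow_eqI simp: arr_def mor_simps dag_scale)

lemma adag_aid [simp]:
  assumes "X \<in> Obj C" shows "adag (aid X) = aid X"
proof -
  have "aid X = adag (adag (aid X) ** aid X)" using assms by (simp del: adag_acmp)
  also have "\<dots> = adag (aid X)" using assms by (subst adag_acmp) simp_all
  finally show ?thesis by simp
qed

lemma adag_positive: "arr f \<Longrightarrow> adag f ** f = anul (src f) (src f) \<Longrightarrow> f = anul (src f) (tgt f)"
  using dag_positive[of "src f" "tgt f" "mor f"] mor_simps(1)[of "adag f" f]
  by (intro arrow_eqI) (simp_all add: arr_def mor_simps)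

lemma diff_eq_anul_iff:
  assumes "arr f" "arr g" "src f = src g" "tgt f = tgt g"
  shows "f +. (-1) *. g = anul (src f) (tgt f) \<longleftrightarrow> f = g"
proof
  assume *: "f +. (-1) *. g = anul (src f) (tgt f)"
  have "f = f +. (g +. (-1) *. g)"
    using assms by (simp add: aplus_neg)
  also have "g +. (-1) *. g = (-1) *. g +. g"
    using assms by (simp add: aplus_comm)
  also have "f +. ((-1) *. g +. g) = (f +. (-1) *. g) +. g"
    using assms by (simp add: aplus_assoc)
  also have "\<dots> = g" using * assms by simp
  finally show "f = g" .
qed (use assms aplus_neg in simp)

lemma adag_anul [simp]: "X \<in> Obj C \<Longrightarrow> Y \<in> Obj C \<Longrightarrow> adag (anul X Y) = anul Y X"
  using ascale_zero[of "anul X Y"] adag_ascale[of "anul X Y" 0] ascale_zero[of "adag (anul X Y)"] by simp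

text \<open>Equality case of Cauchy--Schwarz.\<close>

lemma isometry_section_eq_adag:
  assumes "arr f" "arr g" "src g = tgt f" "tgt g = src f"
    and "adag f ** f = aid (src f)" "g ** adag g = aid (src f)" "g ** f = aid (src f)"
  shows "g = adag f"
proof -
  have X: "src f \<in> Obj C" using assms arrD by auto
  have "adag f ** adag g = aid (src f)"
    using arg_cong[OF assms(7), of adag] assms(1-4) X by simp
  note fg = this
  define D where "D = f +. (-1) *. adag g"
  have D: "arr D" "src D = src f" "tgt D = tgt f"
    using assms by (auto simp: D_def)
  have "adag D = adag f +. (-1) *. g"
    unfolding D_def using assms(1-4) by simp
  then have "adag D ** D = adag f ** D +. (-1) *. (g ** D)"
    using acmp_aplus_left[of D "adag f" "(-1) *. g"] D assms(1-4) by simp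
  moreover have "adag f ** D = aid (src f) +. (-1) *. aid (src f)"
    unfolding D_def using acmp_aplus_right[of f "(-1) *. adag g" "adag f"] assms fg by simp
  moreover have "g ** D = aid (src f) +. (-1) *. aid (src f)"
    unfolding D_def using acmp_aplus_right[of f "(-1) *. adag g" g] assms fg by simp
  ultimately have "adag D ** D = anul (src f) (src f)"
    using aplus_neg[of "aid (src f)"] X by simp
  then have "D = anul (src f) (tgt f)"
    using adag_positive[of D] D by simp
  then have "f +. (-1) *. adag g = anul (src f) (tgt f)"
    unfolding D_def .
  then have "f = adag g"
    by (rule diff_eq_anul_iff[THEN iffD1, rotated -1]) (use assms(1-4) in simp_all)
  then show ?thesis using assms(2) by simp
qed

section \<open>Isomorphisms, simple objects and Schur's lemma\<close>

definition iso_arr :: "('o, 'm) arrow \<Rightarrow> ('o, 'm) arrow \<Rightarrow> bool" where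
  "iso_arr f g \<longleftrightarrow> arr f \<and> arr g \<and> src g = tgt f \<and> tgt g = src f \<and>
     g ** f = aid (src f) \<and> f ** g = aid (tgt f)"

lemma iso_arrD:
  assumes "iso_arr f g"
  shows "arr f" "arr g" "src g = tgt f" "tgt g = src f"
    "g ** f = aid (src f)" "f ** g = aid (tgt f)"
  using assms by (auto simp: iso_arr_def)

lemma isomorphic_iff:
  assumes "X \<in> Obj C" "Y \<in> Obj C"
  shows "isomorphic C X Y \<longleftrightarrow> (\<exists>f g. iso_arr f g \<and> src f = X \<and> tgt f = Y)"
proof
  assume "isomorphic C X Y"
  then obtain f g where "f \<in> Hom C X Y" "g \<in> Hom C Y X" "g \<Zcomp> f = \<i> X" "f \<Zcomp> g = \<i> Y"
    unfolding isomorphic_def by auto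
  then have "iso_arr (Arrow X Y f) (Arrow Y X g)"
    using assms by (auto simp: iso_arr_def mor_simps intro!: arrow_eqI)
  then show "\<exists>f g. iso_arr f g \<and> src f = X \<and> tgt f = Y"
    by force
next
  assume "\<exists>f g. iso_arr f g \<and> src f = X \<and> tgt f = Y"
  then obtain f g where fg: "iso_arr f g" "src f = X" "tgt f = Y" by auto
  then have "g ** f = aid X" "f ** g = aid Y" by (auto simp: iso_arr_def)
  then have "mor g \<Zcomp> mor f = \<i> X" "mor f \<Zcomp> mor g = \<i> Y"
    by (metis mor_simps(1,2))+
  then show "isomorphic C X Y"
    using fg unfolding isomorphic_def
    by (intro bexI[of _ "mor f"] bexI[of _ "mor g"]) (auto simp: iso_arr_def arr_def)
qed

lemma iso_arr_sym: "iso_arr f g \<Longrightarrow> iso_arr g f"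
  by (auto simp: iso_arr_def)

lemma iso_arr_acmp:
  assumes "iso_arr f g" "iso_arr h k" "src h = tgt f"
  shows "iso_arr (h ** f) (g ** k)"
proof -
  note f = iso_arrD[OF assms(1)] and h = iso_arrD[OF assms(2)]
  have "(g ** k) ** h ** f = aid (src f)" "(h ** f) ** g ** k = aid (tgt h)"
    using f h assms(3) by (simp_all add: acmp_reassoc[OF h(5)] acmp_reassoc[OF f(6)])
  then show ?thesis
    using f(1-4) h(1-4) assms(3) unfolding iso_arr_def by auto
qed

lemma iso_arr_cancel:
  assumes "iso_arr f g" "arr h" "src f = tgt h" "f ** h = anul (src h) (tgt f)"
  shows "h = anul (src h) (tgt h)"
proof -
  note f = iso_arrD[OF assms(1)]
  have "h = (g ** f) ** h" using f assms by simp
  also have "\<dots> = g ** (f ** h)" using f(1-4) assms by simp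
  also have "\<dots> = anul (src h) (tgt h)" using f assms arrD by simp
  finally show ?thesis .
qed

lemma isomorphic_refl: "X \<in> Obj C \<Longrightarrow> isomorphic C X X"
  unfolding isomorphic_iff by (rule exI[of _ "aid X"], rule exI[of _ "aid X"]) (simp add: iso_arr_def)

lemma isomorphic_sym: "X \<in> Obj C \<Longrightarrow> Y \<in> Obj C \<Longrightarrow> isomorphic C X Y \<Longrightarrow> isomorphic C Y X"
  unfolding isomorphic_def by auto

lemma isomorphic_trans:
  assumes "X \<in> Obj C" "Y \<in> Obj C" "Z \<in> Obj C" "isomorphic C X Y" "isomorphic C Y Z"
  shows "isomorphic C X Z"
proof -
  obtain f g h k where "iso_arr f g" "src f = X" "tgt f = Y" "iso_arr h k" "src h = Y" "tgt h = Z"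
    using assms by (auto simp: isomorphic_iff)
  then have "iso_arr (h ** f) (g ** k)" "src (h ** f) = X" "tgt (h ** f) = Z"
    using iso_arr_acmp[of f g h k] by auto
  then show ?thesis using isomorphic_iff[of X Z] assms by blast
qed

lemma simple_obj: "simple C X \<Longrightarrow> X \<in> Obj C"
  by (simp add: simple_def)

lemma simple_aid_neq: "simple C X \<Longrightarrow> aid X \<noteq> anul X X"
  by (metis simple_def mor_simps(2,3))

lemma simple_scalar:
  assumes "simple C X" "arr f" "src f = X" "tgt f = X"
  obtains k where "f = k *. aid X"
proof -
  obtain k where "mor f = k \<cdot> \<i> X" using assms by (auto simp: simple_def arr_def)
  then have "f = k *. aid X" using assms by (intro arrow_eqI) (auto simp: mor_simps)
  then show ?thesis using that by blast
qed

lemma simpleI: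
  assumes "X \<in> Obj C" "aid X \<noteq> anul X X"
    and "\<And>f. arr f \<Longrightarrow> src f = X \<Longrightarrow> tgt f = X \<Longrightarrow> \<exists>k. f = k *. aid X"
  shows "simple C X"
  unfolding simple_def
proof (intro conjI ballI)
  show "\<i> X \<noteq> nul C X X" using assms(2) by (auto simp: aid_def anul_def)
  fix f assume "f \<in> Hom C X X"
  then have "arr (Arrow X X f)" using assms(1) by simp
  from assms(3)[OF this] obtain k where "Arrow X X f = k *. aid X" by auto
  then show "\<exists>k. f = k \<cdot> \<i> X" by (auto simp: ascale_def aid_def)
qed (fact assms)

lemma ascale_eq_anul_iff:
  assumes "arr f" "f \<noteq> anul (src f) (tgt f)"
  shows "k *. f = anul (src f) (tgt f) \<longleftrightarrow> k = 0"
proof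
  assume *: "k *. f = anul (src f) (tgt f)"
  show "k = 0"
  proof (rule ccontr)
    assume "k \<noteq> 0"
    then have "f = (1/k) *. k *. f" using assms by simp
    also have "\<dots> = anul (src f) (tgt f)" unfolding * using assms arrD by simp
    finally show False using assms by simp
  qed
qed (use assms ascale_zero in simp)

lemma ascale_inject:
  assumes "arr f" "f \<noteq> anul (src f) (tgt f)"
  shows "k *. f = l *. f \<longleftrightarrow> k = l"
proof
  assume "k *. f = l *. f"
  then have "k *. f +. (-1) *. l *. f = anul (src f) (tgt f)"
    using diff_eq_anul_iff[of "k *. f" "l *. f"] assms by simp
  then have "(k - l) *. f = anul (src f) (tgt f)" using assms by (simp add: aplus_ascale)
  then show "k = l" using assms ascale_eq_anul_iff by auto
qed simp

lemma simple_ascale_inject: "simple C X \<Longrightarrow> k *. aid X = l *. aid X \<longleftrightarrow> k = l"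
  using ascale_inject[of "aid X"] simple_aid_neq simple_obj by simp

text \<open>Conjugation with the isomorphism carries endomorphisms of \<open>Y\<close> to
  endomorphisms of \<open>X\<close>, where they are scalars.\<close>

lemma simple_iso:
  assumes "simple C X" "Y \<in> Obj C" "isomorphic C X Y"
  shows "simple C Y"
proof -
  obtain f g where fg: "iso_arr f g" and st: "src f = X" "tgt f = Y"
    using assms by (auto simp: isomorphic_iff simple_obj)
  note f = iso_arrD[OF fg]
  have X: "X \<in> Obj C" using assms simple_obj by auto
  show ?thesis
  proof (rule simpleI)
    show "aid Y \<noteq> anul Y Y"
    proof
      assume 0: "aid Y = anul Y Y"
      have "aid X = g ** aid Y ** f" using f st by simp
      also have "\<dots> = anul X X" unfolding 0 using f st X assms(2) by simp
      finally show False using simple_aid_neq assms by auto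
    qed
    fix h assume h: "arr h" "src h = Y" "tgt h = Y"
    obtain k where k: "g ** h ** f = k *. aid X"
      using simple_scalar[OF assms(1), of "g ** h ** f"] f st h by auto
    have "h = (f ** g) ** h ** (f ** g)" using f st h by simp
    also have "\<dots> = f ** (g ** h ** f) ** g" using f(1-4) st h by simp
    also have "\<dots> = k *. aid Y" unfolding k using f st X by simp
    finally show "\<exists>k. h = k *. aid Y" by auto
  qed fact
qed

text \<open>Summing \<open>f\<close> with the square root of \<open>- adag f ** f\<close> shows that the scalar cannot be negative.\<close>

lemma norm_sq_pos:
  assumes f: "arr f" "simple C (src f)" "f \<noteq> anul (src f) (tgt f)"
  obtains d where "adag f ** f = of_real d *. aid (src f)" "d > 0"
proof -
  define X where "X = src f"
  have X: "X \<in> Obj C" "simple C X" using assms simple_obj by (auto simp: X_def)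
  obtain k where k: "adag f ** f = k *. aid X"
    using simple_scalar[of X "adag f ** f"] assms X by (auto simp: X_def)
  have "k *. aid X = adag (adag f ** f)" using k[symmetric] assms by simp
  also have "\<dots> = cnj k *. aid X" unfolding k using X by simp
  finally have "k = cnj k" using simple_ascale_inject X by simp
  then have "k \<in> \<real>" by (simp add: Reals_cnj_iff)
  then obtain d where d: "k = complex_of_real d" by (rule Reals_cases)
  have "d > 0"
  proof (rule ccontr)
    assume "\<not> d > 0"
    define s where "s = complex_of_real (sqrt (- d))"
    have s: "cnj s * s = - k"
      using \<open>\<not> d > 0\<close> by (simp add: s_def d flip: of_real_mult)
    obtain Z where "direct_sum C Z (tgt f) X" using ex_direct_sum[of "tgt f" X] X f arrD by auto
    then obtain i' j' where Z: "Z \<in> Obj C" and ij': "i' \<in> Hom C (tgt f) Z" "j' \<in> Hom C X Z"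
      "i'\<dagger> \<Zcomp> i' = \<i> (tgt f)" "j'\<dagger> \<Zcomp> j' = \<i> X" "i'\<dagger> \<Zcomp> j' = nul C X (tgt f)"
      by (auto simp: direct_sum_def)
    define i where "i = Arrow (tgt f) Z i'"
    define j where "j = Arrow X Z j'"
    have ij: "arr i" "arr j" "src i = tgt f" "tgt i = Z" "src j = X" "tgt j = Z"
      "adag i ** i = aid (tgt f)" "adag j ** j = aid X" "adag i ** j = anul X (tgt f)"
      using Z X f arrD ij' by (auto simp: i_def j_def mor_simps intro!: arrow_eqI)
    have ji: "adag j ** i = anul (tgt f) X"
      using arg_cong[OF ij(9), of adag] ij(1-6) X f arrD by simp
    have sX: "src f = X" by (simp add: X_def)
    define g where "g = i ** f +. s *. j"
    have g: "arr g" "src g = X" "tgt g = Z" using ij f by (auto simp: g_def sX)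
    have g1: "adag i ** g = f"
    proof -
      have "adag i ** g = (adag i ** i) ** f +. s *. (adag i ** j)"
        using ij(1-6) f sX by (simp add: g_def acmp_aplus_right)
      then show ?thesis using ij f sX X arrD by simp
    qed
    have g2: "adag j ** g = s *. aid X"
    proof -
      have "adag j ** g = (adag j ** i) ** f +. s *. (adag j ** j)"
        using ij(1-6) f sX by (simp add: g_def acmp_aplus_right)
      then show ?thesis using ij f sX X ji by simp
    qed
    have "adag g = adag f ** adag i +. cnj s *. adag j"
      unfolding g_def using ij(1-6) f sX by simp
    then have "adag g ** g = adag f ** (adag i ** g) +. cnj s *. (adag j ** g)"
      using ij(1-6) f sX g by (simp add: acmp_aplus_left)
    also have "\<dots> = k *. aid X +. (- k) *. aid X"
      unfolding g1 g2 using X s k by simp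
    also have "\<dots> = anul X X" using X by (simp add: aplus_ascale ascale_zero)
    finally have "g = anul X Z" using adag_positive[of g] g by simp
    then have "f = anul X (tgt f)" using g1 ij f X Z by simp
    then show False using f sX by simp
  qed
  then show ?thesis using that[of d] k unfolding d X_def by blast
qed

text \<open>Positivity of the scalar comes from \<open>norm_sq_pos\<close>. That the same scalar
  serves on both sides follows from evaluating \<open>f ** adag f ** f\<close> with either
  bracketing.\<close>

lemma schur:
  assumes "arr f" "simple C (src f)" "simple C (tgt f)" "f \<noteq> anul (src f) (tgt f)"
  obtains k where "k > 0" "adag f ** f = of_real k *. aid (src f)"
    "f ** adag f = of_real k *. aid (tgt f)"
proof -
  obtain k where k: "k > 0" "adag f ** f = of_real k *. aid (src f)"
    using norm_sq_pos assms by metis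
  obtain l where l: "f ** adag f = l *. aid (tgt f)"
    using simple_scalar[of "tgt f" "f ** adag f"] assms by auto
  have "of_real k *. f = f ** (adag f ** f)" unfolding k using assms simple_obj by simp
  also have "\<dots> = (f ** adag f) ** f" using assms by simp
  also have "\<dots> = l *. f" unfolding l using assms simple_obj by simp
  finally have "l = k" using ascale_inject[OF assms(1,4)] by metis
  then show ?thesis using that[of k] k l by blast
qed

lemma iso_arr_if_unitary_up_to_scale:
  assumes "arr f" "k \<noteq> 0" "adag f ** f = k *. aid (src f)" "f ** adag f = k *. aid (tgt f)"
  shows "iso_arr f ((1/k) *. adag f)"
  using assms arrD by (auto simp: iso_arr_def)

lemma schur_iso:
  assumes "arr f" "simple C (src f)" "simple C (tgt f)" "f \<noteq> anul (src f) (tgt f)"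
  shows "isomorphic C (src f) (tgt f)"
proof -
  obtain k where "k > 0" "adag f ** f = of_real k *. aid (src f)"
    "f ** adag f = of_real k *. aid (tgt f)"
    using schur assms by metis
  then have "iso_arr f ((1/k) *. adag f)" using assms(1) iso_arr_if_unitary_up_to_scale[of f k] by simp
  then show ?thesis using simple_obj[OF assms(2)] simple_obj[OF assms(3)] isomorphic_iff by blast
qed

lemma iso_nonzero:
  assumes "iso_arr f g" "simple C (src f)"
  shows "f \<noteq> anul (src f) (tgt f)"
proof
  assume 0: "f = anul (src f) (tgt f)"
  note f = iso_arrD[OF assms(1)]
  have "aid (src f) = g ** f" using f by simp
  also have "\<dots> = anul (src f) (src f)" using f by (subst 0) (auto simp: arrD)
  finally show False using simple_aid_neq assms by blast
qed

lemma equiv_simple: "equiv {X. simple C X} {(X, Y). simple C X \<and> simple C Y \<and> isomorphic C X Y}"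
proof (rule equivI)
  show "refl_on {X. simple C X} {(X, Y). simple C X \<and> simple C Y \<and> isomorphic C X Y}"
    by (auto simp: refl_on_def isomorphic_refl simple_obj)
  show "sym {(X, Y). simple C X \<and> simple C Y \<and> isomorphic C X Y}"
    by (auto simp: sym_def intro: isomorphic_sym simple_obj)
  show "trans {(X, Y). simple C X \<and> simple C Y \<and> isomorphic C X Y}"
    using isomorphic_trans simple_obj by (auto simp: trans_def)
qed auto

end

section \<open>Duals and invertible objects\<close>

context unitary_fusion_category
begin

definition atens :: "('a, 'b) arrow \<Rightarrow> ('a, 'b) arrow \<Rightarrow> ('a, 'b) arrow" (infixl \<open>\<star>\<close> 65)
  where "f \<star> g = Arrow (src f \<odot> src g) (tgt f \<odot> tgt g) (mor f \<boxtimes> mor g)"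

definition asc :: "'a \<Rightarrow> 'a \<Rightarrow> 'a \<Rightarrow> ('a, 'b) arrow" where
  "asc X Y Z = Arrow ((X \<odot> Y) \<odot> Z) (X \<odot> (Y \<odot> Z)) (\<a> X Y Z)"

definition lu :: "'a \<Rightarrow> ('a, 'b) arrow" where "lu X = Arrow (\<I> \<odot> X) X (\<l> X)"

definition ru :: "'a \<Rightarrow> ('a, 'b) arrow" where "ru X = Arrow (X \<odot> \<I>) X (\<r> X)"

lemma src_tgt_tens [simp]:
  "src (f \<star> g) = src f \<odot> src g" "tgt (f \<star> g) = tgt f \<odot> tgt g"
  "src (asc X Y Z) = (X \<odot> Y) \<odot> Z" "tgt (asc X Y Z) = X \<odot> (Y \<odot> Z)"
  "src (lu X) = \<I> \<odot> X" "tgt (lu X) = X" "src (ru X) = X \<odot> \<I>" "tgt (ru X) = X"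
  by (simp_all add: atens_def asc_def lu_def ru_def)

lemma mor_tens_simps:
  "mor (f \<star> g) = mor f \<boxtimes> mor g" "mor (asc X Y Z) = \<a> X Y Z" "mor (lu X) = \<l> X" "mor (ru X) = \<r> X"
  by (simp_all add: atens_def asc_def lu_def ru_def)

lemmas [simp] = unit_in tens_o_in

lemma arr_tens [simp]:
  "arr f \<Longrightarrow> arr g \<Longrightarrow> arr (f \<star> g)"
  "X \<in> Obj C \<Longrightarrow> Y \<in> Obj C \<Longrightarrow> Z \<in> Obj C \<Longrightarrow> arr (asc X Y Z)"
  "X \<in> Obj C \<Longrightarrow> arr (lu X)" "X \<in> Obj C \<Longrightarrow> arr (ru X)"
  using assoc_unitary[of X Y Z] lunit_unitary[of X] runit_unitary[of X]
  by (simp_all add: arr_def mor_tens_simps tens_m_in unitary_def)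

lemma aid_tens: "X \<in> Obj C \<Longrightarrow> Y \<in> Obj C \<Longrightarrow> aid X \<star> aid Y = aid (X \<odot> Y)"
  by (intro arrow_eqI) (auto simp: mor_tens_simps mor_simps tens_ident)

lemma interchange:
  assumes "arr f" "arr f'" "arr g" "arr g'" "src f' = tgt f" "src g' = tgt g"
  shows "(f' \<star> g') ** (f \<star> g) = (f' ** f) \<star> (g' ** g)"
  using assms tens_cmp[of "src f" "tgt f" "tgt f'" "src g" "tgt g" "tgt g'" "mor f" "mor f'" "mor g" "mor g'"]
  by (intro arrow_eqI) (auto simp: arr_def mor_tens_simps mor_simps)

lemma interchange':
  assumes "arr f" "arr f'" "arr g" "arr g'" "src f' = tgt f" "src g' = tgt g"
    and "arr h" "tgt h = src f \<odot> src g"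
  shows "(f' \<star> g') ** (f \<star> g) ** h = ((f' ** f) \<star> (g' ** g)) ** h"
  using assms by (intro acmp_reassoc[OF interchange]) auto

lemma atens_aplus:
  "arr f \<Longrightarrow> arr f' \<Longrightarrow> arr g \<Longrightarrow> src f = src f' \<Longrightarrow> tgt f = tgt f' \<Longrightarrow>
    (f +. f') \<star> g = f \<star> g +. f' \<star> g"
  "arr f \<Longrightarrow> arr f' \<Longrightarrow> arr g \<Longrightarrow> src f = src f' \<Longrightarrow> tgt f = tgt f' \<Longrightarrow>
    g \<star> (f +. f') = g \<star> f +. g \<star> f'"
  by (auto intro!: arrow_eqI simp: arr_def mor_tens_simps mor_simps tens_plus_left tens_plus_right)

lemma atens_ascale [simp]:
  "arr f \<Longrightarrow> arr g \<Longrightarrow> (k *. f) \<star> g = k *. (f \<star> g)"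
  "arr f \<Longrightarrow> arr g \<Longrightarrow> f \<star> (k *. g) = k *. (f \<star> g)"
  by (auto intro!: arrow_eqI simp: arr_def mor_tens_simps mor_simps tens_scale_left tens_scale_right)

lemma atens_anul [simp]:
  assumes "arr f" "X \<in> Obj C" "Y \<in> Obj C"
  shows "anul X Y \<star> f = anul (X \<odot> src f) (Y \<odot> tgt f)"
    "f \<star> anul X Y = anul (src f \<odot> X) (tgt f \<odot> Y)"
proof -
  have n: "anul X Y = 0 *. anul X Y" "arr (anul X Y)" using assms by simp_all
  show "anul X Y \<star> f = anul (X \<odot> src f) (Y \<odot> tgt f)"
    by (subst n(1)) (use assms n(2) ascale_zero[of "anul X Y \<star> f"] in \<open>simp del: ascale_anul\<close>)
  show "f \<star> anul X Y = anul (src f \<odot> X) (tgt f \<odot> Y)"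
    by (subst n(1)) (use assms n(2) ascale_zero[of "f \<star> anul X Y"] in \<open>simp del: ascale_anul\<close>)
qed

lemma adag_atens [simp]: "arr f \<Longrightarrow> arr g \<Longrightarrow> adag (f \<star> g) = adag f \<star> adag g"
  by (auto intro!: arrow_eqI simp: arr_def mor_tens_simps mor_simps tens_dag)

lemma asc_unitary [simp]:
  assumes "X \<in> Obj C" "Y \<in> Obj C" "Z \<in> Obj C"
  shows "adag (asc X Y Z) ** asc X Y Z = aid ((X \<odot> Y) \<odot> Z)"
    "asc X Y Z ** adag (asc X Y Z) = aid (X \<odot> (Y \<odot> Z))"
  using assoc_unitary[OF assms]
  by (auto intro!: arrow_eqI simp: unitary_def mor_tens_simps mor_simps)

lemma lu_unitary [simp]:
  assumes "X \<in> Obj C" shows "adag (lu X) ** lu X = aid (\<I> \<odot> X)" "lu X ** adag (lu X) = aid X"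
  using lunit_unitary[OF assms] by (auto intro!: arrow_eqI simp: unitary_def mor_tens_simps mor_simps)

lemma ru_unitary [simp]:
  assumes "X \<in> Obj C" shows "adag (ru X) ** ru X = aid (X \<odot> \<I>)" "ru X ** adag (ru X) = aid X"
  using runit_unitary[OF assms] by (auto intro!: arrow_eqI simp: unitary_def mor_tens_simps mor_simps)

lemma iso_arr_structure:
  "X \<in> Obj C \<Longrightarrow> Y \<in> Obj C \<Longrightarrow> Z \<in> Obj C \<Longrightarrow> iso_arr (asc X Y Z) (adag (asc X Y Z))"
  "X \<in> Obj C \<Longrightarrow> iso_arr (lu X) (adag (lu X))" "X \<in> Obj C \<Longrightarrow> iso_arr (ru X) (adag (ru X))"
  by (auto simp: iso_arr_def)

lemma iso_arr_aid: "X \<in> Obj C \<Longrightarrow> iso_arr (aid X) (aid X)"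
  by (auto simp: iso_arr_def)

lemma iso_arr_atens: "iso_arr f g \<Longrightarrow> iso_arr h k \<Longrightarrow> iso_arr (f \<star> h) (g \<star> k)"
  by (auto simp: iso_arr_def interchange aid_tens arrD)

lemma asc_natural:
  assumes "arr f" "arr g" "arr h"
  shows "asc (tgt f) (tgt g) (tgt h) ** ((f \<star> g) \<star> h) = (f \<star> (g \<star> h)) ** asc (src f) (src g) (src h)"
  using assms assoc_natural[of "src f" "tgt f" "src g" "tgt g" "src h" "tgt h" "mor f" "mor g" "mor h"]
  by (intro arrow_eqI) (auto simp: arr_def mor_tens_simps mor_simps)

lemma asc_adag_natural:
  assumes "arr f" "arr g" "arr h"
  shows "adag (asc (tgt f) (tgt g) (tgt h)) ** (f \<star> (g \<star> h))
    = ((f \<star> g) \<star> h) ** adag (asc (src f) (src g) (src h))"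
  using arg_cong[OF asc_natural[of "adag f" "adag g" "adag h"], of adag] assms
  by (simp add: arrD)

lemma lu_natural: "arr f \<Longrightarrow> lu (tgt f) ** (aid \<I> \<star> f) = f ** lu (src f)"
  using lunit_natural[of "src f" "tgt f" "mor f"]
  by (intro arrow_eqI) (auto simp: arr_def mor_tens_simps mor_simps)

lemma ru_natural: "arr f \<Longrightarrow> ru (tgt f) ** (f \<star> aid \<I>) = f ** ru (src f)"
  using runit_natural[of "src f" "tgt f" "mor f"]
  by (intro arrow_eqI) (auto simp: arr_def mor_tens_simps mor_simps)

lemma ru_adag_natural: "arr f \<Longrightarrow> adag (ru (tgt f)) ** f = (f \<star> aid \<I>) ** adag (ru (src f))"
  using arg_cong[OF ru_natural[of "adag f"], of adag] by (simp add: arrD)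

lemma apentagon:
  assumes "W \<in> Obj C" "X \<in> Obj C" "Y \<in> Obj C" "Z \<in> Obj C"
  shows "asc W X (Y \<odot> Z) ** asc (W \<odot> X) Y Z
    = (aid W \<star> asc X Y Z) ** asc W (X \<odot> Y) Z ** (asc W X Y \<star> aid Z)"
  using pentagon[OF assms]
  by (intro arrow_eqI) (auto simp: mor_tens_simps mor_simps)

definition adual :: "'a \<Rightarrow> 'a \<Rightarrow> ('a, 'b) arrow \<Rightarrow> ('a, 'b) arrow \<Rightarrow> bool" where
  "adual X Y u e \<longleftrightarrow> X \<in> Obj C \<and> Y \<in> Obj C \<and> arr u \<and> src u = \<I> \<and> tgt u = X \<odot> Y \<and>
     arr e \<and> src e = Y \<odot> X \<and> tgt e = \<I> \<and>
     ru X ** (aid X \<star> e) ** asc X Y X ** (u \<star> aid X) ** adag (lu X) = aid X \<and>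
     lu Y ** (e \<star> aid Y) ** adag (asc Y X Y) ** (aid Y \<star> u) ** adag (ru Y) = aid Y"

lemma adualD:
  assumes "adual X Y u e"
  shows "X \<in> Obj C" "Y \<in> Obj C" "arr u" "src u = \<I>" "tgt u = X \<odot> Y"
    "arr e" "src e = Y \<odot> X" "tgt e = \<I>"
    and "ru X ** (aid X \<star> e) ** asc X Y X ** (u \<star> aid X) ** adag (lu X) = aid X"
    and "lu Y ** (e \<star> aid Y) ** adag (asc Y X Y) ** (aid Y \<star> u) ** adag (ru Y) = aid Y"
  using assms by (auto simp: adual_def)

lemma adual_iff: "dual_pair C X Y coev ev \<longleftrightarrow>
    adual X Y (Arrow \<I> (X \<odot> Y) coev) (Arrow (Y \<odot> X) \<I> ev)"
proof (cases "X \<in> Obj C \<and> Y \<in> Obj C")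
  case True
  then show ?thesis
    unfolding adual_def dual_pair_def
    by (auto intro!: arrow_eqI simp: mor_tens_simps mor_simps
        dest!: arg_cong[where f = mor and x = "_ ** _"])
qed (auto simp: adual_def dual_pair_def)

text \<open>The unitors are moved to the right-hand side, so that the left-hand side can be
  recognised inside a tensor factor of a longer composite, as in \<open>zigzag_iso\<close>.\<close>

lemma zigzag_2_arr:
  assumes "adual X Y u e"
  shows "(e \<star> aid Y) ** adag (asc Y X Y) ** (aid Y \<star> u) = adag (lu Y) ** ru Y"
proof -
  note d = adualD[OF assms]
  define m where "m = (e \<star> aid Y) ** adag (asc Y X Y) ** (aid Y \<star> u)"
  have m: "arr m" "src m = Y \<odot> \<I>" "tgt m = \<I> \<odot> Y" using d(1-8) by (auto simp: m_def)
  have "lu Y ** m ** adag (ru Y) = aid Y" using d by (simp add: m_def)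
  then have "adag (lu Y) ** (lu Y ** m ** adag (ru Y)) ** ru Y = adag (lu Y) ** ru Y"
    using d(1,2) by simp
  also have "adag (lu Y) ** (lu Y ** m ** adag (ru Y)) ** ru Y = m"
    using d(1,2) m by (simp add: acmp_reassoc[OF lu_unitary(1)])
  finally show ?thesis by (simp add: m_def)
qed

text \<open>By the pentagon and the second zigzag, the left-hand side differs from the identity of
  \<open>X \<odot> Y\<close> only by structural isomorphisms; by Kelly's coherence lemmas it is the identity, but
  invertibility suffices.\<close>

lemma zigzag_iso:
  assumes "adual X Y u e"
  defines "\<theta> \<equiv> (((aid X \<star> e) ** asc X Y X) \<star> aid Y) ** adag (asc (X \<odot> Y) X Y) **
    (aid (X \<odot> Y) \<star> u) ** adag (ru (X \<odot> Y))"
  obtains \<theta>' where "iso_arr \<theta> \<theta>'"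
proof -
  note d = adualD[OF assms(1)]
  have 1: "((aid X \<star> e) ** asc X Y X) \<star> aid Y = ((aid X \<star> e) \<star> aid Y) ** (asc X Y X \<star> aid Y)"
    using d(1-8) by (simp add: interchange)
  have 2: "(asc X Y X \<star> aid Y) ** adag (asc (X \<odot> Y) X Y)
    = adag (asc X (Y \<odot> X) Y) ** (aid X \<star> adag (asc Y X Y)) ** asc X Y (X \<odot> Y)" (is "?l = ?r")
  proof -
    have "?r = adag (asc X (Y \<odot> X) Y) ** (aid X \<star> adag (asc Y X Y)) **
        (asc X Y (X \<odot> Y) ** asc (X \<odot> Y) X Y) ** adag (asc (X \<odot> Y) X Y)"
      using d(1,2) by simp
    also have "\<dots> = adag (asc X (Y \<odot> X) Y) ** (aid X \<star> adag (asc Y X Y)) **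
        (aid X \<star> asc Y X Y) ** asc X (Y \<odot> X) Y ** (asc X Y X \<star> aid Y) ** adag (asc (X \<odot> Y) X Y)"
      unfolding apentagon[OF d(1,2,1,2)] using d(1,2) by simp
    also have "\<dots> = ?l"
      using d(1,2) by (simp add: interchange' aid_tens acmp_reassoc[OF asc_unitary(1)])
    finally show ?thesis by simp
  qed
  have 3: "((aid X \<star> e) \<star> aid Y) ** adag (asc X (Y \<odot> X) Y)
    = adag (asc X \<I> Y) ** (aid X \<star> (e \<star> aid Y))"
    using asc_adag_natural[of "aid X" e "aid Y"] d(1-8) by simp
  have 4: "asc X Y (X \<odot> Y) ** (aid (X \<odot> Y) \<star> u) = (aid X \<star> (aid Y \<star> u)) ** asc X Y \<I>"
    using asc_natural[of "aid X" "aid Y" u] d(1-8) by (simp add: aid_tens)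
  have "\<theta> = ((aid X \<star> e) \<star> aid Y) ** (asc X Y X \<star> aid Y) ** adag (asc (X \<odot> Y) X Y) **
      (aid (X \<odot> Y) \<star> u) ** adag (ru (X \<odot> Y))"
    unfolding \<theta>_def 1 using d(1-8) by simp
  also have "\<dots> = ((aid X \<star> e) \<star> aid Y) ** adag (asc X (Y \<odot> X) Y) ** (aid X \<star> adag (asc Y X Y)) **
      asc X Y (X \<odot> Y) ** (aid (X \<odot> Y) \<star> u) ** adag (ru (X \<odot> Y))"
    using d(1-8) by (simp add: acmp_reassoc[OF 2])
  also have "\<dots> = adag (asc X \<I> Y) ** (aid X \<star> (e \<star> aid Y)) ** (aid X \<star> adag (asc Y X Y)) **
      (aid X \<star> (aid Y \<star> u)) ** asc X Y \<I> ** adag (ru (X \<odot> Y))"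
    using d(1-8) by (simp add: acmp_reassoc[OF 3] acmp_reassoc[OF 4])
  also have "\<dots> = adag (asc X \<I> Y) **
      (aid X \<star> ((e \<star> aid Y) ** adag (asc Y X Y) ** (aid Y \<star> u))) ** asc X Y \<I> ** adag (ru (X \<odot> Y))"
    using d(1-8) by (simp add: interchange')
  also have "\<dots> = adag (asc X \<I> Y) ** (aid X \<star> (adag (lu Y) ** ru Y)) ** asc X Y \<I> ** adag (ru (X \<odot> Y))"
    unfolding zigzag_2_arr[OF assms(1)] ..
  finally have *: "\<theta> = \<dots>" .
  show ?thesis
    by (rule that, unfold *, (rule iso_arr_acmp iso_arr_atens iso_arr_aid iso_arr_structure
          iso_arr_structure[THEN iso_arr_sym] | simp add: d(1,2))+)
qed

text \<open>Injectivity of bending the leg \<open>Y\<close> down with \<open>e\<close>: bending it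
  back up with \<open>u\<close> returns \<open>?\<theta> ** h\<close>, and \<open>?\<theta>\<close>
  is invertible by \<open>zigzag_iso\<close>.\<close>

lemma coev_tensor_faithful:
  assumes "adual X Y u e" and h: "arr h" "tgt h = X \<odot> Y"
    and 0: "((aid X \<star> e) ** asc X Y X) ** (h \<star> aid X) = anul (src h \<odot> X) (X \<odot> \<I>)"
  shows "h = anul (src h) (tgt h)"
proof -
  note d = adualD[OF assms(1)]
  define B where "B = (aid X \<star> e) ** asc X Y X"
  have B: "arr B" "src B = (X \<odot> Y) \<odot> X" "tgt B = X \<odot> \<I>" using d(1-8) by (auto simp: B_def)
  define W where "W = src h"
  have W: "src h = W" "W \<in> Obj C" using h arrD by (auto simp: W_def)
  obtain \<theta>' where \<theta>': "iso_arr ((B \<star> aid Y) ** adag (asc (X \<odot> Y) X Y) **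
      (aid (X \<odot> Y) \<star> u) ** adag (ru (X \<odot> Y))) \<theta>'" (is "iso_arr ?\<theta> _")
    using zigzag_iso[OF assms(1)] unfolding B_def by metis
  have 1: "adag (ru (X \<odot> Y)) ** h = (h \<star> aid \<I>) ** adag (ru W)"
    using ru_adag_natural[of h] h W by simp
  have 2: "(aid (X \<odot> Y) \<star> u) ** (h \<star> aid \<I>) = (h \<star> aid (X \<odot> Y)) ** (aid W \<star> u)"
    using d(1-8) h W by (simp add: interchange)
  have 3: "adag (asc (X \<odot> Y) X Y) ** (h \<star> aid (X \<odot> Y)) = ((h \<star> aid X) \<star> aid Y) ** adag (asc W X Y)"
    using asc_adag_natural[of h "aid X" "aid Y"] d(1-8) h W by (simp add: aid_tens)
  have "?\<theta> ** h = (B \<star> aid Y) ** ((h \<star> aid X) \<star> aid Y) ** adag (asc W X Y) ** (aid W \<star> u) ** adag (ru W)"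
    using d(1-8) h W B by (simp add: 1 acmp_reassoc[OF 2] acmp_reassoc[OF 3])
  also have "\<dots> = ((B ** (h \<star> aid X)) \<star> aid Y) ** adag (asc W X Y) ** (aid W \<star> u) ** adag (ru W)"
    using d(1-8) h W B by (simp add: interchange')
  also have "\<dots> = anul W ((X \<odot> \<I>) \<odot> Y)"
    unfolding 0[folded B_def] using d(1-8) W by simp
  finally have "?\<theta> ** h = anul (src h) (tgt ?\<theta>)" using W B by simp
  then show ?thesis
    using iso_arr_cancel[OF \<theta>', of h] h d(1-2) by simp
qed

text \<open>The mirror image of the preceding fact: the second zigzag recovers \<open>f\<close> from
  \<open>(aid X \<star> f) ** u\<close> by bending the leg \<open>X\<close> with
  \<open>e\<close>.\<close>

lemma eval_faithful:
  assumes "adual X Y u e" and f: "arr f" "src f = Y"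
    and 0: "(aid X \<star> f) ** u = anul \<I> (X \<odot> tgt f)"
  shows "f = anul (src f) (tgt f)"
proof -
  note d = adualD[OF assms(1)]
  define W where "W = tgt f"
  have W: "tgt f = W" "W \<in> Obj C" using f arrD by (auto simp: W_def)
  have 1: "f ** lu Y = lu W ** (aid \<I> \<star> f)" using lu_natural[of f] f W by simp
  have 2: "(aid \<I> \<star> f) ** (e \<star> aid Y) = (e \<star> aid W) ** (aid (Y \<odot> X) \<star> f)"
    using d(1-8) f W by (simp add: interchange)
  have 3: "(aid (Y \<odot> X) \<star> f) ** adag (asc Y X Y) = adag (asc Y X W) ** (aid Y \<star> (aid X \<star> f))"
    using asc_adag_natural[of "aid Y" "aid X" f] d(1-8) f W by (simp add: aid_tens)
  have "f = f ** (lu Y ** (e \<star> aid Y) ** adag (asc Y X Y) ** (aid Y \<star> u) ** adag (ru Y))"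
    unfolding d(10) using f by simp
  also have "\<dots> = lu W ** (e \<star> aid W) ** adag (asc Y X W) ** (aid Y \<star> (aid X \<star> f)) ** (aid Y \<star> u) ** adag (ru Y)"
    using d(1-8) f W by (simp add: acmp_reassoc[OF 1] acmp_reassoc[OF 2] acmp_reassoc[OF 3])
  also have "\<dots> = lu W ** (e \<star> aid W) ** adag (asc Y X W) ** (aid Y \<star> ((aid X \<star> f) ** u)) ** adag (ru Y)"
    using d(1-8) f W by (simp add: interchange')
  also have "\<dots> = anul Y W" unfolding 0 using d(1-8) W f by simp
  finally show ?thesis using f W by simp
qed


text \<open>A vanishing \<open>u\<close> or \<open>e\<close> would make the first zigzag, hence the
  identity of \<open>X\<close>, vanish; a vanishing identity of \<open>Y\<close> would make
  \<open>u\<close> vanish.\<close>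

lemma adual_nonzero:
  assumes "adual X Y u e" "aid X \<noteq> anul X X"
  shows "u \<noteq> anul \<I> (X \<odot> Y)" "e \<noteq> anul (Y \<odot> X) \<I>" "aid Y \<noteq> anul Y Y"
proof -
  note d = adualD[OF assms(1)]
  show u: "u \<noteq> anul \<I> (X \<odot> Y)"
    using assms(2) d(1-8) d(9)[symmetric] by auto
  show e: "e \<noteq> anul (Y \<odot> X) \<I>"
    using assms(2) d(1-8) d(9)[symmetric] by auto
  show "aid Y \<noteq> anul Y Y"
  proof
    assume 0: "aid Y = anul Y Y"
    have "u = (aid X \<star> aid Y) ** u" using d(1-8) by (simp add: aid_tens)
    also have "\<dots> = anul \<I> (X \<odot> Y)" unfolding 0 using d(1-8) by simp
    finally show False using u by simp
  qed
qed

lemma adual_scale: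
  assumes "adual X Y u e" "k \<noteq> 0"
  shows "adual X Y (k *. u) ((1/k) *. e)"
  using assms by (simp add: adual_def)

text \<open>Bending embeds the morphisms from the unit to \<open>X \<odot> Y\<close> into the
  endomorphisms of \<open>X\<close>, which are scalars, and \<open>u\<close> is sent to the
  identity.\<close>

lemma coev_unique:
  assumes "adual X Y u e" "simple C X" and g: "arr g" "src g = \<I>" "tgt g = X \<odot> Y"
  obtains k where "g = k *. u"
proof -
  note d = adualD[OF assms(1)]
  define B where "B = (aid X \<star> e) ** asc X Y X"
  have B: "arr B" "src B = (X \<odot> Y) \<odot> X" "tgt B = X \<odot> \<I>" using d(1-8) by (auto simp: B_def)
  obtain k where k: "ru X ** B ** (g \<star> aid X) ** adag (lu X) = k *. aid X"
    using simple_scalar[OF assms(2), of "ru X ** B ** (g \<star> aid X) ** adag (lu X)"] g d(1-8) B by auto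
  have u: "ru X ** B ** (u \<star> aid X) ** adag (lu X) = aid X"
    using d by (simp add: B_def)
  define M where "M f = ru X ** B ** (f \<star> aid X) ** adag (lu X)" for f
  have MM: "B ** (f \<star> aid X) = adag (ru X) ** M f ** lu X" if "arr f" "src f = \<I>" "tgt f = X \<odot> Y" for f
    using that d(1-8) B by (simp add: M_def acmp_reassoc[OF ru_unitary(1)])
  have "B ** (g \<star> aid X) = adag (ru X) ** (k *. aid X) ** lu X"
    using MM[of g] g k by (simp add: M_def)
  also have "\<dots> = k *. (B ** (u \<star> aid X))"
    using MM[of u] d(1-8) u by (simp add: M_def)
  finally have gu: "B ** (g \<star> aid X) = k *. (B ** (u \<star> aid X))" .
  define h where "h = g +. (-1) *. k *. u"
  have h: "arr h" "src h = \<I>" "tgt h = X \<odot> Y" using g d(1-8) by (auto simp: h_def)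
  have "B ** (h \<star> aid X) = B ** (g \<star> aid X) +. (-1) *. k *. (B ** (u \<star> aid X))"
    using g d(1-8) B by (simp add: h_def atens_aplus acmp_aplus_right)
  also have "\<dots> = anul (\<I> \<odot> X) (X \<odot> \<I>)"
    unfolding gu[symmetric] using aplus_neg[of "B ** (g \<star> aid X)"] g d(1-8) B by simp
  finally have "h = anul \<I> (X \<odot> Y)"
    using coev_tensor_faithful[OF assms(1), of h] h B_def by simp
  then have "g = k *. u"
    using diff_eq_anul_iff[of g "k *. u"] g d(1-8) unfolding h_def by simp
  then show ?thesis using that by blast
qed

text \<open>Endomorphisms of \<open>Y\<close> embed, by composition with \<open>u\<close>, into the
  morphisms from the unit to \<open>X \<odot> Y\<close>, all of which are multiples of
  \<open>u\<close> by \<open>coev_unique\<close>.\<close>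

lemma dual_simple:
  assumes "adual X Y u e" "simple C X"
  shows "simple C Y"
proof (rule simpleI)
  note d = adualD[OF assms(1)]
  show "Y \<in> Obj C" by fact
  show "aid Y \<noteq> anul Y Y" using adual_nonzero[OF assms(1)] simple_aid_neq[OF assms(2)] by simp
  fix f assume f: "arr f" "src f = Y" "tgt f = Y"
  obtain k where k: "(aid X \<star> f) ** u = k *. u"
    using coev_unique[OF assms, of "(aid X \<star> f) ** u"] f d(1-8) by auto
  define h where "h = f +. (-1) *. k *. aid Y"
  have h: "arr h" "src h = Y" "tgt h = Y" using f d(1-8) by (auto simp: h_def)
  have "(aid X \<star> h) ** u = (aid X \<star> f) ** u +. (-1) *. k *. u"
    using f d(1-8) by (simp add: h_def atens_aplus acmp_aplus_left aid_tens)
  also have "\<dots> = anul \<I> (X \<odot> Y)"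
    unfolding k using aplus_neg[of "k *. u"] d(1-8) by simp
  finally have "h = anul Y Y"
    using eval_faithful[OF assms(1), of h] h by simp
  then show "\<exists>k. f = k *. aid Y"
    using diff_eq_anul_iff[of f "k *. aid Y"] f d(1-8) unfolding h_def by auto
qed

section \<open>Normalised duals and quantum dimension 1\<close>

definition ndual :: "'a \<Rightarrow> 'a \<Rightarrow> ('a, 'b) arrow \<Rightarrow> ('a, 'b) arrow \<Rightarrow> complex \<Rightarrow> bool" where
  "ndual X Y u e d \<longleftrightarrow> adual X Y u e \<and> adag u ** u = d *. aid \<I> \<and> e ** adag e = d *. aid \<I>"

lemma ndual_iff: "normalized_dual C X Y coev ev \<and> coev\<dagger> \<Zcomp> coev = d \<cdot> \<i> \<I> \<longleftrightarrow>
    ndual X Y (Arrow \<I> (X \<odot> Y) coev) (Arrow (Y \<odot> X) \<I> ev) d"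
  unfolding ndual_def normalized_dual_def adual_iff
  by (auto simp: acmp_def adag_def ascale_def aid_def)

lemma ex_ndual:
  assumes "simple C X"
  obtains Y u e d where "ndual X Y u e (complex_of_real d)"
proof -
  obtain Y coev ev where "dual_pair C X Y coev ev" using rigid simple_obj[OF assms] by blast
  then obtain u e where a: "adual X Y u e" unfolding adual_iff by blast
  note d = adualD[OF a] and nz = adual_nonzero[OF a simple_aid_neq[OF assms]]
  obtain m where m: "adag u ** u = of_real m *. aid \<I>" "m > 0"
    using norm_sq_pos[of u] d(1-8) nz unit_simple by auto
  have "adag e \<noteq> anul \<I> (Y \<odot> X)"
    using nz(2) adag_adag[of e] adag_anul[of \<I> "Y \<odot> X"] d(1-8) by force
  then obtain n where n: "e ** adag e = of_real n *. aid \<I>" "n > 0"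
    using norm_sq_pos[of "adag e"] d(1-8) unit_simple by auto
  \<comment> \<open>Scaling \<open>u\<close> by \<open>r\<close> and \<open>e\<close> by
    \<open>1 / r\<close> preserves the zigzags and turns the loop values \<open>m\<close> and
    \<open>n\<close> into \<open>r^2 m\<close> and \<open>n / r^2\<close>. These agree when
    \<open>r^4 = n / m\<close>, and their common value is \<open>sqrt (m * n)\<close>.\<close>
  define r where "r = sqrt (sqrt (n / m))"
  have r: "r > 0" "r * r * m = sqrt (m * n)" "n / (r * r) = sqrt (m * n)"
  proof -
    show "r > 0" using m n by (simp add: r_def)
    have rr: "r * r = sqrt (n / m)" using m n by (simp add: r_def)
    show "r * r * m = sqrt (m * n)"
      unfolding rr using m n by (simp add: real_sqrt_divide real_sqrt_mult field_simps)
    show "n / (r * r) = sqrt (m * n)"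
      unfolding rr using m n by (simp add: real_sqrt_divide real_sqrt_mult field_simps)
  qed
  let ?k = "complex_of_real r"
  have "adual X Y (?k *. u) ((1 / ?k) *. e)"
    using adual_scale[OF a] r(1) by simp
  moreover have "adag (?k *. u) ** (?k *. u) = of_real (sqrt (m * n)) *. aid \<I>"
    using d(1-8) m(1) r(2) by (simp add: mult.assoc flip: of_real_mult)
  moreover have "((1 / ?k) *. e) ** adag ((1 / ?k) *. e) = of_real (sqrt (m * n)) *. aid \<I>"
    using d(1-8) n(1) r(3) by (simp flip: of_real_mult of_real_divide)
  ultimately have "ndual X Y (?k *. u) ((1 / ?k) *. e) (complex_of_real (sqrt (m * n)))"
    by (simp add: ndual_def)
  then show ?thesis using that by blast
qed

lemma Arrow_collapse: "src f = X \<Longrightarrow> tgt f = Y \<Longrightarrow> Arrow X Y (mor f) = f"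
  by (cases f) auto

text \<open>\<open>qdim\<close> is a choice, so nothing is known of it until some normalised dual
  exists; \<open>ex_ndual\<close> provides one.\<close>

lemma qdim_ndual:
  assumes "simple C (rep x)"
  obtains Y u e where "ndual (rep x) Y u e (complex_of_real (qdim C x))"
proof -
  obtain Y u e d where n: "ndual (rep x) Y u e (complex_of_real d)" using ex_ndual assms by blast
  have "normalized_dual C (rep x) Y (mor u) (mor e) \<and> (mor u)\<dagger> \<Zcomp> mor u = complex_of_real d \<cdot> \<i> \<I>"
    unfolding ndual_iff using n by (auto simp: ndual_def adual_def Arrow_collapse)
  then have "\<exists>d Y coev ev. normalized_dual C (rep x) Y coev ev \<and> coev\<dagger> \<Zcomp> coev = complex_of_real d \<cdot> \<i> \<I>"
    by blast
  from someI_ex[OF this] show ?thesis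
    using that unfolding qdim_def[symmetric] unfolding ndual_iff by blast
qed

text \<open>With loop value 1 the first zigzag writes the identity of \<open>X\<close> as
  \<open>B ** A\<close> with \<open>A\<close> isometric and \<open>B\<close> coisometric, which
  forces \<open>B = adag A\<close>. Bending the defect \<open>h = 1 - u ** adag u\<close> then
  factors through \<open>adag u ** h = 0\<close>, and bending is injective. So \<open>u\<close> is
  unitary, which is the passage from dimension 1 to invertibility.\<close>

lemma ndual_one_coisometry:
  assumes "ndual X Y u e 1"
  shows "u ** adag u = aid (X \<odot> Y)"
proof -
  have a: "adual X Y u e" and l: "adag u ** u = aid \<I>" "e ** adag e = aid \<I>"
    using assms by (auto simp: ndual_def)
  note d = adualD[OF a]
  define A where "A = (u \<star> aid X) ** adag (lu X)"
  define B where "B = ru X ** (aid X \<star> e) ** asc X Y X"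
  have AB: "arr A" "src A = X" "tgt A = (X \<odot> Y) \<odot> X" "arr B" "src B = (X \<odot> Y) \<odot> X" "tgt B = X"
    using d(1-8) by (auto simp: A_def B_def)
  have BA: "B = adag A"
  proof (rule isometry_section_eq_adag)
    show "adag A ** A = aid (src A)"
      using d(1-8) l by (simp add: A_def interchange' aid_tens)
    show "B ** adag B = aid (src A)"
      using d(1-8) l AB(2)
      by (simp add: B_def acmp_reassoc[OF asc_unitary(2)] interchange' aid_tens)
    show "B ** A = aid (src A)" using d AB(2) by (simp add: A_def B_def)
  qed (use AB in auto)
  define h where "h = aid (X \<odot> Y) +. (-1) *. (u ** adag u)"
  have h: "arr h" "src h = X \<odot> Y" "tgt h = X \<odot> Y" using d(1-8) by (auto simp: h_def)
  have uh: "adag u ** h = anul (X \<odot> Y) \<I>"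
    using d(1-8) l aplus_neg[of "adag u"]
    by (simp add: h_def acmp_aplus_right acmp_reassoc[OF l(1)])
  have "(aid X \<star> e) ** asc X Y X = adag (ru X) ** B"
    using d(1-8) by (simp add: B_def acmp_reassoc[OF ru_unitary(1)])
  then have "((aid X \<star> e) ** asc X Y X) ** (h \<star> aid X) = adag (ru X) ** adag A ** (h \<star> aid X)"
    using AB h d(1-8) by (simp add: BA)
  also have "\<dots> = adag (ru X) ** lu X ** ((adag u ** h) \<star> aid X)"
    using d(1-8) h by (simp add: A_def interchange)
  also have "\<dots> = anul (src h \<odot> X) (X \<odot> \<I>)" unfolding uh using d(1-8) h by simp
  finally have "h = anul (X \<odot> Y) (X \<odot> Y)"
    using coev_tensor_faithful[OF a h(1,3)] h by simp
  then show ?thesis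
    using diff_eq_anul_iff[of "aid (X \<odot> Y)" "u ** adag u"] d(1-8) by (simp add: h_def)
qed

text \<open>If \<open>X \<odot> Y\<close> is simple, Schur's lemma makes \<open>u\<close> a multiple
  of a unitary, so \<open>A ** adag A\<close> is \<open>d\<close> times the identity. With
  \<open>B ** A = 1\<close> this gives \<open>d B = adag A\<close>. Then \<open>d\<close> times
  \<open>B ** adag B\<close> is \<open>adag (B ** A) = 1\<close>, while \<open>B ** adag B\<close>
  itself is \<open>d\<close>; hence \<open>d^2 = 1\<close>, and \<open>d\<close> is
  positive.\<close>

lemma ndual_loop_eq_one:
  assumes "ndual X Y u e (complex_of_real d)" "simple C X" "simple C (X \<odot> Y)"
  shows "d = 1"
proof -
  have a: "adual X Y u e" and l: "adag u ** u = of_real d *. aid \<I>" "e ** adag e = of_real d *. aid \<I>"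
    using assms by (auto simp: ndual_def)
  note D = adualD[OF a]
  obtain k where k: "k > 0" "adag u ** u = of_real k *. aid \<I>"
    "u ** adag u = of_real k *. aid (X \<odot> Y)"
    using schur[of u] D(1-8) unit_simple assms(3) adual_nonzero(1)[OF a simple_aid_neq[OF assms(2)]]
    by auto
  have "k = d" using k(2) l(1) simple_ascale_inject[OF unit_simple, of k d] by simp
  note k = k[unfolded this]
  define A where "A = (u \<star> aid X) ** adag (lu X)"
  define B where "B = ru X ** (aid X \<star> e) ** asc X Y X"
  have AB: "arr A" "src A = X" "tgt A = (X \<odot> Y) \<odot> X" "arr B" "src B = (X \<odot> Y) \<odot> X" "tgt B = X"
    using D(1-8) by (auto simp: A_def B_def)
  have 1: "adag A ** A = of_real d *. aid X"
    using D(1-8) l by (simp add: A_def interchange' aid_tens)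
  have 2: "B ** adag B = of_real d *. aid X"
    using D(1-8) l by (simp add: B_def acmp_reassoc[OF asc_unitary(2)] interchange' aid_tens)
  have 3: "B ** A = aid X" using D by (simp add: A_def B_def)
  have 4: "A ** adag A = of_real d *. aid ((X \<odot> Y) \<odot> X)"
    using D(1-8) k(3) by (simp add: A_def interchange' acmp_reassoc[OF lu_unitary(1)] interchange aid_tens)
  have 5: "of_real d *. B = adag A"
  proof -
    have "of_real d *. B = B ** (A ** adag A)" unfolding 4 using AB D(1-2) by simp
    also have "\<dots> = adag A" using AB by (simp add: acmp_reassoc[OF 3])
    finally show ?thesis .
  qed
  have "of_real (d * d) *. aid X = of_real d *. (B ** adag B)"
    unfolding 2 using D(1) by simp
  also have "\<dots> = (of_real d *. B) ** adag B" using AB by simp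
  also have "\<dots> = adag (B ** A)" unfolding 5 using AB by simp
  also have "\<dots> = 1 *. aid X" unfolding 3 using D(1) by simp
  finally have "complex_of_real (d * d) = 1" using simple_ascale_inject[OF assms(2)] by blast
  then have "d * d = 1" using of_real_eq_1_iff by blast
  then show "d = 1" using k(1) by (simp add: square_eq_1_iff)
qed

section \<open>Tensor-invertible objects\<close>

lemma isomorphicI: "iso_arr f g \<Longrightarrow> isomorphic C (src f) (tgt f)"
  using isomorphic_iff[of "src f" "tgt f"] iso_arrD(1) arrD(1,2) by blast

lemma isomorphic_tens:
  assumes "X \<in> Obj C" "X' \<in> Obj C" "Y \<in> Obj C" "Y' \<in> Obj C" "isomorphic C X X'" "isomorphic C Y Y'"
  shows "isomorphic C (X \<odot> Y) (X' \<odot> Y')"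
proof -
  obtain f g h k where "iso_arr f g" "src f = X" "tgt f = X'" "iso_arr h k" "src h = Y" "tgt h = Y'"
    using assms by (auto simp: isomorphic_iff)
  then have "iso_arr (f \<star> h) (g \<star> k)" "src (f \<star> h) = X \<odot> Y" "tgt (f \<star> h) = X' \<odot> Y'"
    using iso_arr_atens[of f g h k] by auto
  then show ?thesis using isomorphic_iff[of "X \<odot> Y" "X' \<odot> Y'"] assms by auto
qed

lemma isomorphic_structure:
  "X \<in> Obj C \<Longrightarrow> Y \<in> Obj C \<Longrightarrow> Z \<in> Obj C \<Longrightarrow> isomorphic C ((X \<odot> Y) \<odot> Z) (X \<odot> (Y \<odot> Z))"
  "X \<in> Obj C \<Longrightarrow> isomorphic C (\<I> \<odot> X) X" "X \<in> Obj C \<Longrightarrow> isomorphic C (X \<odot> \<I>) X"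
  using iso_arr_structure(1)[of X Y Z, THEN isomorphicI] iso_arr_structure(2)[of X, THEN isomorphicI]
    iso_arr_structure(3)[of X, THEN isomorphicI]
  by simp_all

text \<open>Both orders are demanded because no braiding is available at this level;
  \<open>abelian_invertible\<close> obtains the second from the first with one.\<close>

definition invertible :: "'a \<Rightarrow> bool" where
  "invertible X \<longleftrightarrow> X \<in> Obj C \<and> (\<exists>Z\<in>Obj C. isomorphic C (X \<odot> Z) \<I> \<and> isomorphic C (Z \<odot> X) \<I>)"

lemma tens_aid_cancel_iso:
  assumes "X \<in> Obj C" "X' \<in> Obj C" "isomorphic C X X'" "arr g"
    "aid X \<star> g = anul (X \<odot> src g) (X \<odot> tgt g)"
  shows "aid X' \<star> g = anul (X' \<odot> src g) (X' \<odot> tgt g)"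
proof -
  obtain f h where fh: "iso_arr f h" and st: "src f = X" "tgt f = X'"
    using assms by (auto simp: isomorphic_iff)
  note f = iso_arrD[OF fh]
  have "aid X' \<star> g = (f ** h) \<star> (g ** aid (src g))" using f st assms by (simp add: arrD)
  also have "\<dots> = (f \<star> aid (tgt g)) ** (aid X \<star> g) ** (h \<star> aid (src g))"
    using f(1-4) st assms(1-4) by (simp add: interchange' interchange arrD)
  also have "\<dots> = anul (X' \<odot> src g) (X' \<odot> tgt g)"
    unfolding assms(5) using f st assms(1-4) by (simp add: arrD)
  finally show ?thesis .
qed

text \<open>Tensoring with an inverse \<open>Z\<close> and reassociating turns the hypothesis into
  the vanishing of \<open>aid \<I> \<star> g\<close>, which is \<open>g\<close> up to
  unitors.\<close>

lemma invertible_faithful: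
  assumes "invertible X" "arr g" "aid X \<star> g = anul (X \<odot> src g) (X \<odot> tgt g)"
  shows "g = anul (src g) (tgt g)"
proof -
  obtain Z where Z: "X \<in> Obj C" "Z \<in> Obj C" "isomorphic C (Z \<odot> X) \<I>"
    using assms by (auto simp: invertible_def)
  have g: "src g \<in> Obj C" "tgt g \<in> Obj C" using assms arrD by auto
  have "asc Z X (tgt g) ** (aid (Z \<odot> X) \<star> g) = (aid Z \<star> (aid X \<star> g)) ** asc Z X (src g)"
    using asc_natural[of "aid Z" "aid X" g] Z assms g by (simp add: aid_tens)
  also have "\<dots> = anul ((Z \<odot> X) \<odot> src g) (Z \<odot> (X \<odot> tgt g))"
    unfolding assms(3) using Z g by simp
  finally have "aid (Z \<odot> X) \<star> g = anul ((Z \<odot> X) \<odot> src g) ((Z \<odot> X) \<odot> tgt g)"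
    using iso_arr_cancel[OF iso_arr_structure(1)[of Z X "tgt g"], of "aid (Z \<odot> X) \<star> g"] Z g assms(2)
    by simp
  then have "aid \<I> \<star> g = anul (\<I> \<odot> src g) (\<I> \<odot> tgt g)"
    using tens_aid_cancel_iso[of "Z \<odot> X" \<I> g] Z assms by simp
  then have "g ** lu (src g) = anul (\<I> \<odot> src g) (tgt g)"
    using lu_natural[of g] assms(2) g by simp
  then have "g ** lu (src g) ** adag (lu (src g)) = anul (src g) (tgt g)"
    using acmp_reassoc[of g "lu (src g)" "anul (\<I> \<odot> src g) (tgt g)" "adag (lu (src g))"] assms(2) g by simp
  then show ?thesis using assms(2) g by simp
qed

lemma invertible_unit: "invertible \<I>"
  unfolding invertible_def using isomorphic_structure(2)[of \<I>] by auto

lemma invertible_inverse: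
  assumes "invertible X"
  obtains Z where "invertible Z" "isomorphic C (X \<odot> Z) \<I>" "isomorphic C (Z \<odot> X) \<I>"
  using assms unfolding invertible_def by blast

lemma invertible_obj: "invertible X \<Longrightarrow> X \<in> Obj C"
  by (simp add: invertible_def)

lemma invertible_iso:
  assumes "invertible X" "Y \<in> Obj C" "isomorphic C X Y"
  shows "invertible Y"
proof -
  obtain Z where Z: "X \<in> Obj C" "Z \<in> Obj C" "isomorphic C (X \<odot> Z) \<I>" "isomorphic C (Z \<odot> X) \<I>"
    using assms by (auto simp: invertible_def)
  have "isomorphic C Y X" using isomorphic_sym Z assms by blast
  then have "isomorphic C (Y \<odot> Z) (X \<odot> Z)" "isomorphic C (Z \<odot> Y) (Z \<odot> X)"
    using isomorphic_tens isomorphic_refl Z assms by auto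
  then have "isomorphic C (Y \<odot> Z) \<I>" "isomorphic C (Z \<odot> Y) \<I>"
    using isomorphic_trans[of "Y \<odot> Z" "X \<odot> Z" \<I>] isomorphic_trans[of "Z \<odot> Y" "Z \<odot> X" \<I>] Z assms(2)
    by auto
  then show ?thesis unfolding invertible_def using assms Z by blast
qed

lemma isomorphic_middle_cancel:
  assumes "X \<in> Obj C" "Y \<in> Obj C" "Z \<in> Obj C" "W \<in> Obj C" "isomorphic C (Y \<odot> Z) \<I>" "isomorphic C (X \<odot> W) \<I>"
  shows "isomorphic C ((X \<odot> Y) \<odot> (Z \<odot> W)) \<I>"
proof -
  have 1: "isomorphic C ((X \<odot> Y) \<odot> (Z \<odot> W)) (X \<odot> (Y \<odot> (Z \<odot> W)))"
    using isomorphic_structure(1) assms by simp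
  have "isomorphic C (Y \<odot> (Z \<odot> W)) ((Y \<odot> Z) \<odot> W)"
    using isomorphic_sym[OF _ _ isomorphic_structure(1)] assms by simp
  moreover have "isomorphic C ((Y \<odot> Z) \<odot> W) (\<I> \<odot> W)"
    using isomorphic_tens isomorphic_refl assms by simp
  moreover have "isomorphic C (\<I> \<odot> W) W" using isomorphic_structure(2) assms by simp
  ultimately have "isomorphic C (Y \<odot> (Z \<odot> W)) W"
    using isomorphic_trans[of "Y \<odot> (Z \<odot> W)" "(Y \<odot> Z) \<odot> W" "\<I> \<odot> W"]
      isomorphic_trans[of "Y \<odot> (Z \<odot> W)" "\<I> \<odot> W" W] assms(1-4) by simp
  then have "isomorphic C (X \<odot> (Y \<odot> (Z \<odot> W))) (X \<odot> W)"
    using isomorphic_tens isomorphic_refl assms by simp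
  then have "isomorphic C ((X \<odot> Y) \<odot> (Z \<odot> W)) (X \<odot> W)"
    using isomorphic_trans[OF _ _ _ 1] assms(1-4) by simp
  then show ?thesis using isomorphic_trans[OF _ _ _ _ assms(6)] assms(1-4) by simp
qed

lemma invertible_tens:
  assumes "invertible X" "invertible Y"
  shows "invertible (X \<odot> Y)"
proof -
  obtain Z W where "X \<in> Obj C" "Z \<in> Obj C" "isomorphic C (X \<odot> Z) \<I>" "isomorphic C (Z \<odot> X) \<I>"
    "Y \<in> Obj C" "W \<in> Obj C" "isomorphic C (Y \<odot> W) \<I>" "isomorphic C (W \<odot> Y) \<I>"
    using assms by (auto simp: invertible_def)
  then show ?thesis
    unfolding invertible_def
    using isomorphic_middle_cancel[of X Y W Z] isomorphic_middle_cancel[of W Z X Y]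
    by (auto intro!: bexI[of _ "W \<odot> Z"])
qed

text \<open>For an inverse \<open>Z\<close>, the object \<open>Z \<odot> (X \<odot> S)\<close> is
  isomorphic to \<open>S\<close>, hence simple. An endomorphism of \<open>X \<odot> S\<close>
  becomes a scalar after tensoring with \<open>Z\<close>, and that operation is faithful.\<close>

lemma simple_tens_invertible:
  assumes "invertible X" "simple C S"
  shows "simple C (X \<odot> S)"
proof -
  obtain Z where Z: "invertible Z" "isomorphic C (X \<odot> Z) \<I>" "isomorphic C (Z \<odot> X) \<I>"
    using invertible_inverse[OF assms(1)] by blast
  have obj: "X \<in> Obj C" "Z \<in> Obj C" "S \<in> Obj C" using Z assms invertible_obj simple_obj by auto
  have "isomorphic C (Z \<odot> (X \<odot> S)) ((Z \<odot> X) \<odot> S)"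
    using isomorphic_sym[OF _ _ isomorphic_structure(1)] obj by simp
  moreover have "isomorphic C ((Z \<odot> X) \<odot> S) (\<I> \<odot> S)"
    using isomorphic_tens isomorphic_refl obj Z by simp
  moreover have "isomorphic C (\<I> \<odot> S) S" using isomorphic_structure(2) obj by simp
  ultimately have "isomorphic C (Z \<odot> (X \<odot> S)) S"
    using isomorphic_trans[of "Z \<odot> (X \<odot> S)" "(Z \<odot> X) \<odot> S" "\<I> \<odot> S"]
      isomorphic_trans[of "Z \<odot> (X \<odot> S)" "\<I> \<odot> S" S] obj by simp
  then have ZXS: "simple C (Z \<odot> (X \<odot> S))"
    using simple_iso[OF assms(2)] isomorphic_sym obj by simp
  show ?thesis
  proof (rule simpleI)
    show "X \<odot> S \<in> Obj C" using obj by simp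
    show "aid (X \<odot> S) \<noteq> anul (X \<odot> S) (X \<odot> S)"
      using invertible_faithful[OF assms(1), of "aid S"] simple_aid_neq[OF assms(2)] obj
      by (auto simp: aid_tens)
    fix f assume f: "arr f" "src f = X \<odot> S" "tgt f = X \<odot> S"
    obtain k where k: "aid Z \<star> f = k *. aid (Z \<odot> (X \<odot> S))"
      using simple_scalar[OF ZXS, of "aid Z \<star> f"] f obj by auto
    define h where "h = f +. (-1) *. k *. aid (X \<odot> S)"
    have h: "arr h" "src h = X \<odot> S" "tgt h = X \<odot> S" using f obj by (auto simp: h_def)
    have "aid Z \<star> h = (aid Z \<star> f) +. (-1) *. k *. aid (Z \<odot> (X \<odot> S))"
      using f obj by (simp add: h_def atens_aplus aid_tens)
    also have "\<dots> = anul (Z \<odot> (X \<odot> S)) (Z \<odot> (X \<odot> S))"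
      unfolding k using aplus_neg[of "k *. aid (Z \<odot> (X \<odot> S))"] obj by simp
    finally have "h = anul (X \<odot> S) (X \<odot> S)"
      using invertible_faithful[OF Z(1), of h] h by simp
    then show "\<exists>k. f = k *. aid (X \<odot> S)"
      using diff_eq_anul_iff[of f "k *. aid (X \<odot> S)"] f obj unfolding h_def by auto
  qed
qed

lemma invertible_simple: "invertible X \<Longrightarrow> simple C X"
  using simple_iso[OF simple_tens_invertible[OF _ unit_simple]] isomorphic_structure(3) invertible_obj
  by blast

text \<open>The dual of a simple object is simple, and tensoring it with an invertible object keeps
  it so; this is the hypothesis of \<open>ndual_loop_eq_one\<close>.\<close>

lemma invertible_qdim:
  assumes "invertible (rep x)"
  shows "abelian C x"
proof -
  obtain Y u e where n: "ndual (rep x) Y u e (complex_of_real (qdim C x))"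
    using qdim_ndual invertible_simple assms by metis
  then have "simple C Y" using dual_simple invertible_simple assms unfolding ndual_def by blast
  then show ?thesis
    using ndual_loop_eq_one[OF n] simple_tens_invertible assms invertible_simple
    by (simp add: abelian_def)
qed

text \<open>At loop value 1 the coevaluation is both isometric and coisometric.\<close>

lemma abelian_coev_iso:
  assumes "abelian C x" "simple C (rep x)"
  obtains Y where "Y \<in> Obj C" "isomorphic C (rep x \<odot> Y) \<I>"
proof -
  obtain Y u e where n: "ndual (rep x) Y u e 1"
    using qdim_ndual[OF assms(2)] assms(1) unfolding abelian_def by (metis of_real_1)
  then have a: "adual (rep x) Y u e" and l: "adag u ** u = aid \<I>" by (auto simp: ndual_def)
  note d = adualD[OF a]
  have "iso_arr (adag u) u"
    using ndual_one_coisometry[OF n] l d(1-8) by (auto simp: iso_arr_def)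
  then have "isomorphic C (rep x \<odot> Y) \<I>" using isomorphic_iff d(1-8) by force
  then show ?thesis using that d(2) by blast
qed

end

section \<open>Pointed braided categories from bicharacters\<close>

type_synonym mat = "nat \<Rightarrow> nat \<Rightarrow> complex"

text \<open>Composition in the record receives no objects, so the range of summation has to be read
  off from the entries. On finitely supported matrices this is the usual matrix product.\<close>

definition mcmp :: "mat \<Rightarrow> mat \<Rightarrow> mat" where
  "mcmp g f = (\<lambda>i k. \<Sum>j\<in>{j. g i j * f j k \<noteq> 0}. g i j * f j k)"

definition mdag :: "mat \<Rightarrow> mat" where "mdag f = (\<lambda>i j. cnj (f j i))"

text \<open>Monomial matrices listed by columns here and by rows in \<open>rmon\<close>. The first
  form makes a product easy to evaluate when it is the right factor, the second when it is the left
  factor; for bijective index maps \<open>mon_eq_rmon\<close> switches between them.\<close>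

definition mon :: "nat set \<Rightarrow> (nat \<Rightarrow> nat) \<Rightarrow> (nat \<Rightarrow> complex) \<Rightarrow> mat" where
  "mon D \<sigma> w = (\<lambda>i j. if j \<in> D \<and> i = \<sigma> j then w j else 0)"

definition rmon :: "nat set \<Rightarrow> (nat \<Rightarrow> nat) \<Rightarrow> (nat \<Rightarrow> complex) \<Rightarrow> mat" where
  "rmon E \<tau> w = (\<lambda>i j. if i \<in> E \<and> j = \<tau> i then w i else 0)"

lemma mcmp_eq_sum:
  assumes "finite A" "\<And>j. g i j * f j k \<noteq> 0 \<Longrightarrow> j \<in> A"
  shows "mcmp g f i k = (\<Sum>j\<in>A. g i j * f j k)"
  unfolding mcmp_def by (rule sum.mono_neutral_left) (use assms in auto)

lemma mcmp_single:
  assumes "\<And>j. j \<noteq> j0 \<Longrightarrow> g i j * f j k = 0"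
  shows "mcmp g f i k = g i j0 * f j0 k"
proof -
  have "mcmp g f i k = (\<Sum>j\<in>{j0}. g i j * f j k)" by (rule mcmp_eq_sum) (use assms in auto)
  then show ?thesis by simp
qed

lemma mcmp_mon: "mcmp f (mon D \<sigma> w) = (\<lambda>i k. if k \<in> D then f i (\<sigma> k) * w k else 0)"
proof (intro ext)
  fix i k show "mcmp f (mon D \<sigma> w) i k = (if k \<in> D then f i (\<sigma> k) * w k else 0)"
    by (subst mcmp_single[of "\<sigma> k"]) (auto simp: mon_def)
qed

lemma mcmp_rmon: "mcmp (rmon E \<tau> w) f = (\<lambda>i k. if i \<in> E then w i * f (\<tau> i) k else 0)"
proof (intro ext)
  fix i k show "mcmp (rmon E \<tau> w) f i k = (if i \<in> E then w i * f (\<tau> i) k else 0)"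
    by (subst mcmp_single[of "\<tau> i"]) (auto simp: rmon_def)
qed

lemma mcmp_mon_mon:
  "mcmp (mon E \<tau> u) (mon D \<sigma> w) = mon {j \<in> D. \<sigma> j \<in> E} (\<lambda>j. \<tau> (\<sigma> j)) (\<lambda>j. u (\<sigma> j) * w j)"
  unfolding mcmp_mon by (intro ext) (simp add: mon_def)

lemma mon_eq_rmon:
  assumes "\<And>j. j \<in> D \<Longrightarrow> \<sigma> j \<in> E \<and> \<tau> (\<sigma> j) = j" "\<And>i. i \<in> E \<Longrightarrow> \<tau> i \<in> D \<and> \<sigma> (\<tau> i) = i"
  shows "mon D \<sigma> w = rmon E \<tau> (\<lambda>i. w (\<tau> i))"
  unfolding mon_def rmon_def using assms by (intro ext) auto

lemma mon_id_rmon: "mon D (\<lambda>i. i) w = rmon D (\<lambda>i. i) w"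
  by (auto simp: mon_def rmon_def fun_eq_iff)

lemma mdag_mon: "mdag (mon D \<sigma> w) = rmon D \<sigma> (\<lambda>j. cnj (w j))"
  unfolding mon_def rmon_def mdag_def by (intro ext) auto

lemma mdag_mon_inverse:
  assumes "\<And>j. j \<in> D \<Longrightarrow> \<sigma> j \<in> E \<and> \<tau> (\<sigma> j) = j" "\<And>i. i \<in> E \<Longrightarrow> \<tau> i \<in> D \<and> \<sigma> (\<tau> i) = i"
  shows "mdag (mon D \<sigma> w) = mon E \<tau> (\<lambda>i. cnj (w (\<tau> i)))"
  unfolding mdag_mon using mon_eq_rmon[of E \<tau> D \<sigma> "\<lambda>i. cnj (w (\<tau> i))"] assms
  by (auto simp: rmon_def fun_eq_iff)

lemma mdag_mon_one:
  assumes "\<And>j. j \<in> D \<Longrightarrow> \<sigma> j \<in> E \<and> \<tau> (\<sigma> j) = j" "\<And>i. i \<in> E \<Longrightarrow> \<tau> i \<in> D \<and> \<sigma> (\<tau> i) = i"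
  shows "mdag (mon D \<sigma> (\<lambda>_. 1)) = mon E \<tau> (\<lambda>_. 1)"
  using mdag_mon_inverse[OF assms, of "\<lambda>_. 1"] by simp

lemma mon_cong:
  assumes "\<And>j. j \<in> D \<longleftrightarrow> j \<in> D'" "\<And>j. j \<in> D \<Longrightarrow> \<sigma> j = \<sigma>' j" "\<And>j. j \<in> D \<Longrightarrow> w j = w' j"
  shows "mon D \<sigma> w = mon D' \<sigma>' w'"
  unfolding mon_def using assms by (intro ext) auto

text \<open>The binary digits of a number list its elements, so every natural number is an object
  and no well-formedness condition on objects is needed.\<close>

definition idx :: "nat \<Rightarrow> nat set" where "idx X = set_decode X"

lemma finite_idx [simp]: "finite (idx X)"
  by (simp add: idx_def)

lemma idx_set_encode [simp]: "finite A \<Longrightarrow> idx (set_encode A) = A"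
  by (simp add: idx_def set_encode_inverse)

lemma idx_zero [simp]: "idx 0 = {}" and idx_power [simp]: "idx (2 ^ x) = {x}"
  using idx_set_encode[of "{}"] idx_set_encode[of "{x}"] by simp_all

abbreviation mid :: "nat \<Rightarrow> mat" where "mid X \<equiv> mon (idx X) (\<lambda>i. i) (\<lambda>_. 1)"

lemma set_encode_idx: "set_encode (idx X) = X"
  by (simp add: idx_def)

text \<open>An object codes a finite set of indices, each of which carries a grade; morphisms are matrices
  that only connect indices whose grades agree modulo \<open>K\<close>, so \<open>'g / K\<close> is the group of anyons. Pairing of
  indices gives the tensor product, with associator a relabelling of indices. The functions \<open>dl\<close> and
  \<open>cp\<close> provide indices for duals and direct sums.\<close>

locale pointed_braiding =
  fixes gr :: "nat \<Rightarrow> 'g::ab_group_add" and pr :: "nat \<Rightarrow> nat \<Rightarrow> nat" and p1 p2 dl :: "nat \<Rightarrow> nat"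
    and cp :: "bool \<Rightarrow> nat \<Rightarrow> nat" and ix :: "'g \<Rightarrow> nat"
    and K :: "'g set" and \<beta> :: "'g \<Rightarrow> 'g \<Rightarrow> complex"
  assumes pr [simp]: "p1 (pr i j) = i" "p2 (pr i j) = j" "pr (p1 i) (p2 i) = i"
    and gr_p: "gr i = gr (p1 i) + gr (p2 i)"
    and gr_ix [simp]: "gr (ix g) = g"
    and dl: "gr (dl i) = - gr i" "dl (dl i) = i"
    and cp: "gr (cp b i) = gr i" "cp b i = cp b' i' \<Longrightarrow> b = b' \<and> i = i'"
    and K_zero: "0 \<in> K" and K_diff: "x \<in> K \<Longrightarrow> y \<in> K \<Longrightarrow> x - y \<in> K"
    and finite_index: "\<exists>R. finite R \<and> (\<forall>g. \<exists>r\<in>R. g - r \<in> K)"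
    and \<beta>_add: "\<beta> (x + y) z = \<beta> x z * \<beta> y z" "\<beta> x (y + z) = \<beta> x y * \<beta> x z"
    and \<beta>_norm: "norm (\<beta> x y) = 1"
    and \<beta>_K: "x \<in> K \<Longrightarrow> \<beta> x y = 1" "x \<in> K \<Longrightarrow> \<beta> y x = 1"
begin

lemma gr_pr [simp]: "gr (pr i j) = gr i + gr j"
  using gr_p[of "pr i j"] by simp

lemma gr_split: "gr (p1 (p1 p)) + (gr (p2 (p1 p)) + gr (p2 p)) = gr p"
    "p1 p = ix 0 \<Longrightarrow> gr (p2 p) = gr p" "p2 p = ix 0 \<Longrightarrow> gr (p1 p) = gr p"
    "p2 p = dl (p1 p) \<Longrightarrow> gr p = 0" "p1 p = dl (p2 p) \<Longrightarrow> gr p = 0"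
    "gr (p2 p) + gr (p1 p) = gr p"
  using gr_p[of p] gr_p[of "p1 p"] dl(1) by (auto simp: add.assoc add.commute)

lemma pr_eq_iff [simp]: "pr i j = pr i' j' \<longleftrightarrow> i = i' \<and> j = j'"
  by (metis pr(1,2))

lemma cp_eq_iff: "cp b i = cp b' i' \<longleftrightarrow> b = b' \<and> i = i'"
  using cp(2) by blast

lemma eq_pr_iff: "p = pr i j \<longleftrightarrow> p1 p = i \<and> p2 p = j"
  by (metis pr)

lemma pr_collapse: "p1 p = i \<Longrightarrow> pr i (p2 p) = p" "p2 p = j \<Longrightarrow> pr (p1 p) j = p"
  using pr by auto

lemma K_uminus: "x \<in> K \<Longrightarrow> - x \<in> K"
  using K_diff[OF K_zero] by simp

lemma K_add: "x \<in> K \<Longrightarrow> y \<in> K \<Longrightarrow> x + y \<in> K"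
  using K_diff[of x "- y"] K_uminus by simp

lemma K_sym: "x - y \<in> K \<Longrightarrow> y - x \<in> K"
  using K_uminus[of "x - y"] by simp

lemma K_trans: "x - y \<in> K \<Longrightarrow> y - z \<in> K \<Longrightarrow> x - z \<in> K"
  using K_add[of "x - y" "y - z"] by simp

lemma K_add_cong: "x - y \<in> K \<Longrightarrow> x' - y' \<in> K \<Longrightarrow> (x + x') - (y + y') \<in> K"
  using K_add[of "x - y" "x' - y'"] by (simp add: algebra_simps)

lemma \<beta>_cong:
  assumes "x - y \<in> K" "x' - y' \<in> K" shows "\<beta> x x' = \<beta> y y'"
proof -
  have "\<beta> x x' = \<beta> ((x - y) + y) ((x' - y') + y')" by simp
  also have "\<dots> = \<beta> y y'" unfolding \<beta>_add using assms by (simp add: \<beta>_K)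
  finally show ?thesis .
qed

lemma \<beta>_nonzero [simp]: "\<beta> x y \<noteq> 0"
  using \<beta>_norm[of x y] by auto

lemma \<beta>_uminus: "\<beta> (- x) y = inverse (\<beta> x y)" "\<beta> x (- y) = inverse (\<beta> x y)"
  using \<beta>_add(1)[of x "- x" y] \<beta>_add(2)[of x y "- y"] \<beta>_K(1)[OF K_zero, of y] \<beta>_K(2)[OF K_zero, of x]
  by (auto simp: field_simps)

definition ghom :: "nat \<Rightarrow> nat \<Rightarrow> mat set" where
  "ghom X Y = {f. \<forall>i j. f i j \<noteq> 0 \<longrightarrow> i \<in> idx Y \<and> j \<in> idx X \<and> gr i - gr j \<in> K}"

definition otens :: "nat \<Rightarrow> nat \<Rightarrow> nat" where
  "otens X Y = set_encode {p. p1 p \<in> idx X \<and> p2 p \<in> idx Y}"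

definition mtens :: "mat \<Rightarrow> mat \<Rightarrow> mat" where
  "mtens f g = (\<lambda>p p'. f (p1 p) (p1 p') * g (p2 p) (p2 p'))"

definition ounit :: nat where "ounit = set_encode {ix 0}"

text \<open>All associator weights are 1. The hexagons then amount to bimultiplicativity of
  \<open>\<beta>\<close>, and balancing makes the quadratic form \<open>\<beta> g g\<close> the
  natural twist. \<open>\<beta>\<close> itself need not be symmetric: only
  \<open>\<beta> g h * \<beta> h g\<close> is visible as full braiding.\<close>

definition PC :: "(nat, mat) braided_data" where
  "PC = \<lparr>Obj = UNIV, Hom = ghom, ident = (mid), cmp = mcmp,
    nul = (\<lambda>_ _ _ _. 0), plus_m = (\<lambda>f g i j. f i j + g i j), scale = (\<lambda>k f i j. k * f i j),
    dag = mdag, tens_o = otens, tens_m = mtens, unit_o = ounit,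
    assoc = (\<lambda>X Y Z. mon (idx (otens (otens X Y) Z)) (\<lambda>p. pr (p1 (p1 p)) (pr (p2 (p1 p)) (p2 p))) (\<lambda>_. 1)),
    lunit = (\<lambda>X. mon (idx (otens ounit X)) p2 (\<lambda>_. 1)),
    runit = (\<lambda>X. mon (idx (otens X ounit)) p1 (\<lambda>_. 1)),
    braid = (\<lambda>X Y. mon (idx (otens X Y)) (\<lambda>p. pr (p2 p) (p1 p)) (\<lambda>p. \<beta> (gr (p1 p)) (gr (p2 p)))),
    twist = (\<lambda>X. mon (idx X) (\<lambda>i. i) (\<lambda>i. \<beta> (gr i) (gr i)))\<rparr>"

lemma PC_simps [simp]:
  "Obj PC = UNIV" "Hom PC = ghom" "ident PC X = mid X" "cmp PC = mcmp"
  "nul PC X Y = (\<lambda>_ _. 0)" "plus_m PC f g = (\<lambda>i j. f i j + g i j)" "scale PC k f = (\<lambda>i j. k * f i j)"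
  "dag PC = mdag" "tens_o PC = otens" "tens_m PC = mtens" "unit_o PC = ounit"
  by (simp_all add: PC_def)

lemma PC_structure:
  "assoc PC X Y Z = mon (idx (otens (otens X Y) Z)) (\<lambda>p. pr (p1 (p1 p)) (pr (p2 (p1 p)) (p2 p))) (\<lambda>_. 1)"
  "lunit PC X = mon (idx (otens ounit X)) p2 (\<lambda>_. 1)"
  "runit PC X = mon (idx (otens X ounit)) p1 (\<lambda>_. 1)"
  "braid PC X Y = mon (idx (otens X Y)) (\<lambda>p. pr (p2 p) (p1 p)) (\<lambda>p. \<beta> (gr (p1 p)) (gr (p2 p)))"
  "twist PC X = mon (idx X) (\<lambda>i. i) (\<lambda>i. \<beta> (gr i) (gr i))"
  by (simp_all add: PC_def)

lemma idx_otens [simp]: "p \<in> idx (otens X Y) \<longleftrightarrow> p1 p \<in> idx X \<and> p2 p \<in> idx Y"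
proof -
  have "{p. p1 p \<in> idx X \<and> p2 p \<in> idx Y} = (\<lambda>(i, j). pr i j) ` (idx X \<times> idx Y)"
    by (force simp: eq_pr_iff image_iff)
  then have "finite {p. p1 p \<in> idx X \<and> p2 p \<in> idx Y}" by simp
  then show ?thesis by (simp add: otens_def)
qed

lemma idx_ounit [simp]: "idx ounit = {ix 0}"
  unfolding ounit_def by (rule idx_set_encode) simp

lemma PC_inverse_structure:
  "mdag (assoc PC X Y Z) = mon (idx (otens X (otens Y Z))) (\<lambda>p. pr (pr (p1 p) (p1 (p2 p))) (p2 (p2 p))) (\<lambda>_. 1)"
  "mdag (lunit PC X) = mon (idx X) (\<lambda>i. pr (ix 0) i) (\<lambda>_. 1)"
  "mdag (runit PC X) = mon (idx X) (\<lambda>i. pr i (ix 0)) (\<lambda>_. 1)"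
proof -
  show "mdag (assoc PC X Y Z) = mon (idx (otens X (otens Y Z))) (\<lambda>p. pr (pr (p1 p) (p1 (p2 p))) (p2 (p2 p))) (\<lambda>_. 1)"
    unfolding PC_structure by (rule mdag_mon_one) auto
  show "mdag (lunit PC X) = mon (idx X) (\<lambda>i. pr (ix 0) i) (\<lambda>_. 1)"
    unfolding PC_structure by (rule mdag_mon_one) (auto simp: pr_collapse)
  show "mdag (runit PC X) = mon (idx X) (\<lambda>i. pr i (ix 0)) (\<lambda>_. 1)"
    unfolding PC_structure by (rule mdag_mon_one) (auto simp: pr_collapse)
qed

lemma ghomD: "f \<in> ghom X Y \<Longrightarrow> f i j \<noteq> 0 \<Longrightarrow> i \<in> idx Y \<and> j \<in> idx X \<and> gr i - gr j \<in> K"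
  by (auto simp: ghom_def)

lemma mcmp_ghom: "f \<in> ghom X Y \<Longrightarrow> mcmp g f i k = (\<Sum>j\<in>idx Y. g i j * f j k)"
  "g \<in> ghom Y Z \<Longrightarrow> mcmp g f i k = (\<Sum>j\<in>idx Y. g i j * f j k)"
  by (rule mcmp_eq_sum; force simp: ghom_def)+

lemma mcmp_in: assumes "f \<in> ghom X Y" "g \<in> ghom Y Z" shows "mcmp g f \<in> ghom X Z"
  unfolding ghom_def
proof (intro CollectI allI impI)
  fix i k assume "mcmp g f i k \<noteq> 0"
  then obtain j where "g i j * f j k \<noteq> 0" unfolding mcmp_ghom(1)[OF assms(1)]
    by (metis (mono_tags, lifting) sum.neutral)
  then have "g i j \<noteq> 0" "f j k \<noteq> 0" by auto
  then show "i \<in> idx Z \<and> k \<in> idx X \<and> gr i - gr k \<in> K"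
    using ghomD[OF assms(1)] ghomD[OF assms(2)] K_trans by blast
qed

lemma mcmp_assoc:
  assumes "f \<in> ghom W X" "h \<in> ghom Y Z"
  shows "mcmp (mcmp h g) f = mcmp h (mcmp g f)"
proof (intro ext)
  fix i l
  have "mcmp (mcmp h g) f i l = (\<Sum>k\<in>idx X. (\<Sum>j\<in>idx Y. h i j * g j k) * f k l)"
    unfolding mcmp_ghom(1)[OF assms(1)] mcmp_ghom(2)[OF assms(2)] ..
  also have "\<dots> = (\<Sum>j\<in>idx Y. h i j * (\<Sum>k\<in>idx X. g j k * f k l))"
    unfolding sum_distrib_left sum_distrib_right by (subst sum.swap) (simp add: mult.assoc)
  also have "\<dots> = mcmp h (mcmp g f) i l"
    unfolding mcmp_ghom(1)[OF assms(1)] mcmp_ghom(2)[OF assms(2)] ..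
  finally show "mcmp (mcmp h g) f i l = mcmp h (mcmp g f) i l" .
qed

lemma mcmp_ident:
  assumes "f \<in> ghom X Y"
  shows "mcmp (mid Y) f = f" "mcmp f (mid X) = f"
proof -
  show "mcmp (mid Y) f = f"
    unfolding mon_id_rmon mcmp_rmon using ghomD[OF assms] by (auto simp: fun_eq_iff)
  show "mcmp f (mid X) = f"
    using ghomD[OF assms] by (auto simp: mcmp_mon fun_eq_iff)
qed

lemma mon_ghom:
  assumes "\<And>j. j \<in> idx X \<Longrightarrow> \<sigma> j \<in> idx Y \<and> gr (\<sigma> j) - gr j \<in> K"
  shows "mon (idx X) \<sigma> w \<in> ghom X Y"
  using assms by (auto simp: ghom_def mon_def split: if_splits)

lemma mon_unitary:
  assumes "\<And>j. j \<in> idx X \<Longrightarrow> \<sigma> j \<in> idx Y \<and> \<tau> (\<sigma> j) = j \<and> gr (\<sigma> j) - gr j \<in> K"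
    "\<And>i. i \<in> idx Y \<Longrightarrow> \<tau> i \<in> idx X \<and> \<sigma> (\<tau> i) = i" "\<And>j. j \<in> idx X \<Longrightarrow> norm (w j) = 1"
  shows "unitary PC X Y (mon (idx X) \<sigma> w)"
proof -
  have w: "w j * cnj (w j) = 1" "cnj (w j) * w j = 1" if "j \<in> idx X" for j
    using complex_norm_square[of "w j"] assms(3)[OF that] by (simp_all add: mult.commute)
  have d: "mdag (mon (idx X) \<sigma> w) = mon (idx Y) \<tau> (\<lambda>i. cnj (w (\<tau> i)))"
    by (rule mdag_mon_inverse) (use assms in blast)+
  show ?thesis
    unfolding unitary_def using assms w
    by (auto simp: d mcmp_mon_mon intro!: mon_ghom mon_cong)
qed

lemma direct_sumI:
  assumes "idx Z = \<sigma> ` idx X \<union> \<tau> ` idx Y" "inj_on \<sigma> (idx X)" "inj_on \<tau> (idx Y)"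
    "\<And>i j. i \<in> idx X \<Longrightarrow> j \<in> idx Y \<Longrightarrow> \<sigma> i \<noteq> \<tau> j"
    "\<And>i. i \<in> idx X \<Longrightarrow> gr (\<sigma> i) = gr i" "\<And>i. i \<in> idx Y \<Longrightarrow> gr (\<tau> i) = gr i"
  shows "direct_sum PC Z X Y"
proof -
  let ?i = "mon (idx X) \<sigma> (\<lambda>_. 1)" and ?j = "mon (idx Y) \<tau> (\<lambda>_. 1)"
  have hom: "?i \<in> ghom X Z" "?j \<in> ghom Y Z"
    using assms by (auto intro!: mon_ghom simp: K_zero)
  have iso: "mcmp (mdag (mon D \<rho> (\<lambda>_. 1))) (mon D \<rho> (\<lambda>_. 1)) = mon D (\<lambda>i. i) (\<lambda>_. 1)"
    if "inj_on \<rho> D" for D \<rho>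
    unfolding mdag_mon mcmp_rmon using that by (auto simp: mon_def fun_eq_iff inj_on_def)
  have proj: "mcmp (mon D \<rho> (\<lambda>_. 1)) (mdag (mon D \<rho> (\<lambda>_. 1))) = mon (\<rho> ` D) (\<lambda>i. i) (\<lambda>_. 1)"
    if "inj_on \<rho> D" for D \<rho>
  proof -
    have *: "mon D \<rho> (\<lambda>_. 1) = rmon (\<rho> ` D) (inv_into D \<rho>) (\<lambda>_. 1)"
      by (rule mon_eq_rmon) (use that in \<open>auto simp: inv_into_f_f\<close>)
    show ?thesis
      unfolding mdag_mon unfolding * mcmp_rmon using that by (auto simp: rmon_def mon_def fun_eq_iff)
  qed
  have "mcmp (mdag ?i) ?j = (\<lambda>_ _. 0)"
    unfolding mdag_mon mcmp_rmon using assms(4) by (auto simp: mon_def fun_eq_iff)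
  moreover have "(\<lambda>a b. mcmp ?i (mdag ?i) a b + mcmp ?j (mdag ?j) a b) = mid Z"
    unfolding proj[OF assms(2)] proj[OF assms(3)] using assms(1,4) assms(4)[THEN not_sym] by (auto simp: mon_def fun_eq_iff)
  ultimately show ?thesis
    unfolding direct_sum_def using hom iso assms(2,3)
    by (intro conjI bexI[of _ ?i] bexI[of _ ?j]) simp_all
qed

text \<open>The projection onto a single index is always an endomorphism. If it is a multiple of the
  identity there is no second index.\<close>

lemma simple_PC_iff: "simple PC X \<longleftrightarrow> (\<exists>x. idx X = {x})"
proof
  assume s: "simple PC X"
  then have "mid X \<noteq> (\<lambda>_ _. 0)" by (simp add: simple_def)
  then have "idx X \<noteq> {}" by (auto simp: mon_def)
  then obtain x where x: "x \<in> idx X" by blast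
  have "mon {x} (\<lambda>i. i) (\<lambda>_. 1) \<in> ghom X X"
    using x K_zero by (auto simp: ghom_def mon_def)
  then obtain k where k: "mon {x} (\<lambda>i. i) (\<lambda>_. 1) = (\<lambda>i j. k * mid X i j)"
    using s by (auto simp: simple_def)
  have "k = 1" using fun_cong[OF fun_cong[OF k, of x], of x] x by (simp add: mon_def)
  have "y = x" if "y \<in> idx X" for y
    using fun_cong[OF fun_cong[OF k, of y], of y] that \<open>k = 1\<close> by (simp add: mon_def split: if_splits)
  then show "\<exists>x. idx X = {x}" using x by blast
next
  assume "\<exists>x. idx X = {x}"
  then obtain x where x: "idx X = {x}" by blast
  have "\<exists>k. f = (\<lambda>i j. k * mon {x} (\<lambda>i. i) (\<lambda>_. 1) i j)" if "f \<in> ghom X X" for f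
  proof -
    have "f i j = f x x * mon {x} (\<lambda>i. i) (\<lambda>_. 1) i j" for i j
      using ghomD[OF that, of i j] x by (cases "f i j = 0") (auto simp: mon_def)
    then show ?thesis by blast
  qed
  moreover have "mon {x} (\<lambda>i. i) (\<lambda>_. 1) \<noteq> (\<lambda>_ _. 0)"
    by (auto simp: mon_def fun_eq_iff)
  ultimately show "simple PC X" using x by (auto simp: simple_def)
qed

lemma sum_of_simples_PC: "sum_of_simples PC X"
proof -
  have "sum_of_simples PC (set_encode S)" if "finite S" for S
    using that
  proof (induction S)
    case empty
    have "zero_object PC (set_encode {})" by (auto simp: zero_object_def mon_def fun_eq_iff)
    then show ?case by (rule sum_of_simples.zero)
  next
    case (insert x S)
    have "direct_sum PC (set_encode (insert x S)) (set_encode S) (set_encode {x})"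
      by (rule direct_sumI[of _ "\<lambda>i. i" _ "\<lambda>i. i"]) (use insert.hyps idx_set_encode[of "insert x S"] in auto)
    moreover have "simple PC (set_encode {x})" by (simp add: simple_PC_iff)
    ultimately show ?case using sum_of_simples.add insert.IH by metis
  qed
  from this[of "idx X"] show ?thesis by (simp add: set_encode_idx)
qed

lemma semisimple_PC: "unitary_semisimple_category PC"
proof (intro unitary_semisimple_category.intro, goal_cases)
  case (1 X) show ?case by (auto intro!: mon_ghom K_zero)
next case (2 X Y Z f g) then show ?case using mcmp_in by simp
next case (3 X Y f) then show ?case using mcmp_ident by simp
next case (4 X Y f) then show ?case using mcmp_ident by simp
next case (5 W X Y Z f g h) then show ?case using mcmp_assoc by simp
next case (6 X Y) show ?case by (simp add: ghom_def)
next case (7 X Y f g) then show ?case by (auto simp: ghom_def) (metis add.right_neutral)+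
next case (8 X Y f k) then show ?case by (auto simp: ghom_def)
next case (17 X Y Z f g h) then show ?case
    by (auto simp: mcmp_ghom(1) fun_eq_iff sum.distrib algebra_simps)
next case (18 X Y Z f g h) then show ?case
    by (auto simp: mcmp_ghom(2) fun_eq_iff sum.distrib algebra_simps)
next case (19 X Y Z f g k) then show ?case
    by (auto simp: mcmp_ghom(1) fun_eq_iff sum_distrib_left mult.assoc)
next case (20 X Y Z f g k) then show ?case
    by (auto simp: mcmp_ghom(2) fun_eq_iff sum_distrib_left algebra_simps)
next case (21 X Y f) then show ?case
    by (auto simp: ghom_def mdag_def) (metis K_sym)
next case (22 X Y f) then show ?case by (simp add: mdag_def)
next case (23 X Y Z f g)
  then have "mdag f \<in> ghom Y X" by (auto simp: ghom_def mdag_def) (metis K_sym)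
  then show ?case
    using 23 by (intro ext) (simp add: mcmp_ghom(2)[of "mdag f" Y X], simp add: mdag_def mcmp_ghom(1) mult.commute)
next case (26 X Y f)
  then have f: "f \<in> ghom X Y" "mcmp (mdag f) f = (\<lambda>_ _. 0)" by simp_all
  have "f j k = 0" for j k
  proof (rule ccontr)
    assume nz: "f j k \<noteq> 0"
    have "(\<Sum>j\<in>idx Y. cnj (f j k) * f j k) = 0"
      using mcmp_ghom(1)[OF f(1), of "mdag f" k k] f(2) by (simp add: mdag_def)
    then have "(\<Sum>j\<in>idx Y. complex_of_real ((norm (f j k))\<^sup>2)) = 0"
      unfolding complex_norm_square by (simp add: mult.commute)
    then have "(\<Sum>j\<in>idx Y. (norm (f j k))\<^sup>2) = 0"
      by (simp only: of_real_sum[symmetric] of_real_eq_0_iff)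
    then show False using nz ghomD[OF f(1) nz] by (simp add: sum_nonneg_eq_0_iff)
  qed
  then show ?case by auto
next case 27
  have "zero_object PC (set_encode {})" by (auto simp: zero_object_def mon_def fun_eq_iff)
  then show ?case by blast
next case (28 X Y)
  have "direct_sum PC (set_encode (cp False ` idx X \<union> cp True ` idx Y)) X Y"
    by (rule direct_sumI[of _ "cp False" _ "cp True"]) (auto simp: inj_on_def cp_eq_iff cp(1))
  then show ?case by blast
next case (29 X) show ?case by (rule sum_of_simples_PC)
qed (simp_all add: fun_eq_iff algebra_simps mdag_def)


lemma ghom_zero: "f \<in> ghom X Y \<Longrightarrow> i \<notin> idx Y \<Longrightarrow> f i j = 0" "f \<in> ghom X Y \<Longrightarrow> j \<notin> idx X \<Longrightarrow> f i j = 0"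
  using ghomD by blast+

text \<open>A morphism between one-index objects is a single entry, which may be nonzero exactly
  when the grades agree modulo \<open>K\<close>. This is how the anyons become the elements of the
  quotient by \<open>K\<close>.\<close>

lemma isomorphic_PC_iff:
  assumes "idx X = {x}" "idx Y = {y}"
  shows "isomorphic PC X Y \<longleftrightarrow> gr y - gr x \<in> K"
proof
  assume "isomorphic PC X Y"
  then obtain f g where f: "f \<in> ghom X Y" "g \<in> ghom Y X" "mcmp g f = mid X"
    by (auto simp: isomorphic_def)
  have "mcmp g f x x = 1" unfolding f(3) using assms by (simp add: mon_def)
  then have "g x y * f y x = 1" using mcmp_ghom(1)[OF f(1)] assms by simp
  then have "f y x \<noteq> 0" by auto
  then show "gr y - gr x \<in> K" using ghomD[OF f(1)] by blast
next
  assume k: "gr y - gr x \<in> K"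
  have "unitary PC X Y (mon (idx X) (\<lambda>_. y) (\<lambda>_. 1))"
    by (rule mon_unitary[where \<tau> = "\<lambda>_. x"]) (use assms k in auto)
  moreover have "mdag f \<in> ghom Y X" if "f \<in> ghom X Y" for f
    using that K_sym by (auto simp: ghom_def mdag_def)
  ultimately show "isomorphic PC X Y"
    unfolding unitary_def isomorphic_def by auto
qed

section \<open>Tensor product, duals and the fusion axioms\<close>

lemma mtens_mon: "mtens (mon D \<sigma> w) (mon E \<tau> u)
    = mon {p. p1 p \<in> D \<and> p2 p \<in> E} (\<lambda>p. pr (\<sigma> (p1 p)) (\<tau> (p2 p))) (\<lambda>p. w (p1 p) * u (p2 p))"
  unfolding mtens_def mon_def by (intro ext) (auto simp: eq_pr_iff)

lemma mtens_in: "f \<in> ghom X X' \<Longrightarrow> g \<in> ghom Y Y' \<Longrightarrow> mtens f g \<in> ghom (otens X Y) (otens X' Y')"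
  unfolding ghom_def mtens_def using K_add_cong by (auto simp flip: gr_p) (metis gr_p)

lemma mtens_mcmp:
  assumes "f \<in> ghom X X'" "g \<in> ghom Y Y'"
  shows "mtens (mcmp f' f) (mcmp g' g) = mcmp (mtens f' g') (mtens f g)"
proof (intro ext)
  fix p r
  have bij: "bij_betw (\<lambda>(i, j). pr i j) (idx X' \<times> idx Y') (idx (otens X' Y'))"
    by (rule bij_betwI[where g = "\<lambda>p. (p1 p, p2 p)"]) auto
  have "mtens (mcmp f' f) (mcmp g' g) p r
      = (\<Sum>(i, j)\<in>idx X' \<times> idx Y'. (f' (p1 p) i * f i (p1 r)) * (g' (p2 p) j * g j (p2 r)))"
    unfolding mtens_def mcmp_ghom(1)[OF assms(1)] mcmp_ghom(1)[OF assms(2)] sum_product sum.cartesian_product ..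
  also have "\<dots> = (\<Sum>q\<in>idx (otens X' Y'). mtens f' g' p q * mtens f g q r)"
    unfolding sum.reindex_bij_betw[OF bij, symmetric]
    by (intro sum.cong) (auto simp: mtens_def)
  also have "\<dots> = mcmp (mtens f' g') (mtens f g) p r"
    unfolding mcmp_ghom(1)[OF mtens_in[OF assms]] ..
  finally show "mtens (mcmp f' f) (mcmp g' g) p r = mcmp (mtens f' g') (mtens f g) p r" .
qed

lemma PC_rmon:
  "assoc PC X Y Z = rmon (idx (otens X (otens Y Z))) (\<lambda>p. pr (pr (p1 p) (p1 (p2 p))) (p2 (p2 p))) (\<lambda>_. 1)"
  "mdag (assoc PC X Y Z) = rmon (idx (otens (otens X Y) Z)) (\<lambda>p. pr (p1 (p1 p)) (pr (p2 (p1 p)) (p2 p))) (\<lambda>_. 1)"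
  "lunit PC X = rmon (idx X) (\<lambda>i. pr (ix 0) i) (\<lambda>_. 1)"
  "runit PC X = rmon (idx X) (\<lambda>i. pr i (ix 0)) (\<lambda>_. 1)"
  "braid PC X Y = rmon (idx (otens Y X)) (\<lambda>p. pr (p2 p) (p1 p)) (\<lambda>p. \<beta> (gr (p2 p)) (gr (p1 p)))"
proof -
  show "assoc PC X Y Z = rmon (idx (otens X (otens Y Z))) (\<lambda>p. pr (pr (p1 p) (p1 (p2 p))) (p2 (p2 p))) (\<lambda>_. 1)"
    unfolding PC_structure by (rule mon_eq_rmon) auto
  show "mdag (assoc PC X Y Z) = rmon (idx (otens (otens X Y) Z)) (\<lambda>p. pr (p1 (p1 p)) (pr (p2 (p1 p)) (p2 p))) (\<lambda>_. 1)"
    unfolding PC_inverse_structure by (rule mon_eq_rmon) auto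
  show "lunit PC X = rmon (idx X) (\<lambda>i. pr (ix 0) i) (\<lambda>_. 1)"
    unfolding PC_structure by (rule mon_eq_rmon) (auto simp: pr_collapse)
  show "runit PC X = rmon (idx X) (\<lambda>i. pr i (ix 0)) (\<lambda>_. 1)"
    unfolding PC_structure by (rule mon_eq_rmon) (auto simp: pr_collapse)
  have "braid PC X Y = rmon (idx (otens Y X)) (\<lambda>p. pr (p2 p) (p1 p))
      (\<lambda>p. \<beta> (gr (p1 (pr (p2 p) (p1 p)))) (gr (p2 (pr (p2 p) (p1 p)))))"
    unfolding PC_structure by (rule mon_eq_rmon) auto
  then show "braid PC X Y = rmon (idx (otens Y X)) (\<lambda>p. pr (p2 p) (p1 p)) (\<lambda>p. \<beta> (gr (p2 p)) (gr (p1 p)))"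
    by simp
qed

text \<open>The coevaluation is the vector that pairs each index with its \<open>dl\<close> partner,
  as for a vector space and its dual basis; opposite grades make it a morphism out of the
  unit.\<close>

lemma dual_pair_PC:
  defines "coev X \<equiv> (\<lambda>p i. if i = ix 0 \<and> p1 p \<in> idx X \<and> p2 p = dl (p1 p) then 1 else 0 :: complex)"
    and "ev X \<equiv> (\<lambda>i p. if i = ix 0 \<and> p2 p \<in> idx X \<and> p1 p = dl (p2 p) then 1 else 0 :: complex)"
  shows "dual_pair PC X (set_encode (dl ` idx X)) (coev X) (ev X)"
proof -
  define Y where "Y = set_encode (dl ` idx X)"
  have Y: "y \<in> idx Y \<longleftrightarrow> dl y \<in> idx X" for y
    unfolding Y_def by (auto simp: image_iff dl intro: bexI[of _ "dl y"])
  have dl_inj: "dl x = dl y \<longleftrightarrow> x = y" for x y using dl(2) by metis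
  have coev_in: "coev X \<in> ghom ounit (otens X Y)" and ev_in: "ev X \<in> ghom (otens Y X) ounit"
    by (auto simp: ghom_def coev_def ev_def Y dl gr_split(4,5) K_zero split: if_splits)
  let ?id = mid
  have "mcmp (runit PC X) (mcmp (mtens (?id X) (ev X)) (mcmp (assoc PC X Y X)
      (mcmp (mtens (coev X) (?id X)) (mdag (lunit PC X))))) = ?id X" (is "mcmp _ (mcmp _ ?N) = _")
  proof (intro ext)
    fix i k
    have N: "?N p k = (if p1 p \<in> idx X \<and> p1 (p2 p) = dl (p1 p) \<and> p2 (p2 p) = k \<and> k \<in> idx X then 1 else 0)" for p
      unfolding PC_inverse_structure PC_rmon(1) mcmp_rmon mcmp_mon
      by (auto simp: mtens_def coev_def mon_def Y dl)
    define L where "L = ?N"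
    note N = N[folded L_def]
    \<comment> \<open>The coevaluation forces the middle leg to be the partner of the first, and the
      evaluation forces it to be the partner of the third. As \<open>dl\<close> is injective, one
      intermediate index survives.\<close>
    have "mcmp (mtens (?id X) (ev X)) L (pr i (ix 0)) k
        = mtens (?id X) (ev X) (pr i (ix 0)) (pr i (pr (dl i) i)) * L (pr i (pr (dl i) i)) k"
      by (rule mcmp_single) (auto simp: N mtens_def ev_def mon_def eq_pr_iff dl_inj split: if_splits)
    then show "mcmp (runit PC X) (mcmp (mtens (?id X) (ev X)) ?N) i k = ?id X i k"
      unfolding L_def[symmetric] unfolding PC_rmon(4) mcmp_rmon by (auto simp: N mtens_def ev_def mon_def)
  qed
  moreover have "mcmp (lunit PC Y) (mcmp (mtens (ev X) (?id Y)) (mcmp (mdag (assoc PC Y X Y))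
      (mcmp (mtens (?id Y) (coev X)) (mdag (runit PC Y))))) = ?id Y" (is "mcmp _ (mcmp _ ?N) = _")
  proof (intro ext)
    fix i k
    have N: "?N p k = (if p2 (p1 p) \<in> idx X \<and> p2 p = dl (p2 (p1 p)) \<and> p1 (p1 p) = k \<and> k \<in> idx Y then 1 else 0)" for p
      unfolding PC_inverse_structure(3) PC_rmon(2) mcmp_rmon mcmp_mon
      by (auto simp: mtens_def coev_def mon_def Y dl)
    define L where "L = ?N"
    note N = N[folded L_def]
    have "mcmp (mtens (ev X) (?id Y)) L (pr (ix 0) i) k
        = mtens (ev X) (?id Y) (pr (ix 0) i) (pr (pr i (dl i)) i) * L (pr (pr i (dl i)) i) k"
      by (rule mcmp_single) (auto simp: N mtens_def ev_def mon_def eq_pr_iff dl split: if_splits)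
    then show "mcmp (lunit PC Y) (mcmp (mtens (ev X) (?id Y)) ?N) i k = ?id Y i k"
      unfolding L_def[symmetric] unfolding PC_rmon(3) mcmp_rmon by (auto simp: N mtens_def ev_def mon_def Y dl)
  qed
  ultimately show ?thesis
    unfolding dual_pair_def using coev_in ev_in by (simp add: Y_def)
qed

lemma finite_simples_PC:
  "finite ({X. simple PC X} // {(X, Y). simple PC X \<and> simple PC Y \<and> isomorphic PC X Y})" (is "finite (?S // ?r)")
proof -
  obtain R where R: "finite R" "\<And>g. \<exists>r\<in>R. g - r \<in> K" using finite_index by blast
  have "?S // ?r \<subseteq> (\<lambda>r. ?r `` {set_encode {ix r}}) ` R"
  proof
    fix x assume "x \<in> ?S // ?r"
    then obtain X where X: "simple PC X" "x = ?r `` {X}" by (auto simp: quotient_def)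
    then obtain i where i: "idx X = {i}" using simple_PC_iff by blast
    obtain r where r: "r \<in> R" "gr i - r \<in> K" using R by blast
    have "isomorphic PC X (set_encode {ix r})"
      using isomorphic_PC_iff[of X i "set_encode {ix r}" "ix r"] i r K_sym by simp
    then have "(X, set_encode {ix r}) \<in> ?r" using X by (simp add: simple_PC_iff)
    then have "x = ?r `` {set_encode {ix r}}"
      using equiv_class_eq[OF unitary_semisimple_category.equiv_simple[OF semisimple_PC]] X by blast
    then show "x \<in> (\<lambda>r. ?r `` {set_encode {ix r}}) ` R" using r by blast
  qed
  then show ?thesis using R finite_subset by blast
qed

lemma fusion_PC: "unitary_fusion_category PC"
proof (intro unitary_fusion_category.intro semisimple_PC unitary_fusion_category_axioms.intro, goal_cases)
  case (2 X X' Y Y' f g) then show ?case using mtens_in by simp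
next case (3 X Y) show ?case by (auto simp: mtens_mon intro!: mon_cong)
next case (4 X X' X'' Y Y' Y'' f f' g g') then show ?case using mtens_mcmp by simp
next case 11 show ?case by (simp add: simple_PC_iff)
next case (12 X Y Z) show ?case
    unfolding PC_structure
    by (simp, rule mon_unitary[where \<tau> = "\<lambda>p. pr (pr (p1 p) (p1 (p2 p))) (p2 (p2 p))"])
      (auto simp: K_zero gr_split(1))
next case (13 X X' Y Y' Z Z' f g h) then show ?case
    apply (simp add: PC_rmon(1)[of X'] PC_structure(1)[of X] mcmp_mon mcmp_rmon)
    by (auto simp: mtens_def fun_eq_iff mult.assoc ghom_zero[of f X X'] ghom_zero[of g Y Y'] ghom_zero[of h Z Z'])
next case (14 X) show ?case
    unfolding PC_structure
    by (simp, rule mon_unitary[where \<tau> = "\<lambda>i. pr (ix 0) i"]) (auto simp: K_zero gr_split(2) pr_collapse)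
next case (15 X X' f)
  then have f: "f \<in> ghom X X'" by simp
  have "mcmp (lunit PC X') (mtens (mon {ix 0} (\<lambda>i. i) (\<lambda>_. 1)) f) = mcmp f (lunit PC X)"
  proof (intro ext)
    fix i k
    have "mtens (mon {ix 0} (\<lambda>i. i) (\<lambda>_. 1)) f (pr (ix 0) i) k = (if p1 k = ix 0 then f i (p2 k) else 0)"
      by (auto simp: mtens_def mon_def)
    then show "mcmp (lunit PC X') (mtens (mon {ix 0} (\<lambda>i. i) (\<lambda>_. 1)) f) i k = mcmp f (lunit PC X) i k"
      unfolding PC_rmon(3)[of X'] PC_structure(2)[of X] mcmp_mon mcmp_rmon
      using ghom_zero[OF f] by simp
  qed
  then show ?case unfolding PC_simps idx_ounit .
next case (16 X) show ?case
    unfolding PC_structure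
    by (simp, rule mon_unitary[where \<tau> = "\<lambda>i. pr i (ix 0)"]) (auto simp: K_zero gr_split(3) pr_collapse)
next case (17 X X' f)
  then have f: "f \<in> ghom X X'" by simp
  have "mcmp (runit PC X') (mtens f (mon {ix 0} (\<lambda>i. i) (\<lambda>_. 1))) = mcmp f (runit PC X)"
  proof (intro ext)
    fix i k
    have "mtens f (mon {ix 0} (\<lambda>i. i) (\<lambda>_. 1)) (pr i (ix 0)) k = (if p2 k = ix 0 then f i (p1 k) else 0)"
      by (auto simp: mtens_def mon_def)
    then show "mcmp (runit PC X') (mtens f (mon {ix 0} (\<lambda>i. i) (\<lambda>_. 1))) i k = mcmp f (runit PC X) i k"
      unfolding PC_rmon(4)[of X'] PC_structure(3)[of X] mcmp_mon mcmp_rmon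
      using ghom_zero[OF f] by simp
  qed
  then show ?case unfolding PC_simps idx_ounit .
next case (18 W X Y Z) show ?case
    by (auto simp: PC_structure mtens_mon mcmp_mon_mon intro!: mon_cong)
next case (19 X Y) show ?case
    by (auto simp: PC_structure mtens_mon mcmp_mon_mon pr_collapse intro!: mon_cong)
next case (20 X) show ?case using dual_pair_PC by blast
next case 21 show ?case by (rule finite_simples_PC)
qed (auto simp: mtens_def mdag_def algebra_simps fun_eq_iff)


section \<open>Braiding, twist and the canonical ribbon structure\<close>

lemma coev_grade:
  assumes "u \<in> ghom ounit (otens X Y)" "u p i \<noteq> 0"
  shows "gr (p1 p) + gr (p2 p) \<in> K"
proof -
  have "i = ix 0" "gr p - gr i \<in> K" using ghomD[OF assms] by auto
  then show ?thesis using gr_p[of p] by simp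
qed

text \<open>Here \<open>u\<close> and \<open>e\<close> are single numbers \<open>a\<close> and
  \<open>b\<close>. The zigzag says \<open>b * a = 1\<close>, the normalisation says that they have
  equal modulus, so both are phases and \<open>b\<close> is the conjugate of
  \<open>a\<close>.\<close>

lemma dual_normalized_PC:
  assumes n: "normalized_dual PC X Y u e" and x: "idx X = {x}" and y: "idx Y = {y}"
  shows "e (ix 0) (pr y x) = cnj (u (pr x y) (ix 0))" "u (pr x y) (ix 0) \<noteq> 0"
proof -
  let ?id = mid
  define a b where "a = u (pr x y) (ix 0)" and "b = e (ix 0) (pr y x)"
  have u: "u \<in> ghom ounit (otens X Y)" and e: "e \<in> ghom (otens Y X) ounit"
    and norm: "mcmp (mdag u) u = mcmp e (mdag e)"
    and zig: "mcmp (runit PC X) (mcmp (mtens (?id X) e) (mcmp (assoc PC X Y X)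
      (mcmp (mtens u (?id X)) (mdag (lunit PC X))))) = ?id X"
    using n by (simp_all add: normalized_dual_def dual_pair_def)
  have u0: "u p i \<noteq> 0 \<Longrightarrow> p = pr x y \<and> i = ix 0" for p i
    using ghomD[OF u, of p i] x y by (auto simp: eq_pr_iff)
  have e0: "e i p \<noteq> 0 \<Longrightarrow> p = pr y x \<and> i = ix 0" for p i
    using ghomD[OF e, of i p] x y by (auto simp: eq_pr_iff)
  define L where "L = mcmp (assoc PC X Y X) (mcmp (mtens u (?id X)) (mdag (lunit PC X)))"
  have L: "L p x = (if p = pr x (pr y x) then a else 0)" for p
    unfolding L_def PC_inverse_structure PC_rmon(1) mcmp_rmon mcmp_mon
    using x y by (auto simp: mtens_def mon_def a_def eq_pr_iff)
  have "mcmp (mtens (?id X) e) L (pr x (ix 0)) x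
      = mtens (?id X) e (pr x (ix 0)) (pr x (pr y x)) * L (pr x (pr y x)) x"
    by (rule mcmp_single) (simp add: L)
  also have "\<dots> = b * a" using x by (simp add: L mtens_def mon_def b_def)
  finally have "mcmp (runit PC X) (mcmp (mtens (?id X) e) L) x x = b * a"
    unfolding PC_rmon(4) mcmp_rmon using x by simp
  then have ba: "b * a = 1" unfolding L_def zig using x by (simp add: mon_def)
  have "mcmp (mdag u) u (ix 0) (ix 0) = mdag u (ix 0) (pr x y) * u (pr x y) (ix 0)"
    by (rule mcmp_single) (use u0 in auto)
  moreover have "mcmp e (mdag e) (ix 0) (ix 0) = e (ix 0) (pr y x) * mdag e (pr y x) (ix 0)"
    by (rule mcmp_single) (use e0 in auto)
  ultimately have nn: "cnj a * a = b * cnj b" unfolding norm by (simp add: mdag_def a_def b_def)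
  have "a \<noteq> 0" using ba by auto
  then show "u (pr x y) (ix 0) \<noteq> 0" by (simp add: a_def)
  have "(cnj a * a) * (cnj a * a) = (b * a) * cnj (b * a)" unfolding complex_cnj_mult
    using nn by (simp add: mult_ac)
  then have "(cnj a * a)\<^sup>2 = 1" using ba by (simp add: power2_eq_square)
  moreover have "cnj a * a = complex_of_real ((norm a)\<^sup>2)"
    using complex_norm_square[of a] by (simp add: mult.commute)
  ultimately have "complex_of_real (((norm a)\<^sup>2)\<^sup>2) = 1" by simp
  then have "((norm a)\<^sup>2)\<^sup>2 = 1" using of_real_eq_1_iff by blast
  then have "(norm a)\<^sup>2 = 1" unfolding power2_eq_1_iff[of "(norm a)\<^sup>2"] using zero_le_power2[of "norm a"] by linarith
  then have "cnj a * a = 1" using \<open>cnj a * a = complex_of_real ((norm a)\<^sup>2)\<close> by simp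
  then have "b * a = cnj a * a" using ba by simp
  then have "b = cnj a" using \<open>a \<noteq> 0\<close> by simp
  then show "e (ix 0) (pr y x) = cnj (u (pr x y) (ix 0))" by (simp add: a_def b_def)
qed

text \<open>A coevaluation only pairs grades that are opposite modulo \<open>K\<close>, and the
  quadratic form \<open>\<beta> g g\<close> is even.\<close>

lemma twist_dual_PC:
  assumes "u \<in> ghom ounit (otens X Y)"
  shows "mcmp (mtens (twist PC X) (mid Y)) u
    = mcmp (mtens (mid X) (twist PC Y)) u"
proof (intro ext)
  fix p i
  show "mcmp (mtens (twist PC X) (mid Y)) u p i
    = mcmp (mtens (mid X) (twist PC Y)) u p i"
  proof (cases "u p i = 0")
    case True
    then show ?thesis unfolding PC_structure mtens_mon by (simp add: mon_id_rmon mcmp_rmon)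
  next
    case False
    then have "gr (p1 p) - (- gr (p2 p)) \<in> K" using coev_grade[OF assms] by simp
    then have "\<beta> (gr (p1 p)) (gr (p1 p)) = \<beta> (- gr (p2 p)) (- gr (p2 p))" using \<beta>_cong by blast
    then show ?thesis unfolding PC_structure mtens_mon by (simp add: mon_id_rmon mcmp_rmon \<beta>_uminus)
  qed
qed

text \<open>The phase of twist and braiding together is
  \<open>\<beta> x x * \<beta> x y = \<beta> x (x + y)\<close> in terms of grades, which is 1
  because the sum of the grades lies in \<open>K\<close>. What remains is \<open>e\<close> read on
  the swapped pair, the conjugate of \<open>u\<close>.\<close>

lemma twist_canonical_PC:
  assumes n: "normalized_dual PC X Y u e" and x: "idx X = {x}" and y: "idx Y = {y}"
  shows "mcmp e (mcmp (braid PC X Y) (mtens (twist PC X) (mid Y))) = mdag u"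
proof (intro ext)
  fix i p
  have u: "u \<in> ghom ounit (otens X Y)" and e: "e \<in> ghom (otens Y X) ounit"
    using n by (simp_all add: normalized_dual_def dual_pair_def)
  note eu = dual_normalized_PC[OF assms]
  have "gr x + gr y \<in> K" using coev_grade[OF u eu(2)] by simp
  then have "\<beta> (gr x) (gr x + gr y) = 1" using \<beta>_K by blast
  then have \<beta>: "\<beta> (gr x) (gr x) * \<beta> (gr x) (gr y) = 1" by (simp add: \<beta>_add)
  have L: "mcmp e (mcmp (braid PC X Y) (mtens (twist PC X) (mid Y))) i p
      = (if p = pr x y then e i (pr y x) else 0)"
    unfolding PC_structure mtens_mon mcmp_mon_mon unfolding mcmp_mon
    using x y \<beta> by (auto simp: eq_pr_iff mult.commute pr)
  show "mcmp e (mcmp (braid PC X Y) (mtens (twist PC X) (mid Y))) i p = mdag u i p"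
  proof (cases "p = pr x y \<and> i = ix 0")
    case True
    then show ?thesis using L eu by (simp add: mdag_def)
  next
    case False
    moreover have "u p i = 0" if "p \<noteq> pr x y \<or> i \<noteq> ix 0"
      using that ghom_zero[OF u] x y by (auto simp: eq_pr_iff)
    moreover have "e i (pr y x) = 0" if "i \<noteq> ix 0" using that ghom_zero(1)[OF e] by simp
    ultimately show ?thesis using L by (auto simp: mdag_def)
  qed
qed

lemma braided_PC: "unitary_braided_fusion_category PC"
proof (intro unitary_braided_fusion_category.intro fusion_PC unitary_braided_fusion_category_axioms.intro, goal_cases)
  case (1 X Y) show ?case
    unfolding PC_structure
    by (simp, rule mon_unitary[where \<tau> = "\<lambda>p. pr (p2 p) (p1 p)"])
      (simp_all add: K_zero gr_split(6) \<beta>_norm)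
next case (2 X X' Y Y' f g)
  then have fg: "f \<in> ghom X X'" "g \<in> ghom Y Y'" by simp_all
  have "mcmp (braid PC X' Y') (mtens f g) = mcmp (mtens g f) (braid PC X Y)"
    unfolding PC_rmon(5)[of X'] PC_structure(4)[of X] mcmp_mon mcmp_rmon idx_otens
  proof (intro ext)
    fix p r
    show "(if p1 p \<in> idx Y' \<and> p2 p \<in> idx X'
            then \<beta> (gr (p2 p)) (gr (p1 p)) * mtens f g (pr (p2 p) (p1 p)) r else 0)
        = (if p1 r \<in> idx X \<and> p2 r \<in> idx Y
            then mtens g f p (pr (p2 r) (p1 r)) * \<beta> (gr (p1 r)) (gr (p2 r)) else 0)"
    proof (cases "f (p2 p) (p1 r) = 0 \<or> g (p1 p) (p2 r) = 0")
      case True then show ?thesis by (auto simp: mtens_def)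
    next
      case False
      then show ?thesis
        using ghomD[OF fg(1), of "p2 p" "p1 r"] ghomD[OF fg(2), of "p1 p" "p2 r"]
          \<beta>_cong[of "gr (p2 p)" "gr (p1 r)" "gr (p1 p)" "gr (p2 r)"]
        by (simp add: mtens_def)
    qed
  qed
  then show ?case by simp
next case (3 X Y Z) show ?case
    by (auto simp: PC_structure mtens_mon mcmp_mon_mon \<beta>_add mult.commute intro!: mon_cong)
next case (4 X Y Z) show ?case
    unfolding PC_simps PC_inverse_structure
    by (auto simp: PC_structure mtens_mon mcmp_mon_mon \<beta>_add mult.commute intro!: mon_cong)
next case (5 X) show ?case
    unfolding PC_structure
    by (rule mon_unitary[where \<tau> = "\<lambda>i. i"]) (auto simp: K_zero \<beta>_norm)
next case (6 X Y f)
  then have f: "f \<in> ghom X Y" by simp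
  have "mcmp (rmon (idx Y) (\<lambda>i. i) (\<lambda>i. \<beta> (gr i) (gr i))) f i k
      = mcmp f (mon (idx X) (\<lambda>i. i) (\<lambda>i. \<beta> (gr i) (gr i))) i k" for i k
    unfolding mcmp_rmon mcmp_mon
    using ghomD[OF f, of i k] \<beta>_cong[of "gr i" "gr k" "gr i" "gr k"] by (cases "f i k = 0") auto
  then show ?case unfolding PC_structure PC_simps mon_id_rmon[of "idx Y"] by blast
next case (7 X Y)
  \<comment> \<open>Expanding the quadratic form at a sum of two grades gives the two twists and the
    full braiding, which is the balancing axiom.\<close>
  have bal: "\<beta> (gr p) (gr p) = \<beta> (gr (p2 p)) (gr (p1 p)) * (\<beta> (gr (p1 p)) (gr (p2 p)) *
      (\<beta> (gr (p1 p)) (gr (p1 p)) * \<beta> (gr (p2 p)) (gr (p2 p))))" for p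
    unfolding gr_p[of p] \<beta>_add by (simp add: mult_ac)
  show ?case
  proof (simp add: PC_structure mtens_mon mcmp_mon_mon, rule mon_cong, goal_cases)
    case (3 j)
    show ?case by (subst bal) (simp add: mult_ac)
  qed auto
next case (8 X Y u e)
  then have "u \<in> ghom ounit (otens X Y)" by (simp add: dual_pair_def)
  then show ?case unfolding PC_simps by (rule twist_dual_PC)
next case (9 X Y u e)
  interpret unitary_fusion_category PC by (rule fusion_PC)
  have "dual_pair PC X Y u e" using 9(2) unfolding normalized_dual_def by (rule conjunct1)
  then have "simple PC Y" unfolding adual_iff using 9(1) by (rule dual_simple)
  with 9(1) obtain x y where "idx X = {x}" "idx Y = {y}" unfolding simple_PC_iff by (elim exE)
  with 9(2) show ?case unfolding PC_simps by (rule twist_canonical_PC)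
qed

end

section \<open>Monodromy and twist scalars\<close>

context unitary_braided_fusion_category
begin

definition br :: "'a \<Rightarrow> 'a \<Rightarrow> ('a, 'b) arrow" where
  "br X Y = Arrow (X \<odot> Y) (Y \<odot> X) (\<c> X Y)"

definition tw :: "'a \<Rightarrow> ('a, 'b) arrow" where
  "tw X = Arrow X X (\<t> X)"

lemma src_tgt_br [simp]:
  "src (br X Y) = X \<odot> Y" "tgt (br X Y) = Y \<odot> X" "src (tw X) = X" "tgt (tw X) = X"
  by (simp_all add: br_def tw_def)

lemma mor_br_simps: "mor (br X Y) = \<c> X Y" "mor (tw X) = \<t> X"
  by (simp_all add: br_def tw_def)

lemma arr_br [simp]:
  "X \<in> Obj C \<Longrightarrow> Y \<in> Obj C \<Longrightarrow> arr (br X Y)" "X \<in> Obj C \<Longrightarrow> arr (tw X)"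
  using braid_unitary[of X Y] twist_unitary[of X]
  by (simp_all add: arr_def mor_br_simps unitary_def)

lemma br_unitary:
  assumes "X \<in> Obj C" "Y \<in> Obj C"
  shows "adag (br X Y) ** br X Y = aid (X \<odot> Y)" "br X Y ** adag (br X Y) = aid (Y \<odot> X)"
  using braid_unitary[OF assms]
  by (auto intro!: arrow_eqI simp: unitary_def mor_br_simps mor_simps)

lemma tw_unitary: "X \<in> Obj C \<Longrightarrow> adag (tw X) ** tw X = aid X"
  using twist_unitary[of X]
  by (auto intro!: arrow_eqI simp: unitary_def mor_br_simps mor_simps)

lemma iso_arr_br: "X \<in> Obj C \<Longrightarrow> Y \<in> Obj C \<Longrightarrow> iso_arr (br X Y) (adag (br X Y))"
  by (auto simp: iso_arr_def br_unitary)

lemma br_natural: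
  assumes "arr f" "arr g"
  shows "br (tgt f) (tgt g) ** (f \<star> g) = (g \<star> f) ** br (src f) (src g)"
  using braid_natural[of "src f" "tgt f" "src g" "tgt g" "mor f" "mor g"] assms
  by (intro arrow_eqI) (auto simp: arr_def mor_br_simps mor_tens_simps mor_simps)

lemma tw_natural: "arr f \<Longrightarrow> tw (tgt f) ** f = f ** tw (src f)"
  using twist_natural[of "src f" "tgt f" "mor f"]
  by (intro arrow_eqI) (auto simp: arr_def mor_br_simps mor_simps)

lemma br_hexagon:
  assumes "X \<in> Obj C" "Y \<in> Obj C" "Z \<in> Obj C"
  shows "asc Y Z X ** br X (Y \<odot> Z) ** asc X Y Z = (aid Y \<star> br X Z) ** asc Y X Z ** (br X Y \<star> aid Z)"
    "adag (asc X Y Z) ** br (Y \<odot> Z) X ** adag (asc Y Z X)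
      = (br Y X \<star> aid Z) ** adag (asc Y X Z) ** (aid Y \<star> br Z X)"
  using hexagon[OF assms] hexagon'[OF assms(2,3,1)] assms
  by (auto intro!: arrow_eqI simp: mor_br_simps mor_tens_simps mor_simps)

text \<open>A relation rather than a function, so that it can be transported along isomorphisms and
  tensor products before simplicity is known; simplicity gives existence and uniqueness of the
  scalar.\<close>

definition monodromy :: "'a \<Rightarrow> 'a \<Rightarrow> complex \<Rightarrow> bool" where
  "monodromy X Y k \<longleftrightarrow> X \<in> Obj C \<and> Y \<in> Obj C \<and> br Y X ** br X Y = k *. aid (X \<odot> Y)"

definition twisted :: "'a \<Rightarrow> complex \<Rightarrow> bool" where
  "twisted X s \<longleftrightarrow> X \<in> Obj C \<and> tw X = s *. aid X"

lemma isomorphic_br: "X \<in> Obj C \<Longrightarrow> Y \<in> Obj C \<Longrightarrow> isomorphic C (X \<odot> Y) (Y \<odot> X)"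
  using isomorphicI[OF iso_arr_br[of X Y]] by simp

lemma monodromy_iso:
  assumes "monodromy X Y k" "X' \<in> Obj C" "Y' \<in> Obj C" "isomorphic C X X'" "isomorphic C Y Y'"
  shows "monodromy X' Y' k"
proof -
  have obj: "X \<in> Obj C" "Y \<in> Obj C" and m: "br Y X ** br X Y = k *. aid (X \<odot> Y)"
    using assms by (auto simp: monodromy_def)
  obtain f f' where f: "iso_arr f f'" "src f = X" "tgt f = X'"
    using assms obj by (auto simp: isomorphic_iff)
  obtain g g' where g: "iso_arr g g'" "src g = Y" "tgt g = Y'"
    using assms obj by (auto simp: isomorphic_iff)
  note fD = iso_arrD[OF f(1)] and gD = iso_arrD[OF g(1)]
  have fg: "(f \<star> g) ** (f' \<star> g') = aid (X' \<odot> Y')"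
    using fD gD f g assms(2,3) by (simp add: interchange aid_tens)
  have 1: "br X' Y' ** (f \<star> g) = (g \<star> f) ** br X Y" "br Y' X' ** (g \<star> f) = (f \<star> g) ** br Y X"
    using br_natural[of f g] br_natural[of g f] f g fD gD by auto
  have "br Y' X' ** br X' Y' = br Y' X' ** br X' Y' ** ((f \<star> g) ** (f' \<star> g'))"
    unfolding fg using assms(2,3) by simp
  also have "\<dots> = (f \<star> g) ** (br Y X ** br X Y) ** (f' \<star> g')"
    using fD(1-4) gD(1-4) f g assms(2,3) obj
    by (simp add: acmp_reassoc[OF 1(1)] acmp_reassoc[OF 1(2)])
  also have "\<dots> = k *. ((f \<star> g) ** (f' \<star> g'))"
    unfolding m using fD(1-4) gD(1-4) f g assms(2,3) obj by simp
  also have "\<dots> = k *. aid (X' \<odot> Y')" unfolding fg ..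
  finally show ?thesis using assms by (simp add: monodromy_def)
qed

lemma monodromy_sym:
  assumes "monodromy X Y k" shows "monodromy Y X k"
proof -
  have obj: "X \<in> Obj C" "Y \<in> Obj C" and m: "br Y X ** br X Y = k *. aid (X \<odot> Y)"
    using assms by (auto simp: monodromy_def)
  have "br X Y ** br Y X = br X Y ** (br Y X ** br X Y) ** adag (br X Y)"
    using obj by (simp add: br_unitary)
  also have "\<dots> = k *. aid (Y \<odot> X)" unfolding m using obj by (simp add: br_unitary)
  finally show ?thesis using obj by (simp add: monodromy_def)
qed

text \<open>Multiplying the two hexagons places the full braiding of \<open>X\<close> with
  \<open>Z\<close> in the middle. Once it is a scalar it leaves, the associators around it cancel,
  and the full braiding of \<open>X\<close> with \<open>Y\<close> becomes adjacent.\<close>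

lemma monodromy_tens:
  assumes "monodromy X Y k" "monodromy X Z l"
  shows "monodromy X (Y \<odot> Z) (k * l)"
proof -
  have obj: "X \<in> Obj C" "Y \<in> Obj C" "Z \<in> Obj C" and m: "br Y X ** br X Y = k *. aid (X \<odot> Y)"
    "br Z X ** br X Z = l *. aid (X \<odot> Z)"
    using assms by (auto simp: monodromy_def)
  note h = br_hexagon[OF obj]
  have "(adag (asc X Y Z) ** br (Y \<odot> Z) X ** adag (asc Y Z X)) ** (asc Y Z X ** br X (Y \<odot> Z) ** asc X Y Z)
      = (br Y X \<star> aid Z) ** adag (asc Y X Z) ** (aid Y \<star> (br Z X ** br X Z)) ** asc Y X Z ** (br X Y \<star> aid Z)"
    unfolding h using obj by (simp add: interchange')
  also have "\<dots> = l *. ((br Y X ** br X Y) \<star> aid Z)"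
    unfolding m(2) using obj by (simp add: acmp_reassoc[OF asc_unitary(1)] interchange aid_tens)
  also have "\<dots> = (k * l) *. aid ((X \<odot> Y) \<odot> Z)"
    unfolding m(1) using obj by (simp add: aid_tens mult.commute)
  finally have "adag (asc X Y Z) ** br (Y \<odot> Z) X ** br X (Y \<odot> Z) ** asc X Y Z = (k * l) *. aid ((X \<odot> Y) \<odot> Z)"
    using obj by (simp add: acmp_reassoc[OF asc_unitary(1)])
  then have "asc X Y Z ** (adag (asc X Y Z) ** br (Y \<odot> Z) X ** br X (Y \<odot> Z) ** asc X Y Z) ** adag (asc X Y Z)
      = (k * l) *. aid (X \<odot> (Y \<odot> Z))"
    using obj by simp
  then have "br (Y \<odot> Z) X ** br X (Y \<odot> Z) = (k * l) *. aid (X \<odot> (Y \<odot> Z))"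
    using obj by (simp add: acmp_reassoc[OF asc_unitary(2)])
  then show ?thesis using obj by (simp add: monodromy_def)
qed

lemma monodromy_ex:
  assumes "simple C (X \<odot> Y)" "X \<in> Obj C" "Y \<in> Obj C"
  obtains k where "monodromy X Y k"
  using simple_scalar[OF assms(1), of "br Y X ** br X Y"] assms by (auto simp: monodromy_def)

lemma monodromy_unique:
  assumes "simple C (X \<odot> Y)" "monodromy X Y k" "monodromy X Y l"
  shows "k = l"
  using assms simple_ascale_inject[OF assms(1)] by (auto simp: monodromy_def)

lemma monodromy_nonzero:
  assumes "simple C (X \<odot> Y)" "monodromy X Y k"
  shows "k \<noteq> 0"
proof
  assume "k = 0"
  then have obj: "X \<in> Obj C" "Y \<in> Obj C" and m: "br Y X ** br X Y = anul (X \<odot> Y) (X \<odot> Y)"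
    using assms ascale_zero[of "aid (X \<odot> Y)"] by (auto simp: monodromy_def)
  have "iso_arr (br Y X ** br X Y) (adag (br X Y) ** adag (br Y X))"
    using iso_arr_acmp iso_arr_br obj by simp
  then show False using iso_nonzero[of "br Y X ** br X Y"] assms(1) m obj by auto
qed

text \<open>The unit is isomorphic to its own square, so the scalar is idempotent; it is nonzero
  because braidings are invertible.\<close>

lemma monodromy_unit:
  assumes "invertible X" shows "monodromy X \<I> 1"
proof -
  have X: "X \<in> Obj C" "simple C (X \<odot> \<I>)"
    using assms invertible_obj simple_tens_invertible unit_simple by auto
  obtain k where k: "monodromy X \<I> k" using monodromy_ex[OF X(2)] X by auto
  have "monodromy X (\<I> \<odot> \<I>) (k * k)" using monodromy_tens k by simp
  then have "monodromy X \<I> (k * k)"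
    using monodromy_iso[of X "\<I> \<odot> \<I>" "k * k" X \<I>] X isomorphic_refl isomorphic_structure(2) by simp
  then have "k * k = k" using monodromy_unique X k by blast
  then have "k = 1" using monodromy_nonzero[OF X(2) k] by simp
  then show ?thesis using k by simp
qed

lemma twisted_ex: "simple C X \<Longrightarrow> \<exists>s. twisted X s"
  using simple_scalar[of X "tw X"] simple_obj by (auto simp: twisted_def)

lemma twisted_unique: "simple C X \<Longrightarrow> twisted X s \<Longrightarrow> twisted X t \<Longrightarrow> s = t"
  using simple_ascale_inject by (auto simp: twisted_def)

lemma twisted_norm:
  assumes "simple C X" "twisted X s" shows "norm s = 1"
proof -
  have X: "X \<in> Obj C" "tw X = s *. aid X" using assms by (auto simp: twisted_def)
  have "(s * cnj s) *. aid X = 1 *. aid X"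
    using tw_unitary[OF X(1)] unfolding X(2) using X(1) by simp
  then have "s * cnj s = 1" using simple_ascale_inject assms(1) by blast
  then have "(norm s)\<^sup>2 = 1" by (metis complex_norm_square of_real_eq_1_iff)
  then show ?thesis unfolding power2_eq_1_iff using norm_ge_zero[of s] by linarith
qed

lemma twisted_iso:
  assumes "twisted X s" "Y \<in> Obj C" "isomorphic C X Y" shows "twisted Y s"
proof -
  have X: "X \<in> Obj C" "tw X = s *. aid X" using assms by (auto simp: twisted_def)
  obtain f f' where f: "iso_arr f f'" "src f = X" "tgt f = Y"
    using assms X by (auto simp: isomorphic_iff)
  note fD = iso_arrD[OF f(1)]
  have 1: "tw Y ** f = f ** tw X" using tw_natural[of f] f fD by simp
  have "tw Y = tw Y ** f ** f'" using fD f assms(2) by simp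
  also have "\<dots> = f ** tw X ** f'" using fD(1-4) f assms(2) X(1) by (simp add: acmp_reassoc[OF 1])
  also have "\<dots> = s *. aid Y" unfolding X(2) using fD f X(1) by simp
  finally show ?thesis using assms by (simp add: twisted_def)
qed

lemma twisted_tens:
  assumes "twisted X s" "twisted Y t" "monodromy X Y k"
  shows "twisted (X \<odot> Y) (k * s * t)"
proof -
  have X: "X \<in> Obj C" "tw X = s *. aid X" "Y \<in> Obj C" "tw Y = t *. aid Y"
    and k: "br Y X ** br X Y = k *. aid (X \<odot> Y)"
    using assms by (auto simp: twisted_def monodromy_def)
  have "tw (X \<odot> Y) = br Y X ** br X Y ** (tw X \<star> tw Y)"
    using twist_balance[OF X(1,3)]
    by (intro arrow_eqI) (auto simp: mor_br_simps mor_tens_simps mor_simps)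
  also have "\<dots> = (br Y X ** br X Y) ** (tw X \<star> tw Y)" using X(1,3) by simp
  also have "\<dots> = (k * s * t) *. aid (X \<odot> Y)"
    unfolding k X using X(1,3) by (simp add: aid_tens mult_ac)
  finally show ?thesis using X by (simp add: twisted_def)
qed

lemma twisted_unit: "twisted \<I> 1"
proof -
  obtain s where s: "twisted \<I> s" using twisted_ex unit_simple by blast
  have "twisted (\<I> \<odot> \<I>) (1 * s * s)"
    by (rule twisted_tens[OF s s monodromy_unit[OF invertible_unit]])
  then have "twisted \<I> (s * s)" using twisted_iso isomorphic_structure(2) by simp
  then have "s * s = s" using twisted_unique s unit_simple by blast
  then have "s = 1" using twisted_norm[OF unit_simple s] by auto
  then show ?thesis using s by simp
qed

text \<open>A dual \<open>Y\<close> has the same twist \<open>s\<close>. Since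
  \<open>X \<odot> Y\<close> is isomorphic to the unit, balancing gives \<open>k * s * s = 1\<close>
  for the full braiding \<open>k\<close> of \<open>X\<close> with \<open>Y\<close>. Braiding
  \<open>X\<close> with the unit is trivial, so the self-braiding \<open>m\<close> satisfies
  \<open>m * k = 1\<close>; hence \<open>m = s^2\<close>.\<close>

lemma monodromy_self:
  assumes "invertible X" "twisted X s"
  shows "monodromy X X (s\<^sup>2)"
proof -
  have X: "X \<in> Obj C" "simple C X" using assms invertible_obj invertible_simple by auto
  obtain Y u e d where "ndual X Y u e (complex_of_real d)" using ex_ndual X by blast
  then have a: "adual X Y u e" by (auto simp: ndual_def)
  note d = adualD[OF a]
  have Y: "simple C Y" using dual_simple[OF a X(2)] .
  then obtain t where t: "twisted Y t" using twisted_ex by blast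
  have XY: "simple C (X \<odot> Y)" using simple_tens_invertible assms Y by blast
  have nz: "u \<noteq> anul \<I> (X \<odot> Y)" using adual_nonzero(1)[OF a simple_aid_neq[OF X(2)]] .
  then have iso: "isomorphic C \<I> (X \<odot> Y)" using schur_iso[of u] d(1-8) unit_simple XY by simp
  have "dual_pair C X Y (mor u) (mor e)"
    unfolding adual_iff using a d(4,5,7,8) by (simp add: Arrow_collapse)
  then have "(\<t> X \<boxtimes> \<i> Y) \<Zcomp> mor u = (\<i> X \<boxtimes> \<t> Y) \<Zcomp> mor u" by (rule twist_dual)
  then have "(tw X \<star> aid Y) ** u = (aid X \<star> tw Y) ** u"
    using d(4,5) by (intro arrow_eqI) (auto simp: mor_br_simps mor_tens_simps mor_simps)
  moreover have "tw X = s *. aid X" "tw Y = t *. aid Y" using assms t by (auto simp: twisted_def)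
  ultimately have "s *. u = t *. u" using d(1-8) by (simp add: aid_tens)
  then have "t = s" using ascale_inject[of u s t] nz d(1-8) by simp
  obtain k where k: "monodromy X Y k" using monodromy_ex[OF XY] d by blast
  have "twisted (X \<odot> Y) (k * s * s)" using twisted_tens assms t k \<open>t = s\<close> by blast
  moreover have "twisted (X \<odot> Y) 1" using twisted_iso[OF twisted_unit _ iso] d(1,2) by simp
  ultimately have 1: "k * s * s = 1" using twisted_unique XY by blast
  obtain m where m: "monodromy X X m"
    using monodromy_ex simple_tens_invertible assms X by blast
  have "monodromy X (X \<odot> Y) (m * k)" using monodromy_tens m k by blast
  moreover have "monodromy X (X \<odot> Y) 1"
    using monodromy_iso[OF monodromy_unit[OF assms(1)] _ _ _ iso] isomorphic_refl d(1,2) by simp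
  ultimately have "m * k = 1"
    using monodromy_unique simple_tens_invertible[OF assms(1) XY] by blast
  then have "m = s\<^sup>2" using 1 by (metis mult.assoc mult.commute mult.right_neutral power2_eq_square)
  then show ?thesis using m by simp
qed

lemma abelian_invertible:
  assumes "abelian C x" "simple C (rep x)" shows "invertible (rep x)"
proof -
  obtain Y where Y: "Y \<in> Obj C" "isomorphic C (rep x \<odot> Y) \<I>"
    using abelian_coev_iso[OF assms] by blast
  have X: "rep x \<in> Obj C" using assms simple_obj by blast
  have "isomorphic C (Y \<odot> rep x) \<I>"
    using isomorphic_trans[OF _ _ _ isomorphic_br Y(2)] X Y by simp
  then show ?thesis using X Y by (auto simp: invertible_def)
qed

section \<open>The group of Abelian anyons\<close>

definition cls :: "'a \<Rightarrow> 'a set" where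
  "cls X = {Y. simple C Y \<and> isomorphic C X Y}"

lemma cls_in: "simple C X \<Longrightarrow> cls X \<in> anyons C"
  unfolding anyons_def cls_def quotient_def by auto

lemma cls_eq_iff: "simple C X \<Longrightarrow> simple C Y \<Longrightarrow> cls X = cls Y \<longleftrightarrow> isomorphic C X Y"
proof -
  assume X: "simple C X" "simple C Y"
  show "cls X = cls Y \<longleftrightarrow> isomorphic C X Y"
  proof
    have "Y \<in> cls Y" using X simple_obj isomorphic_refl by (simp add: cls_def)
    moreover assume "cls X = cls Y"
    ultimately have "Y \<in> cls X" by simp
    then show "isomorphic C X Y" by (simp add: cls_def)
  next
    assume iso: "isomorphic C X Y"
    have "isomorphic C X Z \<longleftrightarrow> isomorphic C Y Z" if "simple C Z" for Z
      using isomorphic_trans[of X Y Z] isomorphic_trans[of Y X Z] isomorphic_sym[of X Y]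
        iso simple_obj[OF X(1)] simple_obj[OF X(2)] simple_obj[OF that] by blast
    then show "cls X = cls Y" by (auto simp: cls_def)
  qed
qed

lemma rep_anyon:
  assumes "x \<in> anyons C" shows "simple C (rep x)" "cls (rep x) = x"
proof -
  obtain X where X: "simple C X" "x = cls X"
    using assms by (auto simp: anyons_def cls_def quotient_def)
  then have "X \<in> x" using isomorphic_refl simple_obj by (auto simp: cls_def)
  then have "rep x \<in> x" unfolding rep_def by (metis someI)
  then show "simple C (rep x)" "cls (rep x) = x"
    using X cls_eq_iff[of X "rep x"] by (auto simp: cls_def)
qed

lemma rep_cls: "simple C X \<Longrightarrow> isomorphic C (rep (cls X)) X"
  using rep_anyon[OF cls_in, of X] cls_eq_iff[of "rep (cls X)" X] by simp

lemma vacuum_eq: "vacuum C = cls \<I>"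
  by (simp add: vacuum_def cls_def)

lemma finite_anyons: "finite (anyons C)"
  unfolding anyons_def by (rule finite_simples)

text \<open>The Picard group. Invertibility is the convenient membership condition, since it visibly
  passes to products and inverses; \<open>Pic_iff_abelian\<close> translates it into dimension 1,
  and \<open>anyon_group_mult\<close> identifies the product with the one defined through
  \<open>occurs_in\<close>.\<close>

definition Pic :: "'a set monoid" where
  "Pic = \<lparr>carrier = {x \<in> anyons C. invertible (rep x)},
     mult = (\<lambda>x y. cls (rep x \<odot> rep y)), one = vacuum C\<rparr>"

lemma Pic_carrier: "x \<in> carrier Pic \<longleftrightarrow> x \<in> anyons C \<and> invertible (rep x)"
  by (simp add: Pic_def)

lemma Pic_iff_abelian: "x \<in> carrier Pic \<longleftrightarrow> x \<in> anyons C \<and> abelian C x"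
  using abelian_invertible invertible_qdim rep_anyon(1) by (auto simp: Pic_carrier)

lemma Pic_mult: "x \<otimes>\<^bsub>Pic\<^esub> y = cls (rep x \<odot> rep y)"
  by (simp add: Pic_def)

lemma Pic_D:
  assumes "x \<in> carrier Pic"
  shows "x \<in> anyons C" "invertible (rep x)" "rep x \<in> Obj C" "simple C (rep x)" "cls (rep x) = x"
  using assms rep_anyon invertible_obj by (auto simp: Pic_carrier)

lemma cls_in_Pic:
  assumes "invertible X" shows "cls X \<in> carrier Pic"
proof -
  have X: "simple C X" using assms invertible_simple by blast
  have "isomorphic C X (rep (cls X))"
    using isomorphic_sym rep_cls rep_anyon(1)[OF cls_in] X simple_obj by blast
  then have "invertible (rep (cls X))"
    using invertible_iso assms rep_anyon(1)[OF cls_in[OF X]] simple_obj by blast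
  then show ?thesis using X cls_in by (simp add: Pic_carrier)
qed

lemma rep_mult_iso:
  assumes "x \<in> carrier Pic" "y \<in> anyons C"
  shows "isomorphic C (rep (cls (rep x \<odot> rep y))) (rep x \<odot> rep y)"
    "isomorphic C (rep x \<odot> rep y) (rep (cls (rep x \<odot> rep y)))"
    "simple C (rep x \<odot> rep y)"
proof -
  show s: "simple C (rep x \<odot> rep y)"
    using simple_tens_invertible Pic_D[OF assms(1)] rep_anyon[OF assms(2)] by blast
  show 1: "isomorphic C (rep (cls (rep x \<odot> rep y))) (rep x \<odot> rep y)"
    using rep_cls s by blast
  show "isomorphic C (rep x \<odot> rep y) (rep (cls (rep x \<odot> rep y)))"
    using isomorphic_sym[OF _ _ 1] s rep_anyon(1)[OF cls_in] simple_obj by blast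
qed

text \<open>The product of an invertible and a simple object is simple, so by Schur's lemma a
  nonzero morphism from a simple object into it is an isomorphism.\<close>

lemma occurs_in_iff:
  assumes "x \<in> carrier Pic" "y \<in> anyons C" "z \<in> anyons C"
  shows "occurs_in C z x y \<longleftrightarrow> z = cls (rep x \<odot> rep y)"
proof -
  note s = rep_mult_iso[OF assms(1,2)]
  have z: "simple C (rep z)" "cls (rep z) = z" using rep_anyon assms by auto
  have "occurs_in C z x y \<longleftrightarrow> isomorphic C (rep z) (rep x \<odot> rep y)"
  proof
    assume "occurs_in C z x y"
    then obtain f where "f \<in> Hom C (rep z) (rep x \<odot> rep y)" "f \<noteq> nul C (rep z) (rep x \<odot> rep y)"
      unfolding occurs_in_def by blast
    then show "isomorphic C (rep z) (rep x \<odot> rep y)"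
      using schur_iso[of "Arrow (rep z) (rep x \<odot> rep y) f"] z s simple_obj by (simp add: anul_def)
  next
    assume "isomorphic C (rep z) (rep x \<odot> rep y)"
    then obtain f g where f: "iso_arr f g" "src f = rep z" "tgt f = rep x \<odot> rep y"
      using isomorphic_iff z s simple_obj by blast
    then have "mor f \<noteq> nul C (rep z) (rep x \<odot> rep y)"
      using iso_nonzero[OF f(1)] z Arrow_collapse[of f] by (metis anul_def)
    then show "occurs_in C z x y"
      unfolding occurs_in_def using f(2,3) arrD(3)[OF iso_arrD(1)[OF f(1)]] by auto
  qed
  also have "\<dots> \<longleftrightarrow> cls (rep z) = cls (rep x \<odot> rep y)"
    using cls_eq_iff z s by blast
  finally show ?thesis using z by simp
qed

lemma anyon_group_mult:
  assumes "x \<in> carrier Pic" "y \<in> carrier Pic"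
  shows "x \<otimes>\<^bsub>anyon_group C\<^esub> y = x \<otimes>\<^bsub>Pic\<^esub> y"
proof -
  have "(THE z. z \<in> anyons C \<and> occurs_in C z x y) = cls (rep x \<odot> rep y)"
    using occurs_in_iff[OF assms(1) Pic_D(1)[OF assms(2)]] cls_in rep_mult_iso(3)[OF assms(1)] Pic_D(1)[OF assms(2)]
    by (intro the_equality) auto
  then show ?thesis by (simp add: anyon_group_def Pic_mult)
qed

lemma comm_group_Pic: "comm_group Pic"
proof (rule comm_groupI)
  show "x \<otimes>\<^bsub>Pic\<^esub> y \<in> carrier Pic" if "x \<in> carrier Pic" "y \<in> carrier Pic" for x y
    using that invertible_tens cls_in_Pic Pic_D by (simp add: Pic_mult)
  have one: "\<one>\<^bsub>Pic\<^esub> = cls \<I>" by (simp add: Pic_def vacuum_eq)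
  show "\<one>\<^bsub>Pic\<^esub> \<in> carrier Pic"
    unfolding one by (simp add: cls_in_Pic invertible_unit)
  show "x \<otimes>\<^bsub>Pic\<^esub> y \<otimes>\<^bsub>Pic\<^esub> z = x \<otimes>\<^bsub>Pic\<^esub> (y \<otimes>\<^bsub>Pic\<^esub> z)"
    if xyz: "x \<in> carrier Pic" "y \<in> carrier Pic" "z \<in> carrier Pic" for x y z
  proof -
    note x = Pic_D[OF xyz(1)] and y = Pic_D[OF xyz(2)] and z = Pic_D[OF xyz(3)]
    let ?xy = "cls (rep x \<odot> rep y)" let ?yz = "cls (rep y \<odot> rep z)"
    have m: "?xy \<in> carrier Pic" "?yz \<in> carrier Pic"
      using x y z invertible_tens cls_in_Pic by auto
    note xy = Pic_D[OF m(1)] and yz = Pic_D[OF m(2)]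
    have 1: "isomorphic C (rep ?xy \<odot> rep z) ((rep x \<odot> rep y) \<odot> rep z)"
      using isomorphic_tens rep_mult_iso(1)[OF xyz(1) y(1)] isomorphic_refl x y z xy by simp
    have 2: "isomorphic C ((rep x \<odot> rep y) \<odot> rep z) (rep x \<odot> (rep y \<odot> rep z))"
      using isomorphic_structure(1) x y z by simp
    have 3: "isomorphic C (rep x \<odot> (rep y \<odot> rep z)) (rep x \<odot> rep ?yz)"
      using isomorphic_tens rep_mult_iso(2)[OF xyz(2) z(1)] isomorphic_refl x y z yz by simp
    have "isomorphic C (rep ?xy \<odot> rep z) (rep x \<odot> (rep y \<odot> rep z))"
      using isomorphic_trans[OF _ _ _ 1 2] x y z xy by simp
    from isomorphic_trans[OF _ _ _ this 3]
    have "isomorphic C (rep ?xy \<odot> rep z) (rep x \<odot> rep ?yz)" using x y z xy yz by simp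
    then show ?thesis
      unfolding Pic_mult using cls_eq_iff simple_tens_invertible x z xy yz by blast
  qed
  show "x \<otimes>\<^bsub>Pic\<^esub> y = y \<otimes>\<^bsub>Pic\<^esub> x" if "x \<in> carrier Pic" "y \<in> carrier Pic" for x y
    unfolding Pic_mult using cls_eq_iff isomorphic_br simple_tens_invertible Pic_D[OF that(1)] Pic_D[OF that(2)]
    by blast
  show "\<one>\<^bsub>Pic\<^esub> \<otimes>\<^bsub>Pic\<^esub> x = x" if "x \<in> carrier Pic" for x
  proof -
    note x = Pic_D[OF that]
    have I: "cls \<I> \<in> carrier Pic" by (simp add: cls_in_Pic invertible_unit)
    have "isomorphic C (rep (cls \<I>) \<odot> rep x) (\<I> \<odot> rep x)"
      using isomorphic_tens rep_cls[OF unit_simple] isomorphic_refl x Pic_D[OF I] by simp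
    from isomorphic_trans[OF _ _ _ this isomorphic_structure(2)]
    have "isomorphic C (rep (cls \<I>) \<odot> rep x) (rep x)" using x Pic_D[OF I] by simp
    then show ?thesis
      unfolding Pic_mult one using cls_eq_iff simple_tens_invertible x Pic_D[OF I] by metis
  qed
  show "\<exists>y\<in>carrier Pic. y \<otimes>\<^bsub>Pic\<^esub> x = \<one>\<^bsub>Pic\<^esub>" if "x \<in> carrier Pic" for x
  proof -
    note x = Pic_D[OF that]
    obtain Z where Z: "invertible Z" "isomorphic C (Z \<odot> rep x) \<I>"
      using invertible_inverse[OF x(2)] by blast
    have z: "cls Z \<in> carrier Pic" using Z cls_in_Pic by blast
    have "isomorphic C (rep (cls Z) \<odot> rep x) (Z \<odot> rep x)"
      using isomorphic_tens rep_cls[OF invertible_simple[OF Z(1)]] isomorphic_refl x Pic_D[OF z]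
        invertible_obj[OF Z(1)] by simp
    from isomorphic_trans[OF _ _ _ this Z(2)]
    have "isomorphic C (rep (cls Z) \<odot> rep x) \<I>"
      using x Pic_D[OF z] invertible_obj[OF Z(1)] by simp
    then have "cls Z \<otimes>\<^bsub>Pic\<^esub> x = \<one>\<^bsub>Pic\<^esub>"
      unfolding Pic_mult one using cls_eq_iff simple_tens_invertible x Pic_D[OF z] unit_simple by metis
    then show ?thesis using z by blast
  qed
qed

lemma scalar_of_eq:
  assumes "simple C X" "f \<in> Hom C X X" "f = k \<cdot> \<i> X"
  shows "scalar_of C X f = k"
  unfolding scalar_of_def
proof (rule the_equality)
  fix l assume "f = l \<cdot> \<i> X"
  then have "l *. aid X = k *. aid X" using assms by (simp add: ascale_def aid_def)
  then show "l = k" using simple_ascale_inject assms by blast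
qed fact

lemma monodromy_mor:
  "X \<in> Obj C \<Longrightarrow> Y \<in> Obj C \<Longrightarrow> monodromy X Y k \<longleftrightarrow> \<c> Y X \<Zcomp> \<c> X Y = k \<cdot> \<i> (X \<odot> Y)"
  unfolding monodromy_def br_def acmp_def ascale_def aid_def by simp

lemma mutual_monodromy:
  assumes "simple C (rep x \<odot> rep y)" "rep x \<in> Obj C" "rep y \<in> Obj C"
  shows "monodromy (rep x) (rep y) (mutual C x y)"
proof -
  obtain k where k: "monodromy (rep x) (rep y) k" using monodromy_ex assms by blast
  have "\<c> (rep y) (rep x) \<Zcomp> \<c> (rep x) (rep y) \<in> Hom C (rep x \<odot> rep y) (rep x \<odot> rep y)"
    using k monodromy_mor[OF assms(2,3)] scale_in[OF _ _ ident_in] assms(2,3) by simp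
  then have "mutual C x y = k"
    unfolding mutual_def using scalar_of_eq assms k monodromy_mor by blast
  then show ?thesis using k by simp
qed

lemma spin_twisted:
  assumes "x \<in> anyons C" shows "twisted (rep x) (spin C x)"
proof -
  note x = rep_anyon(1)[OF assms]
  obtain s where s: "twisted (rep x) s" using twisted_ex x by blast
  have "\<t> (rep x) = s \<cdot> \<i> (rep x)"
    using s by (simp add: twisted_def tw_def ascale_def aid_def)
  moreover have "\<t> (rep x) \<in> Hom C (rep x) (rep x)"
    using twist_unitary simple_obj[OF x] by (simp add: unitary_def)
  ultimately have "spin C x = s" unfolding spin_def using scalar_of_eq x by blast
  then show ?thesis using s by simp
qed

lemma braids_trivially_iff:
  assumes "x \<in> carrier Pic" "y \<in> anyons C"
  shows "braids_trivially C x y \<longleftrightarrow> mutual C x y = 1"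
proof -
  have obj: "rep x \<in> Obj C" "rep y \<in> Obj C" "simple C (rep x \<odot> rep y)"
    using Pic_D[OF assms(1)] rep_anyon[OF assms(2)] simple_obj rep_mult_iso[OF assms] by auto
  have "braids_trivially C x y \<longleftrightarrow> monodromy (rep x) (rep y) 1"
    using obj monodromy_mor[of "rep x" "rep y" 1] scale_one[OF _ _ ident_in[of "rep x \<odot> rep y"]]
    by (simp add: braids_trivially_def)
  then show ?thesis using mutual_monodromy[of x y] obj monodromy_unique by metis
qed

lemma Pic_monodromy:
  assumes "x \<in> carrier Pic" "y \<in> anyons C"
  shows "monodromy (rep x) (rep y) (mutual C x y)"
  using mutual_monodromy rep_mult_iso(3)[OF assms] Pic_D[OF assms(1)] rep_anyon(1)[OF assms(2)] simple_obj
  by blast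

lemma mutual_sym:
  assumes "x \<in> carrier Pic" "y \<in> carrier Pic"
  shows "mutual C x y = mutual C y x"
  using Pic_monodromy[OF assms(1) Pic_D(1)[OF assms(2)]] Pic_monodromy[OF assms(2) Pic_D(1)[OF assms(1)]]
    monodromy_sym monodromy_unique rep_mult_iso(3)[OF assms(1) Pic_D(1)[OF assms(2)]] by blast

lemma mutual_mult:
  assumes "x \<in> carrier Pic" "y \<in> carrier Pic" "z \<in> carrier Pic"
  shows "mutual C x (y \<otimes>\<^bsub>Pic\<^esub> z) = mutual C x y * mutual C x z"
proof -
  note x = Pic_D[OF assms(1)] and y = Pic_D[OF assms(2)] and z = Pic_D[OF assms(3)]
  have yz: "cls (rep y \<odot> rep z) \<in> anyons C" using cls_in rep_mult_iso(3) assms z by blast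
  have "monodromy (rep x) (rep y \<odot> rep z) (mutual C x y * mutual C x z)"
    using monodromy_tens Pic_monodromy assms y z by blast
  from monodromy_iso[OF this _ _ isomorphic_refl rep_mult_iso(2)[OF assms(2) z(1)]]
  have "monodromy (rep x) (rep (cls (rep y \<odot> rep z))) (mutual C x y * mutual C x z)"
    using x rep_anyon(1)[OF yz] simple_obj by blast
  then show ?thesis
    unfolding Pic_mult
    using Pic_monodromy[OF assms(1) yz] monodromy_unique rep_mult_iso(3)[OF assms(1) yz] by blast
qed

lemma spin_mult:
  assumes "x \<in> carrier Pic" "y \<in> carrier Pic"
  shows "spin C (x \<otimes>\<^bsub>Pic\<^esub> y) = mutual C x y * spin C x * spin C y"
proof -
  note x = Pic_D[OF assms(1)] and y = Pic_D[OF assms(2)]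
  have xy: "cls (rep x \<odot> rep y) \<in> anyons C" using cls_in rep_mult_iso(3) assms y by blast
  have "twisted (rep x \<odot> rep y) (mutual C x y * spin C x * spin C y)"
    using twisted_tens spin_twisted Pic_monodromy assms x y by blast
  from twisted_iso[OF this _ rep_mult_iso(2)[OF assms(1) y(1)]]
  show ?thesis unfolding Pic_mult
    using twisted_unique spin_twisted[OF xy] rep_anyon(1)[OF xy] simple_obj by blast
qed

lemma mutual_self:
  assumes "x \<in> carrier Pic" shows "mutual C x x = (spin C x)\<^sup>2"
  using monodromy_self[OF Pic_D(2)[OF assms] spin_twisted[OF Pic_D(1)[OF assms]]]
    Pic_monodromy[OF assms Pic_D(1)[OF assms]] monodromy_unique rep_mult_iso(3)[OF assms Pic_D(1)[OF assms]]
  by blast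

lemma spin_norm: "x \<in> anyons C \<Longrightarrow> norm (spin C x) = 1"
  using twisted_norm spin_twisted rep_anyon(1) by blast

end

section \<open>Metric groups with a vison\<close>

lemma inj_on_cis_roots:
  assumes "n > 0"
  shows "inj_on (\<lambda>k. cis (2 * pi * real k / real n)) {..<n}"
  using bij_betw_roots_unity[OF assms] by (simp add: bij_betw_def)

lemma cis_rational_power:
  assumes "n > 0"
  shows "cis (2 * pi * real k / real n) ^ n = 1"
  using assms cis_multiple_2pi[of "real k"] by (simp add: DeMoivre)

text \<open>The data left after forgetting the category: \<open>M\<close> is the full braiding,
  \<open>sp\<close> the spin and \<open>chi\<close> the charge phase with angle
  \<open>pi * Q\<close>. Using a phase turns congruences of charges modulo 2 into equations and
  makes charge a character; the vison law then reads \<open>M v x = chi x ^ 2\<close>.\<close>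

locale metric_group = comm_group G for G (structure) +
  fixes M :: "'a \<Rightarrow> 'a \<Rightarrow> complex" and sp chi :: "'a \<Rightarrow> complex" and q :: nat and v a c :: 'a
  assumes M_sym: "x \<in> carrier G \<Longrightarrow> y \<in> carrier G \<Longrightarrow> M x y = M y x"
    and M_mult: "x \<in> carrier G \<Longrightarrow> y \<in> carrier G \<Longrightarrow> z \<in> carrier G \<Longrightarrow> M x (y \<otimes> z) = M x y * M x z"
    and sp_mult: "x \<in> carrier G \<Longrightarrow> y \<in> carrier G \<Longrightarrow> sp (x \<otimes> y) = M x y * sp x * sp y"
    and M_self: "x \<in> carrier G \<Longrightarrow> M x x = (sp x)\<^sup>2"
    and sp_norm: "x \<in> carrier G \<Longrightarrow> norm (sp x) = 1"
    and chi_mult: "x \<in> carrier G \<Longrightarrow> y \<in> carrier G \<Longrightarrow> chi (x \<otimes> y) = chi x * chi y"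
    and chi_norm: "x \<in> carrier G \<Longrightarrow> norm (chi x) = 1"
    and vac: "v \<in> carrier G" "a \<in> carrier G" "c \<in> carrier G"
    and M_v: "x \<in> carrier G \<Longrightarrow> M v x = (chi x)\<^sup>2" and sp_v: "sp v = 1" and chi_v: "chi v = 1"
    and M_c: "x \<in> carrier G \<Longrightarrow> M c x = 1" and sp_c: "sp c = -1" and chi_c: "chi c = -1"
    and chi_a: "chi a = cis (pi / real q)"
    and q: "q > 0"
begin

definition \<omega> :: complex where "\<omega> = cis (2 * pi / real q)"

lemma omega_power: "\<omega> ^ k = cis (2 * pi * real k / real q)"
  by (simp add: \<omega>_def DeMoivre mult_ac)

lemma omega_q: "\<omega> ^ q = 1"
  using q by (simp add: \<omega>_def DeMoivre)

lemma inj_on_omega: "inj_on (\<lambda>k. \<omega> ^ k) {..<q}"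
  using inj_on_cis_roots[OF q] by (simp add: omega_power)

lemma sp_nonzero: "x \<in> carrier G \<Longrightarrow> sp x \<noteq> 0"
  using sp_norm by force

lemma M_mult': "x \<in> carrier G \<Longrightarrow> y \<in> carrier G \<Longrightarrow> z \<in> carrier G \<Longrightarrow> M (y \<otimes> z) x = M y x * M z x"
  using M_mult M_sym by simp

lemma M_one [simp]: assumes "x \<in> carrier G" shows "M x \<one> = 1" "M \<one> x = 1"
proof -
  have "sp x = M x \<one> * sp x * sp \<one>" using sp_mult[OF assms one_closed] assms by simp
  then have "M x \<one> \<noteq> 0" using sp_nonzero[OF assms] by auto
  moreover have "M x \<one> = M x \<one> * M x \<one>" using M_mult[OF assms one_closed one_closed] by simp
  ultimately show "M x \<one> = 1" by simp
  then show "M \<one> x = 1" using M_sym assms by simp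
qed

lemma sp_one [simp]: "sp \<one> = 1"
  using sp_mult[OF one_closed one_closed] sp_nonzero[OF one_closed] by simp

lemma chi_one [simp]: "chi \<one> = 1"
  using chi_mult[OF one_closed one_closed] chi_norm[OF one_closed] by force

lemma chi_pow: "x \<in> carrier G \<Longrightarrow> chi (x [^] (n::nat)) = chi x ^ n"
  by (induction n) (simp_all add: chi_mult)

lemma M_pow: "x \<in> carrier G \<Longrightarrow> y \<in> carrier G \<Longrightarrow> M x (y [^] (n::nat)) = M x y ^ n"
  by (induction n) (simp_all add: M_mult)

lemma M_pow': "x \<in> carrier G \<Longrightarrow> y \<in> carrier G \<Longrightarrow> M (x [^] (n::nat)) y = M x y ^ n"
  using M_pow[of y x n] M_sym by simp

text \<open>The spin is a quadratic form: the induction step is the expansion of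
  \<open>(n + 1)^2\<close>, whose middle term is the braiding of \<open>x [^] n\<close> with
  \<open>x\<close>, namely \<open>sp x ^ (2 * n)\<close>.\<close>

lemma sp_pow: "x \<in> carrier G \<Longrightarrow> sp (x [^] (n::nat)) = sp x ^ n\<^sup>2"
  by (induction n)
    (simp_all add: sp_mult M_pow' M_self power2_eq_square algebra_simps flip: power_add power_mult)

definition word :: "nat \<times> nat \<times> nat \<Rightarrow> 'a" where
  "word = (\<lambda>(j, k, l). a [^] j \<otimes> v [^] k \<otimes> c [^] l)"

definition box :: "(nat \<times> nat \<times> nat) set" where
  "box = {..<q} \<times> {..<q} \<times> {..<2}"

lemma card_box: "card box = 2 * q\<^sup>2" and finite_box: "finite box"
  by (simp_all add: box_def card_cartesian_product power2_eq_square)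

lemma word_closed: "word p \<in> carrier G"
  by (cases p) (simp add: word_def vac)

text \<open>The charge \<open>j / q + l\<close> is written as a fraction of a full turn over
  \<open>2 * q\<close> because \<open>j + q * l\<close> is a positional expansion: on
  \<open>box\<close> it takes each value below \<open>2 * q\<close> for exactly one pair of
  \<open>j\<close> and \<open>l\<close>. So \<open>chi\<close> determines both digits.\<close>

lemma chi_word: "chi (word (j, k, l)) = cis (2 * pi * real (j + q * l) / real (2 * q))"
proof -
  have "chi (word (j, k, l)) = cis (real j * (pi / real q)) * cis pi ^ l"
    by (simp add: word_def vac chi_mult chi_pow chi_a chi_v chi_c DeMoivre)
  also have "\<dots> = cis (real j * (pi / real q) + real l * pi)"
    unfolding DeMoivre cis_mult ..
  also have "real j * (pi / real q) + real l * pi = 2 * pi * real (j + q * l) / real (2 * q)"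
    using q by (simp add: field_simps)
  finally show ?thesis .
qed

lemma chi_word_eqD:
  assumes "(j, k, l) \<in> box" "(j', k', l') \<in> box" "chi (word (j, k, l)) = chi (word (j', k', l'))"
  shows "j = j'" "l = l'"
proof -
  have *: "l = 0 \<or> l = 1" "l' = 0 \<or> l' = 1" "j < q" "j' < q" using assms by (auto simp: box_def)
  then have "j + q * l \<in> {..<2 * q}" "j' + q * l' \<in> {..<2 * q}" by auto
  then have "j + q * l = j' + q * l'"
    using inj_onD[OF inj_on_cis_roots[of "2 * q"], of "j + q * l" "j' + q * l'"] q assms(3)
    unfolding chi_word by simp
  then show "j = j'" "l = l'" using * by auto
qed

lemma inj_on_word: "inj_on word box"
proof (rule inj_onI)
  fix p p' assume p: "p \<in> box" "p' \<in> box" "word p = word p'"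
  obtain j k l j' k' l' where pp: "p = (j, k, l)" "p' = (j', k', l')" by (metis prod_cases3)
  then have jl: "j = j'" "l = l'" using chi_word_eqD[of j k l j' k' l'] p by auto
  then have "v [^] k = v [^] k'"
    using p(3) vac by (simp add: pp word_def)
  then have "\<omega> ^ k = \<omega> ^ k'"
    using M_pow'[OF vac(1,2), of k] M_pow'[OF vac(1,2), of k'] M_v[OF vac(2)]
    by (simp add: chi_a \<omega>_def DeMoivre mult_ac)
  then have "k = k'" using inj_onD[OF inj_on_omega] p by (auto simp: pp box_def)
  then show "p = p'" using jl pp by simp
qed

lemma card_ge: "finite (carrier G) \<Longrightarrow> 2 * q\<^sup>2 \<le> card (carrier G)"
  using card_inj_on_le[OF inj_on_word image_subsetI[OF word_closed]] card_box by simp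

end

section \<open>Metric groups of minimal order\<close>

lemma pow_eq_one_mod:
  fixes G (structure)
  assumes "group G" "x \<in> carrier G" "x [^] n = \<one>"
  shows "x [^] (m mod n) = x [^] (m::nat)"
proof -
  interpret group G by fact
  have "x [^] m = x [^] (n * (m div n) + m mod n)" by simp
  also have "\<dots> = (x [^] n) [^] (m div n) \<otimes> x [^] (m mod n)"
    using assms(2) by (simp add: nat_pow_mult nat_pow_pow)
  finally show ?thesis using assms by simp
qed

text \<open>The element \<open>t\<close> stands for the time reversal of \<open>a\<close>, recorded
  by its charge and its conjugated spin.\<close>

locale minimal_metric_group = metric_group +
  fixes t :: 'a
  assumes fin: "finite (carrier G)" and card_le: "card (carrier G) \<le> 2 * q\<^sup>2"
    and nondegenerate: "x \<in> carrier G \<Longrightarrow> (\<And>y. y \<in> carrier G \<Longrightarrow> M x y = 1) \<Longrightarrow> x = \<one> \<or> x = c"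
    and t: "t \<in> carrier G" "chi t = chi a" "sp t = cnj (sp a)"
    and odd_q: "odd q"
begin

lemma carrier_eq: "carrier G = word ` box"
  using card_subset_eq[of "carrier G" "word ` box"] fin card_le word_closed card_box
    card_image[OF inj_on_word] card_mono[OF fin, of "word ` box"] by fastforce

lemma chi_power_2q: "x \<in> carrier G \<Longrightarrow> chi x ^ (2 * q) = 1"
  unfolding carrier_eq
proof (elim imageE)
  fix p assume "x = word p"
  then show "chi x ^ (2 * q) = 1"
    using cis_rational_power[of "2 * q"] q by (cases p) (simp only: chi_word)
qed

text \<open>\<open>v [^] q\<close> braids with \<open>y\<close> by
  \<open>chi y ^ (2 * q) = 1\<close>, since every charge is a multiple of \<open>1 / q\<close>. It
  is therefore \<open>\<one>\<close> or \<open>c\<close>, and being neutral it is not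
  \<open>c\<close>.\<close>

lemma v_order: "v [^] q = \<one>"
proof -
  have "v [^] q = \<one> \<or> v [^] q = c"
    using M_pow' M_v chi_power_2q vac by (intro nondegenerate) (simp_all flip: power_mult)
  moreover have "chi (v [^] q) = 1" by (simp add: chi_pow vac chi_v)
  ultimately show ?thesis using chi_c by auto
qed

lemma c_order: "c [^] (2::nat) = \<one>"
proof -
  have "c [^] (2::nat) = \<one> \<or> c [^] (2::nat) = c"
    using M_pow' M_c vac by (intro nondegenerate) simp_all
  moreover have "chi (c [^] (2::nat)) = 1" by (simp add: chi_pow vac chi_c)
  ultimately show ?thesis using chi_c by auto
qed

lemma ex_boson: "\<exists>b\<in>carrier G. sp b = 1 \<and> M v b = \<omega>"
proof -
  \<comment> \<open>This quotient is neutral, and the only neutral words in \<open>box\<close> are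
    powers of \<open>v\<close>.\<close>
  define x where "x = t \<otimes> inv a"
  have x: "x \<in> carrier G" "x \<otimes> a = t" using t vac by (auto simp: x_def m_assoc)
  have "chi x * chi a = chi a" using chi_mult[of x a] x vac t by simp
  then have chi_x: "chi x = 1" using chi_norm[OF vac(2)] by auto
  obtain j k l where jkl: "x = word (j, k, l)" "(j, k, l) \<in> box" using x carrier_eq by auto
  have "(0, 0, 0) \<in> box" using q by (simp add: box_def)
  moreover have "chi (word (0, 0, 0)) = 1" by (simp add: word_def)
  ultimately have "j = 0" "l = 0"
    using chi_word_eqD[OF jkl(2), of 0 0 0] chi_x jkl by auto
  then have "t = v [^] k \<otimes> a" using x jkl vac by (simp add: word_def)
  moreover have M_va: "M (v [^] n) a = \<omega> ^ n" for n :: nat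
    using M_v[OF vac(2)] vac by (simp add: M_pow' chi_a \<omega>_def DeMoivre)
  moreover have sp_vn: "sp (v [^] n) = 1" for n :: nat by (simp add: sp_pow vac sp_v)
  ultimately have "cnj (sp a) = \<omega> ^ k * sp a"
    using t(3) sp_mult[of "v [^] k" a] vac by simp
  moreover have "cnj (sp a) * sp a = 1"
    using sp_norm[OF vac(2)] complex_norm_square[of "sp a"] by (simp add: mult.commute)
  ultimately have 1: "\<omega> ^ k * (sp a)\<^sup>2 = 1" by (simp add: power2_eq_square mult.assoc)
  \<comment> \<open>\<open>(q + 1) div 2\<close> is the inverse of 2 modulo the odd number
    \<open>q\<close>, so \<open>2 * m\<close> is \<open>k\<close> modulo \<open>q\<close>.
    Multiplying \<open>a\<close> by \<open>v [^] m\<close> thus cancels half of the phase and makes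
    the squared spin 1.\<close>
  define m where "m = k * ((q + 1) div 2)"
  have "2 * m = k * q + k" using odd_q by (auto simp: m_def elim!: oddE)
  define y where "y = v [^] m \<otimes> a"
  have y: "y \<in> carrier G" using vac by (simp add: y_def)
  have "sp y = \<omega> ^ m * sp a" using sp_mult[of "v [^] m" a] M_va sp_vn vac by (simp add: y_def)
  then have "(sp y)\<^sup>2 = \<omega> ^ (2 * m) * (sp a)\<^sup>2" by (simp add: power_mult_distrib power_mult mult.commute flip: power_mult)
  also have "\<dots> = (\<omega> ^ q) ^ k * (\<omega> ^ k * (sp a)\<^sup>2)"
    unfolding \<open>2 * m = k * q + k\<close> by (simp add: power_add mult.commute flip: power_mult)
  also have "\<dots> = 1" using 1 omega_q by simp
  finally have "sp y = 1 \<or> sp y = -1" by (simp add: power2_eq_1_iff)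
  moreover have My: "M v y = \<omega>"
    using M_va[of 1] M_self[OF vac(1)] M_pow[OF vac(1) vac(1)] vac sp_v by (simp add: y_def M_mult)
  \<comment> \<open>If \<open>y\<close> has spin -1, fusing with the fermion flips the sign and, as
    \<open>c\<close> is transparent, leaves the braiding with \<open>v\<close> unchanged.\<close>
  moreover have "sp (c \<otimes> y) = - sp y" using sp_mult[of c y] M_c y vac sp_c by simp
  moreover have "M v (c \<otimes> y) = \<omega>"
    using M_mult[of v c y] M_c[OF vac(1)] M_sym[of v c] vac y My by simp
  moreover have "c \<otimes> y \<in> carrier G" using vac y by simp
  ultimately show ?thesis using y by (metis minus_minus)
qed

text \<open>\<open>b\<close> and \<open>v\<close> are bosons with trivial self-braiding and mutual
  braiding \<omega>, the hyperbolic pair of the gauge theory. Once their orders are known to divide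
  \<open>q\<close>, sending \<open>(r, s, k)\<close> to \<open>b^r v^s c^k\<close> is a
  homomorphism. Braiding with \<open>v\<close> reads off \<open>r\<close>, braiding with
  \<open>b\<close> reads off \<open>s\<close>, and the spin then reads off \<open>k\<close>;
  injectivity and the bound on the order give bijectivity.\<close>

theorem gauge_theory:
  "\<exists>h \<in> iso G (gauge_group q). (\<forall>x\<in>carrier G. gauge_spin q (h x) = sp x) \<and> h c = (0, 0, 1)"
proof -
  obtain b where b: "b \<in> carrier G" "sp b = 1" "M v b = \<omega>" using ex_boson by blast
  have Mbb: "M b b = 1" using M_self b by simp
  have Mbv: "M b v = \<omega>" "M b c = 1" using M_sym b vac M_c by auto
  have Mvc: "M v c = 1" "M v v = 1" using M_sym[of v c] M_c M_self sp_v vac by auto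
  obtain j k l where jkl: "b = word (j, k, l)" "(j, k, l) \<in> box" using b carrier_eq by auto
  \<comment> \<open>The aim is that \<open>b [^] q\<close> is transparent. Braiding \<open>b\<close>
    with \<open>v\<close> and \<open>c\<close> gives \<omega> and 1. For \<open>a\<close>, one
    factor in \<open>M b b = 1\<close> is expanded as \<open>a v^k c^l\<close>, whence
    \<open>M b a * \<omega> ^ k = 1\<close>.\<close>
  have Mbq: "M b x ^ q = 1" if "x \<in> carrier G" for x
  proof -
    have "chi b ^ 2 = \<omega>" using b M_v by simp
    have va: "M v a = \<omega>" using M_v[OF vac(2)] by (simp add: chi_a \<omega>_def DeMoivre)
    have "\<omega> = \<omega> ^ j"
      using b(3) jkl vac Mvc va by (simp add: word_def M_mult M_pow)
    \<comment> \<open>For \<open>q = 1\<close> the root \<omega> is 1 and does not determine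
      \<open>j\<close>; the group then consists of \<open>\<one>\<close> and \<open>c\<close> only
      and is treated apart.\<close>
    then have j: "q = 1 \<or> j = 1"
      using inj_onD[OF inj_on_omega, of 1 j] jkl(2) q by (cases "q = 1") (auto simp: box_def)
    have "M b a ^ q = 1"
    proof (cases "q = 1")
      case True
      have "a = word (0,0,0) \<or> a = word (0,0,1)"
        using vac(2) unfolding carrier_eq box_def unfolding True by (auto simp: less_2_cases_iff)
      then have "a = \<one> \<or> a = c" using vac by (auto simp: word_def)
      then show ?thesis using b Mbv by auto
    next
      case False
      then have "1 = M b a * \<omega> ^ k"
        using Mbb b(1) j vac Mbv arg_cong[OF jkl(1), of "M b"]
        by (simp add: word_def M_mult M_pow)
      then have "1 = M b a ^ q * (\<omega> ^ q) ^ k"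
        by (metis power_mult_distrib power_one power_mult mult.commute)
      then show ?thesis using omega_q by simp
    qed
    moreover obtain j' k' l' where "x = word (j', k', l')"
      using \<open>x \<in> carrier G\<close> unfolding carrier_eq by auto
    ultimately show ?thesis
      using omega_q b vac Mbv
      by (simp add: word_def M_mult M_pow power_mult_distrib)
        (metis power_mult mult.commute power_one mult_1)
  qed
  have b_order: "b [^] q = \<one>"
  proof -
    have "b [^] q = \<one> \<or> b [^] q = c"
      using M_pow' Mbq b by (intro nondegenerate) simp_all
    moreover have "sp (b [^] q) = 1" by (simp add: sp_pow b)
    ultimately show ?thesis using sp_c by auto
  qed
  define F where "F = (\<lambda>(r, s, k). b [^] nat r \<otimes> v [^] nat s \<otimes> c [^] nat k)"
  have F_closed: "F p \<in> carrier G" for p using b vac by (cases p) (simp add: F_def)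
  have carr: "carrier (gauge_group q) = {0..<int q} \<times> {0..<int q} \<times> {0..<2}"
    using q by (simp add: gauge_group_def carrier_integer_mod_group)
  have mult: "(r, s, k) \<otimes>\<^bsub>gauge_group q\<^esub> (r', s', k') = ((r + r') mod int q, (s + s') mod int q, (k + k') mod 2)"
    for r s k r' s' k'
    by (simp add: gauge_group_def)
  have pow_add: "x [^] nat ((m + n) mod int i) = x [^] nat m \<otimes> x [^] nat n"
    if "x \<in> carrier G" "x [^] i = \<one>" "m \<ge> 0" "n \<ge> 0" for x i m n
  proof -
    have "nat ((m + n) mod int i) = (nat m + nat n) mod i"
      using that by (simp add: nat_mod_distrib nat_add_distrib)
    then show ?thesis using pow_eq_one_mod[OF is_group that(1,2)] that(1) by (simp add: nat_pow_mult)
  qed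
  have F_hom: "F \<in> hom (gauge_group q) G"
  proof (rule homI)
    fix x y assume xy: "x \<in> carrier (gauge_group q)" "y \<in> carrier (gauge_group q)"
    obtain r s k r' s' k' where [simp]: "x = (r, s, k)" "y = (r', s', k')" by (metis prod_cases3)
    have pos: "r \<ge> 0" "s \<ge> 0" "k \<ge> 0" "r' \<ge> 0" "s' \<ge> 0" "k' \<ge> 0" using xy carr by auto
    have "F (x \<otimes>\<^bsub>gauge_group q\<^esub> y)
        = (b [^] nat r \<otimes> b [^] nat r') \<otimes> (v [^] nat s \<otimes> v [^] nat s') \<otimes> (c [^] nat k \<otimes> c [^] nat k')"
      using pow_add[OF b(1) b_order pos(1,4)] pow_add[OF vac(1) v_order pos(2,5)]
        pow_add[of c 2, OF vac(3) c_order pos(3,6)]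
      by (simp add: mult F_def)
    also have "\<dots> = F x \<otimes> F y" using b vac by (simp add: F_def m_ac)
    finally show "F (x \<otimes>\<^bsub>gauge_group q\<^esub> y) = F x \<otimes> F y" .
  qed (use F_closed in auto)
  have M_vF: "M v (F (r, s, k)) = \<omega> ^ nat r" and M_bF: "M b (F (r, s, k)) = \<omega> ^ nat s"
    and sp_F: "sp (F (r, s, k)) = \<omega> ^ (nat r * nat s) * (-1) ^ (nat k)\<^sup>2" for r s k
    using b vac Mbb Mbv Mvc
    by (simp_all add: F_def M_mult M_mult' M_pow M_pow' sp_mult sp_pow sp_v sp_c M_c M_sym[of _ c]
        flip: power_mult)
  have F_inj: "inj_on F (carrier (gauge_group q))"
  proof (rule inj_onI)
    fix x y assume xy: "x \<in> carrier (gauge_group q)" "y \<in> carrier (gauge_group q)" "F x = F y"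
    obtain r s k r' s' k' where [simp]: "x = (r, s, k)" "y = (r', s', k')" by (metis prod_cases3)
    have bd: "0 \<le> r" "0 \<le> s" "0 \<le> k" "0 \<le> r'" "0 \<le> s'" "0 \<le> k'" "r < q" "s < q" "r' < q" "s' < q" "k < 2" "k' < 2"
      using xy carr by auto
    have "\<omega> ^ nat r = \<omega> ^ nat r'" "\<omega> ^ nat s = \<omega> ^ nat s'"
      using M_vF M_bF xy(3) by (metis \<open>x = _\<close> \<open>y = _\<close>)+
    then have rs: "nat r = nat r'" "nat s = nat s'"
      using inj_onD[OF inj_on_omega, of "nat r" "nat r'"] inj_onD[OF inj_on_omega, of "nat s" "nat s'"] bd
      by auto
    moreover have "sp (F x) = sp (F y)" using xy by simp
    ultimately have "(-1::complex) ^ (nat k)\<^sup>2 = (-1) ^ (nat k')\<^sup>2"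
      by (simp add: sp_F \<omega>_def)
    moreover have "k = 0 \<or> k = 1" "k' = 0 \<or> k' = 1" using bd by auto
    ultimately have "k = k'" by auto
    then show "x = y" using rs bd by (simp add: nat_eq_iff2)
  qed
  have "card (F ` carrier (gauge_group q)) = 2 * q\<^sup>2"
    unfolding card_image[OF F_inj] unfolding carr by (simp add: card_cartesian_product power2_eq_square)
  then have "F ` carrier (gauge_group q) = carrier G"
    using card_le fin F_closed by (intro card_seteq) auto
  then have F_iso: "F \<in> iso (gauge_group q) G" using F_hom F_inj by (simp add: iso_def bij_betw_def)
  have grp: "group (gauge_group q)"
    unfolding gauge_group_def by (intro DirProd_group group_integer_mod_group)
  define h where "h = inv_into (carrier (gauge_group q)) F"
  have hF: "h (F p) = p" if "p \<in> carrier (gauge_group q)" for p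
    using inv_into_f_f[OF F_inj that] by (simp add: h_def)
  have "h \<in> iso G (gauge_group q)"
    unfolding h_def using group.iso_set_sym[OF grp F_iso] .
  moreover have "gauge_spin q (h x) = sp x" if x: "x \<in> carrier G" for x
  proof -
    obtain r s k where p: "x = F (r, s, k)" "(r, s, k) \<in> carrier (gauge_group q)"
      using x \<open>F ` carrier (gauge_group q) = carrier G\<close> by (metis imageE prod_cases3)
    then have bd: "0 \<le> r" "0 \<le> s" "k = 0 \<or> k = 1" using carr by auto
    have "sp x = cis (2 * pi * of_int (r * s) / of_nat q) * (-1) ^ nat k"
      using bd by (auto simp: p(1) sp_F omega_power nat_mult_distrib)
    also have "\<dots> = gauge_spin q (r, s, k)"
      using bd(3) by (auto simp: gauge_spin_def simp flip: cis_mult)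
    finally show ?thesis using hF p by simp
  qed
  moreover have "h c = (0, 0, 1)"
    using hF[of "(0, 0, 1)"] carr q vac by (simp add: F_def)
  ultimately show ?thesis by blast
qed

end

section \<open>The gauge theory as an enriched order\<close>

context pointed_braiding
begin

interpretation br: unitary_braided_fusion_category PC
  by (rule braided_PC)

definition ob :: "'g \<Rightarrow> nat" where "ob g = set_encode {ix g}"

definition an :: "'g \<Rightarrow> nat set" where "an g = br.cls (ob g)"

lemma idx_ob [simp]: "idx (ob g) = {ix g}"
  by (simp add: ob_def)

lemma simple_ob [simp]: "simple PC (ob g)"
  by (auto simp: simple_PC_iff)

lemma isomorphic_ob: "isomorphic PC (ob g) (ob h) \<longleftrightarrow> g - h \<in> K"
  using isomorphic_PC_iff[of "ob g" "ix g" "ob h" "ix h"] K_sym by auto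

lemma an_eq_iff: "an g = an h \<longleftrightarrow> g - h \<in> K"
  unfolding an_def using br.cls_eq_iff[of "ob g" "ob h"] isomorphic_ob by simp

lemma simple_iso_ob: "idx X = {x} \<Longrightarrow> isomorphic PC X (ob (gr x))"
  using isomorphic_PC_iff[of X x "ob (gr x)" "ix (gr x)"] K_zero by simp

lemma an_in [simp]: "an g \<in> anyons PC"
  unfolding an_def by (rule br.cls_in) simp

lemma anyons_PC: "anyons PC = range an"
proof
  show "anyons PC \<subseteq> range an"
  proof
    fix a assume a: "a \<in> anyons PC"
    obtain x where x: "idx (rep a) = {x}" using br.rep_anyon(1)[OF a] by (auto simp: simple_PC_iff)
    then have "a = an (gr x)"
      unfolding an_def using simple_iso_ob[OF x] br.cls_eq_iff[of "rep a" "ob (gr x)"] br.rep_anyon[OF a] by simp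
    then show "a \<in> range an" by blast
  qed
qed auto

text \<open>The representative is chosen arbitrarily in its isomorphism class, so its grade is known
  only modulo \<open>K\<close>.\<close>

lemma rep_an: obtains x where "idx (rep (an g)) = {x}" "gr x - g \<in> K"
proof -
  obtain x where x: "idx (rep (an g)) = {x}" using br.rep_anyon(1)[OF an_in] by (auto simp: simple_PC_iff)
  have "isomorphic PC (rep (an g)) (ob g)" unfolding an_def by (rule br.rep_cls) simp
  then have "g - gr x \<in> K" using isomorphic_PC_iff[OF x, of "ob g" "ix g"] by simp
  then show ?thesis using that x K_sym by blast
qed

lemma rep_an_iso: "isomorphic PC (ob g) (rep (an g))"
  using br.isomorphic_sym[OF _ _ br.rep_cls[of "ob g"]] by (simp add: an_def)

lemma otens_ob: "isomorphic PC (otens (ob g) (ob h)) (ob (g + h))"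
proof -
  have "idx (otens (ob g) (ob h)) = {pr (ix g) (ix h)}" by (auto simp: eq_pr_iff)
  from simple_iso_ob[OF this] show ?thesis by simp
qed

lemma invertible_ob: "br.invertible (ob g)"
proof -
  have "isomorphic PC (otens (ob g) (ob (- g))) ounit" "isomorphic PC (otens (ob (- g)) (ob g)) ounit"
    using otens_ob[of g "- g"] otens_ob[of "- g" g] by (simp_all add: ob_def ounit_def)
  then show ?thesis unfolding br.invertible_def by auto
qed

lemma an_Pic [simp]: "an g \<in> carrier br.Pic"
  unfolding an_def by (rule br.cls_in_Pic[OF invertible_ob])

lemma abelian_an: "abelian PC (an g)"
  using br.Pic_iff_abelian[of "an g"] by simp

lemma an_mult: "br.cls (otens (rep (an g)) (rep (an h))) = an (g + h)"
proof -
  have "isomorphic PC (otens (ob g) (ob h)) (otens (rep (an g)) (rep (an h)))"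
    using br.isomorphic_tens[OF _ _ _ _ rep_an_iso rep_an_iso] by simp
  moreover have "simple PC (otens (ob g) (ob h))"
    using br.simple_tens_invertible[OF invertible_ob, of "ob h" g] by simp
  moreover have "simple PC (otens (rep (an g)) (rep (an h)))"
    using br.rep_mult_iso(3)[of "an g" "an h"] by simp
  ultimately show ?thesis
    unfolding an_def[of "g + h"]
    using br.cls_eq_iff[of "otens (ob g) (ob h)" "otens (rep (an g)) (rep (an h))"]
      br.cls_eq_iff[of "otens (ob g) (ob h)" "ob (g + h)"] otens_ob[of g h] simple_ob by simp
qed

lemma occurs_in_an: "occurs_in PC (an k) (an g) (an h) \<longleftrightarrow> k - (g + h) \<in> K"
  using br.occurs_in_iff[of "an g" "an h" "an k"] an_mult an_eq_iff by simp

lemma vacuum_PC: "vacuum PC = an 0"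
  by (simp add: br.vacuum_eq an_def ob_def ounit_def)

lemma spin_an: "spin PC (an g) = \<beta> g g"
proof -
  have "br.twisted (ob g) (\<beta> g g)"
    unfolding br.twisted_def br.tw_def br.ascale_def br.aid_def PC_structure
    by (auto simp: mon_def fun_eq_iff)
  then have "br.twisted (rep (an g)) (\<beta> g g)"
    using br.twisted_iso[OF _ _ rep_an_iso] by simp
  then show ?thesis
    using br.twisted_unique[OF _ br.spin_twisted[OF an_in]] br.rep_anyon(1)[OF an_in] by blast
qed

lemma mutual_an: "mutual PC (an g) (an h) = \<beta> g h * \<beta> h g"
proof -
  have "mcmp (braid PC (ob h) (ob g)) (braid PC (ob g) (ob h))
      = mon {p. p1 p = ix g \<and> p2 p = ix h} (\<lambda>p. p) (\<lambda>_. \<beta> h g * \<beta> g h)"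
    unfolding PC_structure mcmp_mon_mon by (rule mon_cong) (auto intro: eq_pr_iff[THEN iffD2, symmetric])
  also have "\<dots> = (\<lambda>i j. (\<beta> g h * \<beta> h g) * mid (otens (ob g) (ob h)) i j)"
    by (auto simp: mon_def fun_eq_iff)
  finally have "br.monodromy (ob g) (ob h) (\<beta> g h * \<beta> h g)"
    by (subst br.monodromy_mor) simp_all
  then have "br.monodromy (rep (an g)) (rep (an h)) (\<beta> g h * \<beta> h g)"
    using br.monodromy_iso[OF _ _ _ rep_an_iso rep_an_iso] by simp
  then show ?thesis
    using br.monodromy_unique[OF br.rep_mult_iso(3)] br.Pic_monodromy an_Pic an_in by blast
qed

section \<open>Comparison of fusion multiplicities\<close>

lemma ghom_single_eta:
  assumes "f \<in> ghom X Y" "idx X = {x}" "idx Y = {y}"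
  shows "(\<lambda>i j. if i = y \<and> j = x then f y x else 0) = f"
  using ghom_zero[OF assms(1)] assms(2,3) by (intro ext) auto

text \<open>The predicate under the definite description in \<open>hom_dim\<close>. Two hom spaces
  satisfying it for the same \<open>n\<close> have equal \<open>hom_dim\<close>, so fusion
  multiplicities can be compared without being computed.\<close>

definition has_hom_dim :: "nat \<Rightarrow> nat \<Rightarrow> nat \<Rightarrow> bool" where
  "has_hom_dim X Y n \<longleftrightarrow> (\<exists>\<phi> :: mat \<Rightarrow> nat \<Rightarrow> complex.
     bij_betw \<phi> (ghom X Y) {u. \<forall>i\<ge>n. u i = 0} \<and>
     (\<forall>f\<in>ghom X Y. \<forall>g\<in>ghom X Y. \<forall>i. \<phi> (\<lambda>a b. f a b + g a b) i = \<phi> f i + \<phi> g i) \<and>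
     (\<forall>f\<in>ghom X Y. \<forall>k. \<forall>i. \<phi> (\<lambda>a b. k * f a b) i = k * \<phi> f i))"

text \<open>Both hom spaces are lines, or both are zero; moving the only entry from one position to
  the other is a linear bijection to compose with.\<close>

lemma has_hom_dim_transfer:
  assumes "has_hom_dim X Y n" and st: "idx X = {x}" "idx Y = {y}" "idx X' = {x'}" "idx Y' = {y'}"
    and K: "gr y - gr x \<in> K \<longleftrightarrow> gr y' - gr x' \<in> K"
  shows "has_hom_dim X' Y' n"
proof -
  from assms(1) obtain \<phi> where "bij_betw \<phi> (ghom X Y) {u. \<forall>i\<ge>n. u i = 0} \<and>
    (\<forall>f\<in>ghom X Y. \<forall>g\<in>ghom X Y. \<forall>i. \<phi> (\<lambda>a b. f a b + g a b) i = \<phi> f i + \<phi> g i) \<and>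
    (\<forall>f\<in>ghom X Y. \<forall>k. \<forall>i. \<phi> (\<lambda>a b. k * f a b) i = k * \<phi> f i)"
    unfolding has_hom_dim_def ..
  then have \<phi>: "bij_betw \<phi> (ghom X Y) {u. \<forall>i\<ge>n. u i = 0}"
    "\<And>f g i. f \<in> ghom X Y \<Longrightarrow> g \<in> ghom X Y \<Longrightarrow> \<phi> (\<lambda>a b. f a b + g a b) i = \<phi> f i + \<phi> g i"
    "\<And>f k i. f \<in> ghom X Y \<Longrightarrow> \<phi> (\<lambda>a b. k * f a b) i = k * \<phi> f i"
    by simp_all
  define \<psi> :: "mat \<Rightarrow> mat" where "\<psi> f = (\<lambda>i j. if i = y \<and> j = x then f y' x' else 0)" for f
  define \<psi>' :: "mat \<Rightarrow> mat" where "\<psi>' f = (\<lambda>i j. if i = y' \<and> j = x' then f y x else 0)" for f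
  have in1: "\<psi> f \<in> ghom X Y" if "f \<in> ghom X' Y'" for f
    using ghomD[OF that, of y' x'] K st by (auto simp: ghom_def \<psi>_def split: if_splits)
  have in2: "\<psi>' f \<in> ghom X' Y'" if "f \<in> ghom X Y" for f
    using ghomD[OF that, of y x] K st by (auto simp: ghom_def \<psi>'_def split: if_splits)
  have \<psi>: "bij_betw \<psi> (ghom X' Y') (ghom X Y)"
  proof (rule bij_betwI[where g = \<psi>'])
    show "\<psi>' (\<psi> f) = f" if "f \<in> ghom X' Y'" for f
      using ghom_single_eta[OF that st(3,4)] by (simp add: \<psi>_def \<psi>'_def)
    show "\<psi> (\<psi>' f) = f" if "f \<in> ghom X Y" for f
      using ghom_single_eta[OF that st(1,2)] by (simp add: \<psi>_def \<psi>'_def)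
  qed (use in1 in2 in auto)
  have lin: "\<psi> (\<lambda>a b. f a b + g a b) = (\<lambda>a b. \<psi> f a b + \<psi> g a b)"
    "\<psi> (\<lambda>a b. k * f a b) = (\<lambda>a b. k * \<psi> f a b)" for f g k
    unfolding \<psi>_def by (intro ext; simp)+
  show ?thesis
    unfolding has_hom_dim_def
  proof (intro exI[of _ "\<phi> \<circ> \<psi>"] conjI ballI allI)
    show "bij_betw (\<phi> \<circ> \<psi>) (ghom X' Y') {u. \<forall>i\<ge>n. u i = 0}"
      using bij_betw_trans[OF \<psi> \<phi>(1)] .
    show "(\<phi> \<circ> \<psi>) (\<lambda>a b. f a b + g a b) i = (\<phi> \<circ> \<psi>) f i + (\<phi> \<circ> \<psi>) g i"
      if "f \<in> ghom X' Y'" "g \<in> ghom X' Y'" for f g i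
      unfolding o_apply lin(1) using \<phi>(2)[OF in1 in1] that by blast
    show "(\<phi> \<circ> \<psi>) (\<lambda>a b. k * f a b) i = k * (\<phi> \<circ> \<psi>) f i" if "f \<in> ghom X' Y'" for f k i
      unfolding o_apply lin(2) using \<phi>(3)[OF in1] that by blast
  qed
qed

lemma hom_dim_cong:
  assumes "idx X = {x}" "idx Y = {y}" "idx X' = {x'}" "idx Y' = {y'}" "gr y - gr x \<in> K \<longleftrightarrow> gr y' - gr x' \<in> K"
  shows "hom_dim PC X Y = hom_dim PC X' Y'"
proof -
  have "has_hom_dim X Y n \<longleftrightarrow> has_hom_dim X' Y' n" for n
    using has_hom_dim_transfer[OF _ assms] has_hom_dim_transfer[OF _ assms(3,4,1,2) assms(5)[symmetric]]
    by blast
  moreover have "hom_dim PC X Y = (THE n. has_hom_dim X Y n)" for X Y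
    unfolding hom_dim_def has_hom_dim_def PC_simps ..
  ultimately show ?thesis by simp
qed

text \<open>Reduces preservation of fusion by a permutation of anyons to an equivalence about
  grades, which is immediate for a map induced by an additive map of grades that respects
  \<open>K\<close>.\<close>

lemma fusion_an_cong:
  assumes "k - (g + h) \<in> K \<longleftrightarrow> k' - (g' + h') \<in> K"
  shows "fusion PC (an g) (an h) (an k) = fusion PC (an g') (an h') (an k')"
proof -
  have *: "\<exists>a b. idx (rep (an k)) = {a} \<and> idx (otens (rep (an g)) (rep (an h))) = {b} \<and>
      (gr b - gr a \<in> K \<longleftrightarrow> k - (g + h) \<in> K)" for g h k
  proof -
    obtain a where a: "idx (rep (an k)) = {a}" "gr a - k \<in> K" by (rule rep_an)
    obtain x where x: "idx (rep (an g)) = {x}" "gr x - g \<in> K" by (rule rep_an)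
    obtain y where y: "idx (rep (an h)) = {y}" "gr y - h \<in> K" by (rule rep_an)
    have xy: "idx (otens (rep (an g)) (rep (an h))) = {pr x y}" using x y by (auto simp: eq_pr_iff)
    have "gr (pr x y) - (g + h) \<in> K" using K_add_cong[OF x(2) y(2)] by simp
    then have "gr (pr x y) - gr a \<in> K \<longleftrightarrow> k - (g + h) \<in> K"
      using a(2) K_trans[of "gr (pr x y)" "gr a" k] K_trans[of "gr (pr x y)" k "gr a"]
        K_trans[of k "gr (pr x y)" "g + h"] K_trans[of "gr (pr x y)" "g + h" k]
        K_sym[of "gr a" k] K_sym[of k "gr a"] K_sym[of "gr (pr x y)" k] K_sym[of k "g + h"] K_sym[of "g + h" k]
        K_sym[of k "gr (pr x y)"]
      by blast
    then show ?thesis using a(1) xy by (intro exI conjI)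
  qed
  obtain a b where 1: "idx (rep (an k)) = {a}" "idx (otens (rep (an g)) (rep (an h))) = {b}"
      "gr b - gr a \<in> K \<longleftrightarrow> k - (g + h) \<in> K" using *[of k g h] by blast
  obtain a' b' where 2: "idx (rep (an k')) = {a'}" "idx (otens (rep (an g')) (rep (an h'))) = {b'}"
      "gr b' - gr a' \<in> K \<longleftrightarrow> k' - (g' + h') \<in> K" using *[of k' g' h'] by blast
  show ?thesis unfolding fusion_def PC_simps
    using hom_dim_cong[OF 1(1,2) 2(1,2)] 1(3) 2(3) assms by blast
qed

end

section \<open>Indices graded by triples of integers\<close>

type_synonym grade = "int \<times> int \<times> int"

definition enc3 :: "grade \<Rightarrow> nat" where
  "enc3 = (\<lambda>(r, s, k). prod_encode (int_encode r, prod_encode (int_encode s, int_encode k)))"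

definition dec3 :: "nat \<Rightarrow> grade" where
  "dec3 n = (case prod_decode n of (r, m) \<Rightarrow> case prod_decode m of (s, k) \<Rightarrow>
     (int_decode r, int_decode s, int_decode k))"

lemma dec3_enc3 [simp]: "dec3 (enc3 g) = g"
  by (simp add: enc3_def dec3_def split: prod.split)

lemma enc3_dec3 [simp]: "enc3 (dec3 n) = n"
proof -
  obtain r s k where "n = prod_encode (r, prod_encode (s, k))"
    by (metis prod_decode_inverse surj_pair)
  then show ?thesis by (simp add: enc3_def dec3_def)
qed

text \<open>An index is a grade with a label. The labels provide infinitely many indices of each
  grade: pairs are encoded in the label, and the two summands of a direct sum are kept apart by its
  parity.\<close>

definition mk :: "grade \<Rightarrow> nat \<Rightarrow> nat" where "mk g m = prod_encode (enc3 g, m)"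

definition gr3 :: "nat \<Rightarrow> grade" where "gr3 i = dec3 (fst (prod_decode i))"

definition lb :: "nat \<Rightarrow> nat" where "lb i = snd (prod_decode i)"

lemma mk_simps [simp]: "gr3 (mk g m) = g" "lb (mk g m) = m" "mk (gr3 i) (lb i) = i"
  by (simp_all add: mk_def gr3_def lb_def)

lemma mk_eq_iff [simp]: "mk g m = mk h n \<longleftrightarrow> g = h \<and> m = n"
  by (metis mk_simps(1,2))

definition pr3 :: "nat \<Rightarrow> nat \<Rightarrow> nat" where
  "pr3 i j = mk (gr3 i + gr3 j) (prod_encode (i, lb j))"

definition fst3 :: "nat \<Rightarrow> nat" where "fst3 p = fst (prod_decode (lb p))"

text \<open>The grade of the second component is recovered by subtraction, which makes the pairing a
  bijection even though the grade of a pair is the sum of the grades.\<close>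

definition snd3 :: "nat \<Rightarrow> nat" where
  "snd3 p = mk (gr3 p - gr3 (fst3 p)) (snd (prod_decode (lb p)))"

definition dl3 :: "nat \<Rightarrow> nat" where "dl3 i = mk (- gr3 i) (lb i)"

definition cp3 :: "bool \<Rightarrow> nat \<Rightarrow> nat" where "cp3 b i = mk (gr3 i) (2 * lb i + of_bool b)"

text \<open>The quotient of the triples by this lattice is the group of the gauge theory. Working
  upstairs keeps one type of grades for all \<open>q\<close>.\<close>

definition K3 :: "nat \<Rightarrow> grade set" where
  "K3 q = {(r, s, k). int q dvd r \<and> int q dvd s \<and> even k}"

text \<open>Deliberately asymmetric: the diagonal gives \<open>r * s\<close> over \<open>q\<close>
  and a sign for odd \<open>k\<close>, as in \<open>gauge_spin\<close> because \<open>k * k\<close>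
  and \<open>k\<close> have equal parity, while symmetrising gives the full braiding of charges with
  fluxes.\<close>

definition \<beta>3 :: "nat \<Rightarrow> grade \<Rightarrow> grade \<Rightarrow> complex" where
  "\<beta>3 q = (\<lambda>(r, s, k) (r', s', k'). cis (2 * pi * of_int (r * s') / of_nat q + pi * of_int (k * k')))"

lemma cis_2pi_int: "cis (2 * pi * of_int n) = 1"
  by (rule cis_multiple_2pi) simp

lemma rcong_cis:
  assumes "[x = y] (rmod 2)" shows "cis (pi * x) = cis (pi * y)"
proof -
  obtain n where "y = x + of_int n * 2" using assms unfolding rcong_altdef by blast
  then have "pi * y = pi * x + 2 * pi * of_int n" by (simp add: algebra_simps)
  then have "cis (pi * y) = cis (pi * x) * cis (2 * pi * of_int n)" by (simp only: cis_mult)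
  then show ?thesis unfolding cis_2pi_int by simp
qed

lemma cis_pi_even: "even n \<Longrightarrow> cis (pi * of_int n) = 1"
  using cis_2pi_int by (auto elim!: evenE simp: mult_ac)

lemma cis_dvd:
  assumes "q > 0" "int q dvd n" shows "cis (2 * pi * of_int n / of_nat q) = 1"
proof -
  obtain m where "n = int q * m" using assms(2) by (auto simp: dvd_def)
  then have "2 * pi * of_int n / of_nat q = 2 * pi * of_int m" using assms(1) by simp
  then show ?thesis using cis_2pi_int[of m] by (simp only:)
qed

lemma K3_diff_iff: "(r, s, k) - (r', s', k') \<in> K3 q \<longleftrightarrow>
    int q dvd r - r' \<and> int q dvd s - s' \<and> even (k - k')"
  by (simp add: K3_def)

lemma \<beta>3_simp: "\<beta>3 q (r, s, k) (r', s', k')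
    = cis (2 * pi * of_int (r * s') / of_nat q) * cis (pi * of_int (k * k'))"
  by (simp add: \<beta>3_def cis_mult)

lemma pointed_gauge:
  assumes "q > 0"
  shows "pointed_braiding gr3 pr3 fst3 snd3 dl3 cp3 (\<lambda>g. mk g 0) (K3 q) (\<beta>3 q)"
proof
  show f: "fst3 (pr3 i j) = i" for i j by (simp add: fst3_def pr3_def)
  show "snd3 (pr3 i j) = j" for i j unfolding snd3_def f by (simp add: pr3_def)
  show "pr3 (fst3 i) (snd3 i) = i" for i by (simp add: pr3_def snd3_def) (simp add: fst3_def)
  show "gr3 i = gr3 (fst3 i) + gr3 (snd3 i)" for i by (simp add: snd3_def)
  show "gr3 (mk g 0) = g" for g by simp
  show "gr3 (dl3 i) = - gr3 i" "dl3 (dl3 i) = i" for i by (simp_all add: dl3_def)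
  show "gr3 (cp3 b i) = gr3 i" for b i by (simp add: cp3_def)
  show "b = b' \<and> i = i'" if "cp3 b i = cp3 b' i'" for b b' i i'
  proof -
    have gr: "gr3 i = gr3 i'" and lb: "2 * lb i + of_bool b = 2 * lb i' + of_bool b'"
      using that by (simp_all add: cp3_def)
    have "b = b'" using arg_cong[OF lb, of even] by (cases b; cases b') simp_all
    moreover from this lb have "lb i = lb i'" by simp
    then have "mk (gr3 i) (lb i) = mk (gr3 i') (lb i')" unfolding gr by simp
    then have "i = i'" unfolding mk_simps .
    ultimately show ?thesis by simp
  qed
  show "0 \<in> K3 q" by (simp add: K3_def zero_prod_def)
  show "x - y \<in> K3 q" if "x \<in> K3 q" "y \<in> K3 q" for x y using that by (auto simp: K3_def)
  show "\<exists>R. finite R \<and> (\<forall>g. \<exists>r\<in>R. g - r \<in> K3 q)"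
  proof (intro exI conjI allI)
    show "finite ({0..<int q} \<times> {0..<int q} \<times> {0..<2::int})" by simp
    fix g :: grade
    obtain r s k where g: "g = (r, s, k)" by (metis prod_cases3)
    show "\<exists>x\<in>{0..<int q} \<times> {0..<int q} \<times> {0..<2::int}. g - x \<in> K3 q"
      by (rule bexI[of _ "(r mod int q, s mod int q, k mod 2)"])
        (use assms dvd_minus_mod[of 2 k] in \<open>simp_all add: g K3_def dvd_minus_mod\<close>)
  qed
  show "\<beta>3 q (x + y) z = \<beta>3 q x z * \<beta>3 q y z" "\<beta>3 q x (y + z) = \<beta>3 q x y * \<beta>3 q x z" for x y z
    by (cases x; cases y; cases z;
        simp add: \<beta>3_def cis_mult distrib_left distrib_right add_divide_distrib add_ac)+
  show "norm (\<beta>3 q x y) = 1" for x y by (cases x; cases y; simp add: \<beta>3_def)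
  show "\<beta>3 q x y = 1" "\<beta>3 q y x = 1" if x: "x \<in> K3 q" for x y
  proof -
    obtain r s k r' s' k' where [simp]: "x = (r, s, k)" "y = (r', s', k')" by (metis prod_cases3)
    have "int q dvd r" "int q dvd s" "even k" using x by (auto simp: K3_def)
    then show "\<beta>3 q x y = 1" "\<beta>3 q y x = 1"
      using cis_dvd[OF assms, of "r * s'"] cis_dvd[OF assms, of "r' * s"]
        cis_pi_even[of "k * k'"] cis_pi_even[of "k' * k"]
      by (simp_all add: \<beta>3_simp)
  qed
qed

section \<open>Symmetry data on the gauge theory\<close>

locale gauge_competitor =
  fixes q :: nat
  assumes q: "q > 0" "odd q"
begin

sublocale pointed_braiding gr3 pr3 fst3 snd3 dl3 cp3 "\<lambda>g. mk g 0" "K3 q" "\<beta>3 q"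
  by (rule pointed_gauge[OF q(1)])

interpretation br: unitary_braided_fusion_category PC
  by (rule braided_PC)

text \<open>Unlike \<open>r / q\<close>, the charge \<open>r (q + 1) / q\<close> only depends on \<open>r\<close> modulo \<open>q\<close> when taken modulo 2,
  because \<open>q + 1\<close> is even.\<close>

definition qc :: "grade \<Rightarrow> real" where
  "qc = (\<lambda>(r, s, k). of_int r * (real q + 1) / real q + of_int k)"

text \<open>A chosen grade of an anyon, meaningful modulo \<open>K3 q\<close> only. Whatever is
  built from it must respect that: \<open>qc\<close> does so modulo 2, and \<open>flip\<close>
  preserves the lattice.\<close>

definition gd :: "nat set \<Rightarrow> grade" where "gd x = (SOME g. x = an g)"

text \<open>Negating \<open>s\<close> conjugates the phase of \<open>r * s\<close> and leaves the
  charge alone, which sees only \<open>r\<close> and \<open>k\<close>.\<close>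

definition flip :: "grade \<Rightarrow> grade" where "flip = (\<lambda>(r, s, k). (r, - s, k))"

text \<open>The background \<open>(1, 0, 1)\<close> has charge
  \<open>(q + 1) / q + 1 = 1 / q + 2\<close>; its fermion factor compensates the extra 1 in the
  charge of \<open>(1, 0, 0)\<close>. With \<open>s = 0\<close> it is fixed by \<open>flip\<close>,
  so time-reversal invariance of the background holds even though the trivial translations fix every
  anyon.\<close>

definition S :: "(nat, mat) SET_data" where
  "S = \<lparr>TO = PC, fermion = an (0, 0, 1), charge = (\<lambda>x. qc (gd x)), vison = an (0, 1, 0),
     background = an (1, 0, 1), time_rev = (\<lambda>x. an (flip (gd x))), transl_x = (\<lambda>x. x),
     transl_y = (\<lambda>x. x)\<rparr>"

lemma an_gd: "x \<in> anyons PC \<Longrightarrow> an (gd x) = x"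
  using someI_ex[of "\<lambda>g. x = an g"] unfolding gd_def[symmetric] anyons_PC by blast

lemma gd_an: "gd (an g) - g \<in> K3 q"
  using an_gd[OF an_in[of g]] an_eq_iff by blast

lemma qc_add: "qc (g + h) = qc g + qc h"
proof -
  obtain r s k r' s' k' where "g = (r, s, k)" "h = (r', s', k')" by (metis prod_cases3)
  then show ?thesis by (simp add: qc_def distrib_right add_divide_distrib)
qed

lemma qc_K: assumes "g \<in> K3 q" shows "[qc g = 0] (rmod 2)"
proof -
  obtain r s k where g: "g = (r, s, k)" by (metis prod_cases3)
  obtain m where m: "r = int q * m" using assms by (auto simp: g K3_def)
  obtain n where n: "k = 2 * n" using assms by (auto simp: g K3_def)
  have "even (q + 1)" using q(2) by simp
  then obtain l where l: "q + 1 = 2 * l" by (elim evenE)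
  have "qc g = of_int m * real (q + 1) + of_int k" using q by (simp add: qc_def g m)
  also have "\<dots> = of_int (m * int l + n) * 2" unfolding l n by (simp add: algebra_simps)
  finally have "0 = qc g + of_int (- (m * int l + n)) * 2" by simp
  then show ?thesis unfolding rcong_altdef by (rule exI)
qed

lemma qc_cong: assumes "g - h \<in> K3 q" shows "[qc g = qc h] (rmod 2)"
proof -
  have "[qc (g - h) + qc h = 0 + qc h] (rmod 2)" by (rule rcong_add[OF qc_K[OF assms] rcong_refl])
  then show ?thesis unfolding qc_add[symmetric] diff_add_cancel add_0 .
qed

lemma charge_an: "[qc (gd (an g)) = qc g] (rmod 2)"
  using qc_cong[OF gd_an] .

lemma rcong_cis2: "[x = y] (rmod 2) \<Longrightarrow> cis (2 * pi * x) = cis (2 * pi * y)"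
  using rcong_cis[of x y] DeMoivre[of "pi * x" 2] DeMoivre[of "pi * y" 2]
  by (simp add: mult.assoc)

lemma spin_S: "spin PC (an (r, s, k)) = cis (2 * pi * of_int (r * s) / of_nat q) * cis (pi * of_int (k * k))"
  unfolding spin_an \<beta>3_simp ..

text \<open>The fermionic contribution occurs once in each direction, so together it is a full
  turn.\<close>

lemma mutual_S: "mutual PC (an (r, s, k)) (an (r', s', k')) = cis (2 * pi * of_int (r * s' + r' * s) / of_nat q)"
proof -
  have "cis (pi * of_int (k * k')) * cis (pi * of_int (k' * k)) = cis (2 * pi * of_int (k * k'))"
  proof -
    have "pi * of_int (k * k') + pi * of_int (k' * k) = 2 * pi * of_int (k * k')" by simp
    then show ?thesis by (simp only: cis_mult)
  qed
  also have "\<dots> = 1" by (rule cis_2pi_int)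
  finally have *: "cis (pi * of_int (k * k')) * cis (pi * of_int (k' * k)) = 1" .
  have "mutual PC (an (r, s, k)) (an (r', s', k')) = (cis (2 * pi * of_int (r * s') / of_nat q) *
      cis (2 * pi * of_int (r' * s) / of_nat q)) * (cis (pi * of_int (k * k')) * cis (pi * of_int (k' * k)))"
    unfolding mutual_an \<beta>3_simp by (simp only: mult_ac)
  also have "\<dots> = cis (2 * pi * of_int (r * s' + r' * s) / of_nat q)"
  proof -
    have "2 * pi * of_int (r * s') / of_nat q + 2 * pi * of_int (r' * s) / of_nat q
        = 2 * pi * of_int (r * s' + r' * s) / (of_nat q :: real)"
      by (simp add: distrib_left add_divide_distrib)
    then show ?thesis unfolding * by (simp only: cis_mult mult_1_right)
  qed
  finally show ?thesis .
qed

lemma cis_eq_1_dvd: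
  assumes "cis (2 * pi * of_int n / of_nat q) = 1" shows "int q dvd n"
proof -
  have "cis 0 = cis (2 * pi * of_int n / of_nat q)" using assms by simp
  then obtain m where "2 * pi * of_int n / of_nat q = 0 + of_int m * (2 * pi)"
    unfolding cis_eq_iff rcong_altdef by blast
  then have "2 * pi * of_int n = 2 * pi * (of_int m * of_nat q)" using q by (simp add: field_simps)
  then have "of_int n = (of_int m * of_nat q :: real)" by simp
  then have "of_int n = (of_int (m * int q) :: real)" by simp
  then have "n = m * int q" by (simp only: of_int_eq_iff)
  then show ?thesis by simp
qed

lemma fermionic_S: "fermionic_TO PC (an (0, 0, 1))"
  unfolding fermionic_TO_def
proof (intro conjI braided_PC)
  show "{x \<in> anyons PC. \<forall>y\<in>anyons PC. braids_trivially PC x y} = {vacuum PC, an (0, 0, 1)}"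
  proof (intro equalityI subsetI)
    fix x assume x: "x \<in> {x \<in> anyons PC. \<forall>y\<in>anyons PC. braids_trivially PC x y}"
    then obtain r s k where xa: "x = an (r, s, k)" unfolding anyons_PC by auto
    have "mutual PC (an (r, s, k)) (an (r', s', k')) = 1" for r' s' k'
      using x an_in br.braids_trivially_iff[OF an_Pic an_in] unfolding xa by blast
    \<comment> \<open>Braiding with these two generators reads off \<open>r\<close> and
      \<open>s\<close> modulo \<open>q\<close>; \<open>k\<close> stays free, which leaves the vacuum
      and the fermion.\<close>
    from this[of 0 1 0] this[of 1 0 0] have "int q dvd r" "int q dvd s"
      using cis_eq_1_dvd[of r] cis_eq_1_dvd[of s] by (simp_all add: mutual_S)
    then have "x = an 0 \<or> x = an (0, 0, 1)"
      unfolding xa an_eq_iff zero_prod_def K3_diff_iff by auto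
    then show "x \<in> {vacuum PC, an (0, 0, 1)}" by (simp add: vacuum_PC)
  next
    fix x assume "x \<in> {vacuum PC, an (0, 0, 1)}"
    then obtain k where x: "x = an (0, 0, k)" by (auto simp: vacuum_PC zero_prod_def)
    have "braids_trivially PC x y" if "y \<in> anyons PC" for y
      using that br.braids_trivially_iff[OF an_Pic an_in] unfolding x anyons_PC
      by (auto simp: mutual_S)
    then show "x \<in> {x \<in> anyons PC. \<forall>y\<in>anyons PC. braids_trivially PC x y}" by (simp add: x)
  qed
  let ?c = "an (0, 0, 1)"
  have "br.cls (otens (rep ?c) (rep ?c)) = br.cls (ob 0)"
    unfolding an_mult unfolding an_def[symmetric] an_eq_iff by (simp add: K3_def)
  then have "isomorphic PC (otens (rep ?c) (rep ?c)) (ob 0)"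
    using br.cls_eq_iff[OF br.rep_mult_iso(3)[OF an_Pic an_in] simple_ob] by simp
  then show "isomorphic PC (tens_o PC (rep ?c) (rep ?c)) (unit_o PC)"
    by (simp add: ob_def ounit_def)
  show "spin PC ?c = cis pi" by (simp add: spin_S)
qed

lemma charge_S: "charge_assignment PC (an (0, 0, 1)) (\<lambda>x. qc (gd x))"
  unfolding charge_assignment_def
proof (intro conjI ballI impI)
  fix x y z assume "x \<in> anyons PC" "y \<in> anyons PC" "z \<in> anyons PC" and occ: "occurs_in PC z x y"
  then have "gd z - (gd x + gd y) \<in> K3 q" using occurs_in_an[of "gd z" "gd x" "gd y"] an_gd by simp
  from qc_cong[OF this] show "[qc (gd z) = qc (gd x) + qc (gd y)] (rmod 2)" by (simp add: qc_add)
next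
  show "[qc (gd (vacuum PC)) = 0] (rmod 2)" "[qc (gd (an (0, 0, 1))) = 1] (rmod 2)"
    using charge_an[of 0] charge_an[of "(0, 0, 1)"] by (simp_all add: vacuum_PC qc_def zero_prod_def)
qed

lemma anyons_ball: "(\<forall>x\<in>anyons PC. P x) \<longleftrightarrow> (\<forall>r s k. P (an (r, s, k)))"
  unfolding anyons_PC by auto

lemma vison_S: "is_vison PC (\<lambda>x. qc (gd x)) 0 (an (0, 1, 0))"
  unfolding is_vison_def
proof (intro conjI)
  show "\<forall>x\<in>anyons PC. mutual PC (an (0, 1, 0)) x = cis (2 * pi * qc (gd x))"
    unfolding anyons_ball
  proof (intro allI)
    fix r s k
    have "cis (2 * pi * qc (gd (an (r, s, k)))) = cis (2 * pi * qc (r, s, k))"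
      using rcong_cis2[OF charge_an] .
    also have "2 * pi * qc (r, s, k) = 2 * pi * of_int r / of_nat q + 2 * pi * of_int (r + k)"
      using q by (simp add: qc_def field_simps)
    finally show "mutual PC (an (0, 1, 0)) (an (r, s, k)) = cis (2 * pi * qc (gd (an (r, s, k))))"
      by (simp add: mutual_S cis_2pi_int del: of_int_add flip: cis_mult)
  qed
  show "[qc (gd (an (0, 1, 0))) = 0] (rmod 2)" using charge_an[of "(0, 1, 0)"] by (simp add: qc_def)
qed (simp_all add: abelian_an spin_S)

definition R :: "grade set" where "R = {0..<int q} \<times> {0..<int q} \<times> {0..<2}"

lemma bij_an: "bij_betw an R (anyons PC)"
  unfolding bij_betw_def
proof
  show "inj_on an R"
  proof (rule inj_onI)
    fix x y assume xy: "x \<in> R" "y \<in> R" "an x = an y"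
    obtain r s k r' s' k' where [simp]: "x = (r, s, k)" "y = (r', s', k')" by (metis prod_cases3)
    have "r mod int q = r' mod int q" "s mod int q = s' mod int q" "k mod 2 = k' mod 2"
      using xy(3) unfolding an_eq_iff by (simp_all add: K3_def mod_eq_dvd_iff)
    moreover have "r mod int q = r" "r' mod int q = r'" "s mod int q = s" "s' mod int q = s'" "k mod 2 = k" "k' mod 2 = k'"
      using xy(1,2) by (simp_all add: R_def)
    ultimately show "x = y" by simp
  qed
  have "an (r, s, k) = an (r mod int q, s mod int q, k mod 2)" for r s k
    unfolding an_eq_iff K3_diff_iff using dvd_minus_mod[of 2 k] by (simp add: dvd_minus_mod)
  moreover have "(r mod int q, s mod int q, k mod 2) \<in> R" for r s k using q by (simp add: R_def)
  ultimately have "an (r, s, k) \<in> an ` R" for r s k by (rule image_eqI)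
  then show "an ` R = anyons PC" unfolding anyons_PC by auto
qed

lemma card_R: "card R = 2 * q\<^sup>2"
  by (simp add: R_def card_cartesian_product power2_eq_square)

lemma card_anyons_PC: "card (anyons PC) = 2 * q\<^sup>2"
  using bij_betw_same_card[OF bij_an] card_R by simp

lemma qdim_PC: "x \<in> anyons PC \<Longrightarrow> qdim PC x = 1"
  using abelian_an unfolding anyons_PC abelian_def by auto

lemma root_sum: "(\<Sum>s\<in>{0..<int q}. cis (2 * pi * of_int (r * s) / of_nat q)) = (if int q dvd r then of_nat q else 0)"
proof -
  let ?z = "cis (2 * pi * of_int r / of_nat q)"
  have "(\<Sum>s\<in>{0..<int q}. cis (2 * pi * of_int (r * s) / of_nat q)) = (\<Sum>s<q. ?z ^ s)"
    by (rule sum.reindex_bij_witness[of _ int nat]) (auto simp: DeMoivre mult_ac)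
  also have "\<dots> = (if int q dvd r then of_nat q else 0)"
  proof (cases "int q dvd r")
    case True
    then show ?thesis using cis_dvd[OF q(1)] by simp
  next
    case False
    then have "?z \<noteq> 1" using cis_eq_1_dvd by blast
    moreover have "?z ^ q = 1" using cis_2pi_int[of r] q by (simp add: DeMoivre)
    ultimately show ?thesis using geometric_sum[of ?z q] False by simp
  qed
  finally show ?thesis .
qed

text \<open>A Gauss sum. For \<open>k = 1\<close> the sign of the fermion's spin cancels that of its
  charge, so summing over \<open>k\<close> gives a factor 2. The charge is independent of
  \<open>s\<close>, so the sum over \<open>s\<close> vanishes unless \<open>r = 0\<close> and is
  \<open>q\<close> there. The total \<open>2 * q\<close> equals \<open>sqrt 2\<close> times the
  total dimension \<open>sqrt (2 * q^2)\<close>.\<close>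

lemma central_S: "central_charge_relation PC (\<lambda>x. qc (gd x)) 0 0"
proof -
  have D: "total_dim PC = sqrt (2 * (real q)\<^sup>2)"
    unfolding total_dim_def using qdim_PC card_anyons_PC by simp
  have "(\<Sum>x\<in>anyons PC. complex_of_real ((qdim PC x)\<^sup>2) * (spin PC x * cis (pi * qc (gd x))))
      = (\<Sum>x\<in>anyons PC. spin PC x * cis (pi * qc (gd x)))"
    by (rule sum.cong) (simp_all add: qdim_PC)
  also have "\<dots> = (\<Sum>g\<in>R. spin PC (an g) * cis (pi * qc (gd (an g))))"
    using sum.reindex_bij_betw[OF bij_an, of "\<lambda>x. spin PC x * cis (pi * qc (gd x))"] by simp
  also have "\<dots> = (\<Sum>(r, s, k)\<in>R. cis (2 * pi * of_int (r * s) / of_nat q) * cis (pi * (of_int r * (real q + 1) / real q)))"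
  proof (rule sum.cong, rule refl)
    fix g assume "g \<in> R"
    obtain r s k where g1: "g = (r, s, k)" by (metis prod_cases3)
    then have "0 \<le> k" "k < 2" using \<open>g \<in> R\<close> by (auto simp: R_def)
    then have g: "g = (r, s, k)" "k = 0 \<or> k = 1" using g1 by auto
    have "cis (pi * qc (gd (an g))) = cis (pi * qc g)" using rcong_cis[OF charge_an] .
    also have "\<dots> = cis (pi * (of_int r * (real q + 1) / real q)) * cis (pi * of_int k)"
      by (simp add: qc_def g(1) cis_mult distrib_left)
    finally have *: "cis (pi * qc (gd (an g))) = \<dots>" .
    have kk: "cis (pi * of_int (k * k)) * cis (pi * of_int k) = 1" using g(2) by auto
    have "spin PC (an g) * cis (pi * qc (gd (an g))) = cis (2 * pi * of_int (r * s) / of_nat q) *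
        cis (pi * (of_int r * (real q + 1) / real q)) * (cis (pi * of_int (k * k)) * cis (pi * of_int k))"
      unfolding * unfolding g(1) spin_S by (simp only: mult_ac)
    then show "spin PC (an g) * cis (pi * qc (gd (an g))) = (case g of (r, s, k) \<Rightarrow>
        cis (2 * pi * of_int (r * s) / of_nat q) * cis (pi * (of_int r * (real q + 1) / real q)))"
      unfolding kk unfolding g(1) by simp
  qed
  also have "\<dots> = (\<Sum>r\<in>{0..<int q}. \<Sum>s\<in>{0..<int q}. \<Sum>k\<in>{0..<2::int}.
      cis (2 * pi * of_int (r * s) / of_nat q) * cis (pi * (of_int r * (real q + 1) / real q)))"
    unfolding R_def by (simp only: sum.cartesian_product split_def)
  also have "\<dots> = (\<Sum>r\<in>{0..<int q}. 2 * (if int q dvd r then of_nat q else 0) * cis (pi * (of_int r * (real q + 1) / real q)))"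
    unfolding root_sum[symmetric] sum_distrib_left sum_distrib_right by (simp add: mult.assoc)
  also have "\<dots> = (\<Sum>r\<in>{0..<int q}. if r = 0 then 2 * of_nat q else 0)"
  proof (rule sum.cong[OF refl])
    fix r assume r: "r \<in> {0..<int q}"
    then have "int q dvd r \<longleftrightarrow> r = 0" using zdvd_imp_le[of "int q" r] by (cases "r = 0") auto
    then show "2 * (if int q dvd r then of_nat q else 0) * cis (pi * (of_int r * (real q + 1) / real q))
        = (if r = 0 then 2 * of_nat q else 0)" by simp
  qed
  also have "\<dots> = 2 * of_nat q" using q by simp
  finally have sum: "(\<Sum>x\<in>anyons PC. complex_of_real ((qdim PC x)\<^sup>2) * (spin PC x * cis (pi * qc (gd x)))) = 2 * of_nat q" .
  have "sqrt 2 * total_dim PC = 2 * real q" unfolding D by (simp add: real_sqrt_mult)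
  then show ?thesis unfolding central_charge_relation_def sum using q by simp
qed

lemma flip_K: "flip g - flip h \<in> K3 q \<longleftrightarrow> g - h \<in> K3 q"
proof -
  obtain r s k r' s' k' where [simp]: "g = (r, s, k)" "h = (r', s', k')" by (metis prod_cases3)
  have "int q dvd - s - - s' \<longleftrightarrow> int q dvd s - s'" using dvd_minus_iff[of "int q" "s - s'"] by simp
  then show ?thesis by (simp add: flip_def K3_def)
qed

lemma flip_add: "flip (g + h) = flip g + flip h"
  by (cases g; cases h) (simp add: flip_def)

lemma time_rev_an: "an (flip (gd (an g))) = an (flip g)"
  unfolding an_eq_iff flip_K by (rule gd_an)

lemma flip_flip [simp]: "flip (flip g) = g"
  by (simp add: flip_def split: prod.split)

lemma time_reversal_S: "is_time_reversal PC (an (0, 0, 1)) (\<lambda>x. qc (gd x)) (\<lambda>x. an (flip (gd x)))"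
  unfolding is_time_reversal_def preserves_fusion_def
proof (intro conjI)
  show *: "\<forall>x\<in>anyons PC. an (flip (gd (an (flip (gd x))))) = x"
    unfolding anyons_ball time_rev_an by (simp add: an_gd)
  show "bij_betw (\<lambda>x. an (flip (gd x))) (anyons PC) (anyons PC)"
    by (rule bij_betwI[where g = "\<lambda>x. an (flip (gd x))"]) (use * in auto)
  show "\<forall>x\<in>anyons PC. \<forall>y\<in>anyons PC. \<forall>z\<in>anyons PC.
      fusion PC (an (flip (gd x))) (an (flip (gd y))) (an (flip (gd z))) = fusion PC x y z"
    unfolding anyons_ball time_rev_an
    by (intro allI fusion_an_cong) (simp only: flip_add[symmetric] flip_K)
  show "\<forall>x\<in>anyons PC. spin PC (an (flip (gd x))) = cnj (spin PC x)"
    unfolding anyons_ball time_rev_an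
  proof (intro allI)
    fix r s k
    \<comment> \<open>The fermionic factor of the spin is a sign, hence its own conjugate.\<close>
    have "cis (pi * of_int (k * k)) = cnj (cis (pi * of_int (k * k)))"
    proof -
      have "cis (pi * of_int (k * k)) * cis (pi * of_int (k * k)) = 1"
        unfolding cis_mult using cis_2pi_int[of "k * k"] by (simp add: algebra_simps)
      moreover have "cis (pi * of_int (k * k)) * cnj (cis (pi * of_int (k * k))) = 1"
        by (simp add: cis_cnj cis_mult)
      ultimately show ?thesis by (metis cis_neq_zero mult_left_cancel)
    qed
    then show "spin PC (an (flip (r, s, k))) = cnj (spin PC (an (r, s, k)))"
      by (simp add: flip_def spin_S cis_cnj)
  qed
  show "an (flip (gd (an (0, 0, 1)))) = an (0, 0, 1)" unfolding time_rev_an by (simp add: flip_def)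
  show "\<forall>x\<in>anyons PC. [qc (gd (an (flip (gd x)))) = qc (gd x)] (rmod 2)"
    unfolding anyons_ball time_rev_an
  proof (intro allI)
    fix r s k
    have "qc (flip (r, s, k)) = qc (r, s, k)" by (simp add: qc_def flip_def)
    then show "[qc (gd (an (flip (r, s, k)))) = qc (gd (an (r, s, k)))] (rmod 2)"
      using rcong_trans[OF charge_an[of "flip (r, s, k)"]] rcong_sym[OF charge_an[of "(r, s, k)"]] by simp
  qed
qed

lemma translation_S: "is_translation PC (an (0, 0, 1)) (\<lambda>x. qc (gd x)) (\<lambda>x. x)"
  by (simp add: is_translation_def preserves_fusion_def bij_betw_def)

lemma S_in_SET: "S \<in> SET_G (1 / real q)"
proof -
  have "[qc (gd (an (1, 0, 1))) = 1 / real q] (rmod 2)"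
  proof -
    have "qc (1, 0, 1) = 1 / real q + 2" using q by (simp add: qc_def field_simps)
    then have "[qc (1, 0, 1) = 1 / real q] (rmod 2)"
      unfolding rcong_altdef by (intro exI[of _ "-1"]) simp
    then show ?thesis using rcong_trans[OF charge_an] by blast
  qed
  moreover have "an (flip (gd (an (1, 0, 1)))) = an (1, 0, 1)"
    unfolding time_rev_an by (simp add: flip_def)
  ultimately show ?thesis
    unfolding SET_G_def S_def
    by (simp add: Let_def fermionic_S charge_S vison_S central_S time_reversal_S translation_S abelian_an an_in)
qed

lemma card_S: "card (anyons (TO S)) = 2 * q\<^sup>2"
  unfolding S_def using card_anyons_PC by simp

end

section \<open>From a minimal enriched order to the metric group\<close>

lemma (in unitary_braided_fusion_category) charge_character:
  assumes "charge_assignment C c Q" "x \<in> carrier Pic" "y \<in> carrier Pic"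
  shows "cis (pi * Q (x \<otimes>\<^bsub>Pic\<^esub> y)) = cis (pi * Q x) * cis (pi * Q y)"
proof -
  have xy: "x \<in> anyons C" "y \<in> anyons C" "x \<otimes>\<^bsub>Pic\<^esub> y \<in> anyons C"
    using assms(2,3) Pic_D(1) comm_group.axioms(2)[OF comm_group_Pic] group.is_monoid monoid.m_closed by metis+
  have "occurs_in C (x \<otimes>\<^bsub>Pic\<^esub> y) x y"
    using occurs_in_iff[OF assms(2) xy(2,3)] by (simp add: Pic_mult)
  then have "[Q (x \<otimes>\<^bsub>Pic\<^esub> y) = Q x + Q y] (rmod 2)"
    using assms(1) xy unfolding charge_assignment_def by blast
  from rcong_cis[OF this] show ?thesis by (simp add: distrib_left flip: cis_mult)
qed

theorem corollaryE4:
  fixes q :: nat and \<nu> :: real and A :: "('o, 'm) SET_data"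
  assumes "q > 0" and "odd q" and "\<nu> = 1 / real q"
    and "A \<in> mG_GSD \<nu>"
  shows "is_ZN_gauge_theory_with_fermion q (TO A) (fermion A)"
proof -
  define C where "C = TO A"
  define c where "c = fermion A"
  define Q where "Q = charge A"
  define v where "v = vison A"
  define a where "a = background A"
  define T where "T = time_rev A"
  note defs = C_def[symmetric] c_def[symmetric] Q_def[symmetric] v_def[symmetric] a_def[symmetric] T_def[symmetric]
  have A: "A \<in> SET_G \<nu>" and min: "\<And>C'. C' \<in> (SET_G \<nu> :: (nat, nat \<Rightarrow> nat \<Rightarrow> complex) SET_data set) \<Longrightarrow>
      card (anyons (TO A)) \<le> card (anyons (TO C'))"
    using assms(4) unfolding mG_GSD_def by auto
  have TOC: "fermionic_TO C c" and charge: "charge_assignment C c Q" and vison: "is_vison C Q 0 v"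
    and a: "a \<in> anyons C" "abelian C a" "[Q a = \<nu>] (rmod 2)" and T: "is_time_reversal C c Q T"
    using A unfolding SET_G_def Let_def mem_Collect_eq defs by simp_all
  interpret comp: gauge_competitor q using assms(1,2) by unfold_locales
  have card: "card (anyons C) \<le> 2 * q\<^sup>2"
    using min[OF comp.S_in_SET[folded assms(3)]] comp.card_S by (simp add: C_def)
  interpret unitary_braided_fusion_category C using TOC by (simp add: fermionic_TO_def)
  have transparent: "{x \<in> anyons C. \<forall>y\<in>anyons C. braids_trivially C x y} = {vacuum C, c}"
    and cc: "isomorphic C (tens_o C (rep c) (rep c)) (unit_o C)" and spin_c: "spin C c = - 1"
    using TOC by (simp_all add: fermionic_TO_def)
  \<comment> \<open>The fermion is its own tensor inverse, which places it in the group without any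
    computation of its dimension.\<close>
  have "c \<in> anyons C" using transparent by blast
  moreover from this have "rep c \<in> Obj C" using rep_anyon(1) simple_obj by blast
  ultimately have c: "c \<in> carrier Pic" using cc unfolding Pic_carrier invertible_def by blast
  have v: "v \<in> carrier Pic" and aP: "a \<in> carrier Pic"
    using vison a by (auto simp: Pic_iff_abelian is_vison_def)
  interpret Pic: comm_group Pic by (rule comm_group_Pic)
  let ?chi = "\<lambda>x. cis (pi * Q x)"
  interpret mg: metric_group Pic "mutual C" "spin C" ?chi q v a c
  proof
    show "mutual C x y = mutual C y x" if "x \<in> carrier Pic" "y \<in> carrier Pic" for x y
      using mutual_sym that .
    show "mutual C x (y \<otimes>\<^bsub>Pic\<^esub> z) = mutual C x y * mutual C x z"
      if "x \<in> carrier Pic" "y \<in> carrier Pic" "z \<in> carrier Pic" for x y z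
      using mutual_mult that .
    show "spin C (x \<otimes>\<^bsub>Pic\<^esub> y) = mutual C x y * spin C x * spin C y"
      if "x \<in> carrier Pic" "y \<in> carrier Pic" for x y using spin_mult that .
    show "mutual C x x = (spin C x)\<^sup>2" if "x \<in> carrier Pic" for x using mutual_self that .
    show "norm (spin C x) = 1" if "x \<in> carrier Pic" for x using spin_norm Pic_D(1)[OF that] .
    show "?chi (x \<otimes>\<^bsub>Pic\<^esub> y) = ?chi x * ?chi y" if "x \<in> carrier Pic" "y \<in> carrier Pic" for x y
      using charge_character[OF charge that] .
    show "mutual C v x = (?chi x)\<^sup>2" if "x \<in> carrier Pic" for x
      using vison Pic_D(1)[OF that] by (simp add: is_vison_def DeMoivre mult.assoc)
    show "mutual C c x = 1" if "x \<in> carrier Pic" for x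
      using transparent Pic_D(1)[OF that] braids_trivially_iff[OF c, of x] by blast
    have "[Q v = 0] (rmod 2)" "[Q c = 1] (rmod 2)"
      using vison charge by (simp_all add: is_vison_def charge_assignment_def)
    then show "?chi v = 1" "?chi c = -1" using rcong_cis[of "Q v" 0] rcong_cis[of "Q c" 1] by simp_all
    show "?chi a = cis (pi / real q)" using rcong_cis[OF a(3)] assms(3) by simp
  qed (use v aP c vison spin_c assms(1) in \<open>simp_all add: is_vison_def\<close>)
  have sub: "carrier Pic \<subseteq> anyons C" using Pic_D(1) by blast
  then have fin: "finite (carrier Pic)" using finite_anyons finite_subset by blast
  \<comment> \<open>The lower bound counts invertible classes, the upper bound counts all anyons.
    Their agreement rules out non-Abelian anyons.\<close>
  have "carrier Pic = anyons C"
    using card_seteq[OF finite_anyons sub] mg.card_ge[OF fin] card by linarith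
  note PicC = this
  interpret mmg: minimal_metric_group Pic "mutual C" "spin C" ?chi q v a c "T a"
  proof
    show "finite (carrier Pic)" by (rule fin)
    show "card (carrier Pic) \<le> 2 * q\<^sup>2" using card PicC by simp
    show "x = \<one>\<^bsub>Pic\<^esub> \<or> x = c" if x: "x \<in> carrier Pic" "\<And>y. y \<in> carrier Pic \<Longrightarrow> mutual C x y = 1" for x
    proof -
      \<comment> \<open>Transparency quantifies over all anyons, the hypothesis on \<open>x\<close>
        only over invertible ones; \<open>PicC\<close> closes the gap.\<close>
      have "x \<in> {x \<in> anyons C. \<forall>y\<in>anyons C. braids_trivially C x y}"
        using x braids_trivially_iff[OF x(1)] PicC by simp
      then show ?thesis unfolding transparent by (simp add: Pic_def)
    qed
    show "T a \<in> carrier Pic" using T a(1) PicC unfolding is_time_reversal_def bij_betw_def by blast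
    show "?chi (T a) = ?chi a" "spin C (T a) = cnj (spin C a)"
      using T a(1) rcong_cis unfolding is_time_reversal_def by blast+
    show "odd q" by fact
  qed
  obtain h where h: "h \<in> iso Pic (gauge_group q)" "\<And>x. x \<in> carrier Pic \<Longrightarrow> gauge_spin q (h x) = spin C x"
    "h c = (0, 0, 1)"
    using mmg.gauge_theory by blast
  \<comment> \<open>The product of \<open>anyon_group\<close> picks the unique anyon occurring in
    \<open>x \<times> y\<close>; it agrees with that of \<open>Pic\<close> on all anyons now that
    all are invertible.\<close>
  have "h \<in> iso (anyon_group C) (gauge_group q)"
    using h(1) anyon_group_mult PicC unfolding iso_def hom_def by (simp add: anyon_group_def)
  then show ?thesis
    unfolding is_ZN_gauge_theory_with_fermion_def defs
    using h(2,3) PicC Pic_iff_abelian by blast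
qed

end
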